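(* Let $V_1,\dots,V_l,W_1,\dots,W_l,U$ be finite dimensional $k$-vector spaces and let $T:\bigoplus_{i=1}^{l}(V_i\otimes W_i)\to U$ be a linear transformation satisfying the right omnipresent maximal rank property. For each $i=1,\dots,l$ let $X_i$ be an irreducible quasiprojective subset of $P_i$ with affine cone $C(X_i)\subset V_i\otimes W_i$, and let $X\subset P$ be the subset corresponding to $C(X_1)\times\cdots\times C(X_l)$. Assume that $\sum_{i=1}^{l}\dim C(X_i)\le\dim U$. Then $\pi_1(\pi_2^{-1}(X)\cap Y)$ is contained in a proper Zariski closed subset of $B$. (The notation $P_i$, $P$, $B$, $Y$, $\pi_1$, $\pi_2$ is defined in the context.)
   Context: $k$ is a fixed algebraically closed field; $\otimes$ and $\dim$ are over $k$. A linear map has maximal rank if it is injective or surjective. $T$ satisfies the right omnipresent maximal rank property if for every choice of subspaces $W'_i\subset W_i$, $i=1,\dots,l$, the restriction of $T$ to $\bigoplus_{i=1}^l (V_i\otimes W'_i)$ has maximal rank. Let $B=\prod_{i=1}^l\operatorname{End}_k(V_i)$, viewed as an affine space of dimension $\sum_i(\dim V_i)^2$. It acts on $\bigoplus_i (V_i\otimes W_i)$ componentwise, $\varphi_i\cdot(v_i\otimes w_i)=\varphi_i(v_i)\otimes w_i$; this gives the bilinear evaluation map $e: B\times\bigoplus_i (V_i\otimes W_i)\to\bigoplus_i (V_i\otimes W_i)$, $e(b,x)=bx$. Let $P_i$ be the projective space of one dimensional subspaces of $V_i\otimes W_i$ and $P$ the projective space of one dimensional subspaces of $\bigoplus_i (V_i\otimes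 W_i)$. Let $\pi_1:B\times P\to B$ and $\pi_2:B\times P\to P$ be the projections. $Y\subset B\times P$ is the Zariski closed subset whose affine cone is $e^{-1}(\operatorname{Ker}T)$, i.e. $(b,p)\in Y$ if and only if $T(bx)=0$ for any (equivalently every) nonzero $x$ representing $p$. For a subset $X_i\subset P_i$, its affine cone $C(X_i)$ is the union in $V_i\otimes W_i$ of the lines belonging to $X_i$. The subset $X\subset P$ corresponding to $C(X_1)\times\cdots\times C(X_l)$ is the set of lines spanned by nonzero tuples $(x_1,\dots,x_l)$ with $x_i\in C(X_i)$ for all $i$. *)

theory Defs
  imports
    "HOL-Analysis.Abstract_Topology"
    "HOL-Library.Function_Algebras"
    "HOL-Library.Extended_Nat"
    "HOL-Computational_Algebra.Polynomial"
begin

section \<open>Linear algebra on carriers\<close>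

text \<open>
  A finite family of vector spaces of varying dimension cannot be a family of types, so the
  spaces are subspaces of an ambient vector space (for instance of their direct sum).
\<close>

definition fd_space :: "('k::field \<Rightarrow> 'a::ab_group_add \<Rightarrow> 'a) \<Rightarrow> 'a set \<Rightarrow> bool" where
  "fd_space s E \<longleftrightarrow>
     vector_space s \<and> module.subspace s E \<and> (\<exists>B. finite B \<and> module.span s B = E)"

definition linear_on ::
  "('k::field \<Rightarrow> 'a::ab_group_add \<Rightarrow> 'a) \<Rightarrow> ('k \<Rightarrow> 'b::ab_group_add \<Rightarrow> 'b) \<Rightarrow> 'a set \<Rightarrow> ('a \<Rightarrow> 'b) \<Rightarrow> bool"
  where
  "linear_on s1 s2 E f \<longleftrightarrow>
     (\<forall>x\<in>E. \<forall>y\<in>E. f (x + y) = f x + f y) \<and> (\<forall>c. \<forall>x\<in>E. f (s1 c x) = s2 c (f x))"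

text \<open>Pointwise scalar multiplication; the pointwise addition is that of Function_Algebras.\<close>

definition fun_scale :: "('k \<Rightarrow> 'b \<Rightarrow> 'b) \<Rightarrow> 'k \<Rightarrow> ('a \<Rightarrow> 'b) \<Rightarrow> 'a \<Rightarrow> 'b" where
  "fun_scale s c f = (\<lambda>x. s c (f x))"

definition indexed_dsum :: "nat \<Rightarrow> (nat \<Rightarrow> 'a::zero set) \<Rightarrow> (nat \<Rightarrow> 'a) set" where
  "indexed_dsum l E = {x. (\<forall>i\<in>{1..l}. x i \<in> E i) \<and> (\<forall>i. i \<notin> {1..l} \<longrightarrow> x i = 0)}"

text \<open>Endomorphisms are extended by 0 outside the carrier, so that they form a vector space.\<close>

definition endos :: "('k::field \<Rightarrow> 'a::ab_group_add \<Rightarrow> 'a) \<Rightarrow> 'a set \<Rightarrow> ('a \<Rightarrow> 'a) set" where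
  "endos s E = {\<phi>. linear_on s s E \<phi> \<and> \<phi> ` E \<subseteq> E \<and> (\<forall>x. x \<notin> E \<longrightarrow> \<phi> x = 0)}"

definition max_rank :: "('a \<Rightarrow> 'b) \<Rightarrow> 'a set \<Rightarrow> 'b set \<Rightarrow> bool" where
  "max_rank T E U \<longleftrightarrow> inj_on T E \<or> T ` E = U"


section \<open>Tensor products\<close>

text \<open>
  The tensor of \<open>v\<close> and \<open>w\<close> is realised as the bilinear form \<open>(f, g) \<mapsto> f v * g w\<close> on pairs of
  linear functionals; the tensor product of two subspaces is the span of the tensors of their
  elements. The universal property is proved below. With functionals on the ambient spaces, the
  tensor product of \<open>V\<close> with a subspace of \<open>W\<close> is literally a subspace of that of \<open>V\<close> with \<open>W\<close>.
\<close>

type_synonym ('k, 'v, 'w) tensor = "('v \<Rightarrow> 'k) \<times> ('w \<Rightarrow> 'k) \<Rightarrow> 'k"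

abbreviation tscale :: "'k::field \<Rightarrow> ('k, 'v, 'w) tensor \<Rightarrow> ('k, 'v, 'w) tensor" where
  "tscale \<equiv> fun_scale (*)"

definition pure_tensor ::
  "('k::field \<Rightarrow> 'v::ab_group_add \<Rightarrow> 'v) \<Rightarrow> ('k \<Rightarrow> 'w::ab_group_add \<Rightarrow> 'w) \<Rightarrow> 'v \<Rightarrow> 'w
    \<Rightarrow> ('k, 'v, 'w) tensor" where
  "pure_tensor sV sW v w =
     (\<lambda>(f, g). if Vector_Spaces.linear sV (*) f \<and> Vector_Spaces.linear sW (*) g
               then f v * g w else 0)"

definition tensor_space ::
  "('k::field \<Rightarrow> 'v::ab_group_add \<Rightarrow> 'v) \<Rightarrow> ('k \<Rightarrow> 'w::ab_group_add \<Rightarrow> 'w) \<Rightarrow> 'v set \<Rightarrow> 'w set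
    \<Rightarrow> ('k, 'v, 'w) tensor set" where
  "tensor_space sV sW V W = module.span tscale {pure_tensor sV sW v w |v w. v \<in> V \<and> w \<in> W}"

text \<open>
  The endomorphism \<open>v \<otimes> w \<mapsto> \<phi> v \<otimes> w\<close>; existence and uniqueness are shown in \<open>tensor_act\<close> below.
\<close>

definition tensor_act ::
  "('k::field \<Rightarrow> 'v::ab_group_add \<Rightarrow> 'v) \<Rightarrow> ('k \<Rightarrow> 'w::ab_group_add \<Rightarrow> 'w) \<Rightarrow> 'v set \<Rightarrow> 'w set
    \<Rightarrow> ('v \<Rightarrow> 'v) \<Rightarrow> ('k, 'v, 'w) tensor \<Rightarrow> ('k, 'v, 'w) tensor" where
  "tensor_act sV sW V W \<phi> =
     (THE h. linear_on tscale tscale (tensor_space sV sW V W) h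
           \<and> (\<forall>t. t \<notin> tensor_space sV sW V W \<longrightarrow> h t = 0)
           \<and> (\<forall>v\<in>V. \<forall>w\<in>W. h (pure_tensor sV sW v w) = pure_tensor sV sW (\<phi> v) w))"

lemma vector_space_mult: "vector_space ((*) :: 'k::field \<Rightarrow> 'k \<Rightarrow> 'k)"
  by unfold_locales (auto simp: algebra_simps)

lemma vector_space_fun_scale:
  assumes "vector_space s"
  shows "vector_space (fun_scale s)"
proof -
  interpret vector_space s by fact
  show ?thesis
    by unfold_locales (auto simp: fun_scale_def fun_eq_iff scale_right_distrib scale_left_distrib)
qed

lemma vector_space_tscale: "vector_space tscale"
  by (intro vector_space_fun_scale vector_space_mult)

lemma linear_on_span_unique:
  assumes s: "vector_space s1" "vector_space s2"
    and h: "linear_on s1 s2 (module.span s1 G) h" and h': "linear_on s1 s2 (module.span s1 G) h'"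
    and G: "\<And>g. g \<in> G \<Longrightarrow> h g = h' g" and t: "t \<in> module.span s1 G"
  shows "h t = h' t"
proof -
  interpret v1: vector_space s1 by fact
  interpret v2: vector_space s2 by fact
  have "t \<in> v1.span G \<and> h t = h' t"
    using t
  proof (induction rule: v1.span_induct_alt)
    case base
    have "h 0 = h' 0"
      using h h' v1.span_zero[of G] unfolding linear_on_def
      by (metis v1.scale_zero_left v2.scale_zero_left)
    then show ?case by (simp add: v1.span_zero)
  next
    case (step c x y)
    then have "x \<in> v1.span G" "s1 c x \<in> v1.span G" "y \<in> v1.span G" "h x = h' x"
      by (auto simp: v1.span_base v1.span_scale G)
    moreover from this have "s1 c x + y \<in> v1.span G"
      by (simp add: v1.span_add)
    ultimately show ?case
      using h h' step unfolding linear_on_def by simp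
  qed
  then show ?thesis ..
qed

lemma fd_space_basis:
  assumes "fd_space s E"
  obtains B where "finite B" "B \<subseteq> E" "\<not> module.dependent s B" "module.span s B = E"
proof -
  from assms interpret vector_space s by (simp add: fd_space_def)
  from assms obtain G where G: "finite G" "span G = E" by (auto simp: fd_space_def)
  from maximal_independent_subset[of G] obtain B
    where B: "B \<subseteq> G" "independent B" "G \<subseteq> span B" by blast
  have "span B = E" using B G by (metis span_eq span_superset subset_trans)
  with B G that show ?thesis
    by (metis finite_subset span_superset)
qed

theorem tensor_space_universal:
  fixes \<beta> :: "'v::ab_group_add \<Rightarrow> 'w::ab_group_add \<Rightarrow> 'x::ab_group_add"
    and sX :: "'k::field \<Rightarrow> 'x \<Rightarrow> 'x"
  assumes V: "fd_space sV V" and W: "fd_space sW W" and X: "vector_space sX"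
    and l: "\<And>w. w \<in> W \<Longrightarrow> linear_on sV sX V (\<lambda>v. \<beta> v w)"
    and r: "\<And>v. v \<in> V \<Longrightarrow> linear_on sW sX W (\<beta> v)"
  shows "\<exists>h. linear_on tscale sX (tensor_space sV sW V W) h
           \<and> (\<forall>v\<in>V. \<forall>w\<in>W. h (pure_tensor sV sW v w) = \<beta> v w)"
proof -
  interpret V: vector_space sV using V by (simp add: fd_space_def)
  interpret W: vector_space sW using W by (simp add: fd_space_def)
  interpret X: vector_space sX by fact
  obtain A where A: "finite A" "A \<subseteq> V" "V.independent A" "V.span A = V"
    using fd_space_basis[OF V] .
  obtain C where C: "finite C" "C \<subseteq> W" "W.independent C" "W.span C = W"
    using fd_space_basis[OF W] .
  define f where "f = (\<lambda>a v. V.representation (V.extend_basis A) v a)"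
  define g where "g = (\<lambda>c w. W.representation (W.extend_basis C) w c)"
  have f: "Vector_Spaces.linear sV (*) (f a)" for a
    unfolding f_def
    by (simp add: Vector_Spaces.linear_def V.vector_space_axioms vector_space_mult
        module_hom_def module_hom_axioms_def module_iff_vector_space
        V.representation_add V.representation_scale V.independent_extend_basis A)
  have g: "Vector_Spaces.linear sW (*) (g a)" for a
    unfolding g_def
    by (simp add: Vector_Spaces.linear_def W.vector_space_axioms vector_space_mult
        module_hom_def module_hom_axioms_def module_iff_vector_space
        W.representation_add W.representation_scale W.independent_extend_basis C)
  have fv: "(\<Sum>a\<in>A. sV (f a v) a) = v" if "v \<in> V" for v
  proof -
    have "f a v = V.representation A v a" for a
      using V.representation_extend[OF V.independent_extend_basis[OF A(3)], of v A]
        V.extend_basis_superset[OF A(3)] that A(4) by (simp add: f_def)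
    with V.sum_representation_eq[OF A(3), of v A] A that show ?thesis by simp
  qed
  have gw: "(\<Sum>c\<in>C. sW (g c w) c) = w" if "w \<in> W" for w
  proof -
    have "g c w = W.representation C w c" for c
      using W.representation_extend[OF W.independent_extend_basis[OF C(3)], of w C]
        W.extend_basis_superset[OF C(3)] that C(4) by (simp add: g_def)
    with W.sum_representation_eq[OF C(3), of w C] C that show ?thesis by simp
  qed
  have lin_sum: "h (\<Sum>a\<in>S. s1 (q a) a) = (\<Sum>a\<in>S. sX (q a) (h a))"
    if "vector_space s1" "linear_on s1 sX E h" "module.subspace s1 E" "finite S" "S \<subseteq> E"
    for h and s1 :: "'k \<Rightarrow> 'y::ab_group_add \<Rightarrow> 'y" and S E q
  proof -
    interpret Y: vector_space s1 by fact
    have h0: "h 0 = 0"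
      using that(2) Y.subspace_0[OF that(3)] unfolding linear_on_def
      by (metis Y.scale_zero_left X.scale_zero_left)
    show ?thesis
      using that(4,5)
    proof (induction S)
      case empty
      then show ?case by (simp add: h0)
    next
      case (insert x S)
      then have "s1 (q x) x \<in> E" "(\<Sum>a\<in>S. s1 (q a) a) \<in> E" "x \<in> E"
        using that(3) by (auto intro!: Y.subspace_scale Y.subspace_sum)
      with insert that(2) show ?case by (simp add: linear_on_def)
    qed
  qed
  define h where "h = (\<lambda>t. \<Sum>a\<in>A. \<Sum>c\<in>C. sX (t (f a, g c)) (\<beta> a c))"
  have "linear_on tscale sX (tensor_space sV sW V W) h"
    by (simp add: linear_on_def h_def fun_scale_def X.scale_left_distrib sum.distrib
        X.scale_sum_right)
  moreover have "h (pure_tensor sV sW v w) = \<beta> v w" if v: "v \<in> V" and w: "w \<in> W" for v w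
  proof -
    have "\<beta> v w = (\<Sum>a\<in>A. sX (f a v) (\<beta> a w))"
      using lin_sum[OF V.vector_space_axioms l[OF w], of A "\<lambda>a. f a v"] V A fv[OF v]
      by (simp add: fd_space_def)
    also have "\<dots> = (\<Sum>a\<in>A. sX (f a v) (\<Sum>c\<in>C. sX (g c w) (\<beta> a c)))"
    proof (rule sum.cong[OF refl])
      fix a assume "a \<in> A"
      then have "a \<in> V" using A by blast
      then show "sX (f a v) (\<beta> a w) = sX (f a v) (\<Sum>c\<in>C. sX (g c w) (\<beta> a c))"
        using lin_sum[OF W.vector_space_axioms r, of a C "\<lambda>c. g c w"] W C gw[OF w]
        by (simp add: fd_space_def)
    qed
    also have "\<dots> = h (pure_tensor sV sW v w)"
      by (simp add: h_def pure_tensor_def f g X.scale_sum_right)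
    finally show ?thesis ..
  qed
  ultimately show ?thesis by blast
qed

lemma linear_functional:
  assumes "Vector_Spaces.linear s (*) f"
  shows "f (x + y) = f x + f y" "f (s c x) = c * f x"
proof -
  interpret Vector_Spaces.linear s "(*)" f by fact
  show "f (x + y) = f x + f y" "f (s c x) = c * f x" by (simp_all add: add scale)
qed

lemma pure_tensor_bilinear:
  shows "linear_on sV tscale UNIV (\<lambda>v. pure_tensor sV sW v w)"
    and "linear_on sW tscale UNIV (pure_tensor sV sW v)"
  by (auto simp: linear_on_def pure_tensor_def fun_scale_def fun_eq_iff linear_functional
      algebra_simps)

lemma tensor_act:
  assumes V: "fd_space sV V" and W: "fd_space sW W" and \<phi>: "\<phi> \<in> endos sV V"
  shows "linear_on tscale tscale (tensor_space sV sW V W) (tensor_act sV sW V W \<phi>)"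
    and "t \<notin> tensor_space sV sW V W \<Longrightarrow> tensor_act sV sW V W \<phi> t = 0"
    and "v \<in> V \<Longrightarrow> w \<in> W \<Longrightarrow>
      tensor_act sV sW V W \<phi> (pure_tensor sV sW v w) = pure_tensor sV sW (\<phi> v) w"
proof -
  interpret T: vector_space "tscale :: 'a \<Rightarrow> ('a, 'b, 'c) tensor \<Rightarrow> _"
    by (rule vector_space_tscale)
  let ?Q = "tensor_space sV sW V W"
  let ?P = "\<lambda>h. linear_on tscale tscale ?Q h \<and> (\<forall>t. t \<notin> ?Q \<longrightarrow> h t = 0)
           \<and> (\<forall>v\<in>V. \<forall>w\<in>W. h (pure_tensor sV sW v w) = pure_tensor sV sW (\<phi> v) w)"
  have "\<exists>h. linear_on tscale tscale ?Q h
           \<and> (\<forall>v\<in>V. \<forall>w\<in>W. h (pure_tensor sV sW v w) = pure_tensor sV sW (\<phi> v) w)"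
  proof (rule tensor_space_universal[OF V W vector_space_tscale])
    fix w show "linear_on sV tscale V (\<lambda>v. pure_tensor sV sW (\<phi> v) w)"
      using \<phi> pure_tensor_bilinear(1)[of sV sW w] by (auto simp: linear_on_def endos_def)
  next
    fix v show "linear_on sW tscale W (pure_tensor sV sW (\<phi> v))"
      using pure_tensor_bilinear(2)[of sW sV "\<phi> v"] by (auto simp: linear_on_def)
  qed
  then obtain h where h: "linear_on tscale tscale ?Q h"
      "\<And>v w. v \<in> V \<Longrightarrow> w \<in> W \<Longrightarrow> h (pure_tensor sV sW v w) = pure_tensor sV sW (\<phi> v) w"
    by blast
  have pt: "pure_tensor sV sW v w \<in> ?Q" if "v \<in> V" "w \<in> W" for v w
    unfolding tensor_space_def using that by (intro T.span_base) blast
  have ex: "?P (\<lambda>t. if t \<in> ?Q then h t else 0)"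
    using h pt unfolding linear_on_def
    by (auto simp: tensor_space_def T.span_add T.span_scale)
  have uniq: "h1 = h2" if h1: "?P h1" and h2: "?P h2" for h1 h2
  proof
    fix t
    show "h1 t = h2 t"
    proof (cases "t \<in> ?Q")
      case True
      let ?G = "{pure_tensor sV sW v w |v w. v \<in> V \<and> w \<in> W}"
      have "linear_on tscale tscale (T.span ?G) h1" "linear_on tscale tscale (T.span ?G) h2"
        using h1 h2 by (simp_all only: tensor_space_def)
      moreover have "g \<in> ?G \<Longrightarrow> h1 g = h2 g" for g
        using h1 h2 by auto
      moreover have "t \<in> T.span ?G"
        using True by (simp only: tensor_space_def)
      ultimately show ?thesis
        by (rule linear_on_span_unique[OF vector_space_tscale vector_space_tscale])
    next
      case False
      with h1 h2 show ?thesis by simp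
    qed
  qed
  have "?P (tensor_act sV sW V W \<phi>)"
    unfolding tensor_act_def by (rule theI[of ?P, OF ex]) (rule uniq[OF _ ex])
  then show "linear_on tscale tscale ?Q (tensor_act sV sW V W \<phi>)"
    and "t \<notin> ?Q \<Longrightarrow> tensor_act sV sW V W \<phi> t = 0"
    and "v \<in> V \<Longrightarrow> w \<in> W \<Longrightarrow>
      tensor_act sV sW V W \<phi> (pure_tensor sV sW v w) = pure_tensor sV sW (\<phi> v) w"
    by auto
qed


section \<open>Zariski topologies\<close>

text \<open>
  Polynomial functions on \<open>E\<close>, generated by constants and linear functionals. Their values outside
  \<open>E\<close> are irrelevant.
\<close>

inductive_set polyfun :: "('k::field \<Rightarrow> 'a::ab_group_add \<Rightarrow> 'a) \<Rightarrow> 'a set \<Rightarrow> ('a \<Rightarrow> 'k) set"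
  for s E where
  const: "(\<lambda>_. c) \<in> polyfun s E"
| lin: "linear_on s (*) E f \<Longrightarrow> f \<in> polyfun s E"
| add: "f \<in> polyfun s E \<Longrightarrow> g \<in> polyfun s E \<Longrightarrow> (\<lambda>x. f x + g x) \<in> polyfun s E"
| mult: "f \<in> polyfun s E \<Longrightarrow> g \<in> polyfun s E \<Longrightarrow> (\<lambda>x. f x * g x) \<in> polyfun s E"

inductive hom_polyfun ::
  "('k::field \<Rightarrow> 'a::ab_group_add \<Rightarrow> 'a) \<Rightarrow> 'a set \<Rightarrow> nat \<Rightarrow> ('a \<Rightarrow> 'k) \<Rightarrow> bool"
  for s E where
  const: "hom_polyfun s E 0 (\<lambda>_. c)"
| lin: "linear_on s (*) E f \<Longrightarrow> hom_polyfun s E 1 f"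
| add: "hom_polyfun s E d f \<Longrightarrow> hom_polyfun s E d g \<Longrightarrow> hom_polyfun s E d (\<lambda>x. f x + g x)"
| mult: "hom_polyfun s E d f \<Longrightarrow> hom_polyfun s E e g \<Longrightarrow> hom_polyfun s E (d + e) (\<lambda>x. f x * g x)"

definition zariski :: "('k::field \<Rightarrow> 'a::ab_group_add \<Rightarrow> 'a) \<Rightarrow> 'a set \<Rightarrow> 'a topology" where
  "zariski s E =
     topology (\<lambda>S. \<exists>F \<subseteq> polyfun s E. S = E - {x \<in> E. \<forall>f\<in>F. f x = 0})"

definition proj_space :: "('k::field \<Rightarrow> 'a::ab_group_add \<Rightarrow> 'a) \<Rightarrow> 'a set \<Rightarrow> 'a set set" where
  "proj_space s E = {module.span s {x} |x. x \<in> E \<and> x \<noteq> 0}"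

definition proj_zariski :: "('k::field \<Rightarrow> 'a::ab_group_add \<Rightarrow> 'a) \<Rightarrow> 'a set \<Rightarrow> 'a set topology" where
  "proj_zariski s E =
     topology (\<lambda>S. \<exists>F \<subseteq> {f. \<exists>d. hom_polyfun s E d f}.
       S = proj_space s E - {L \<in> proj_space s E. \<forall>f\<in>F. \<forall>x\<in>L. f x = 0})"

lemma istopology_zeros:
  assumes mult: "\<And>f g. f \<in> A \<Longrightarrow> g \<in> A \<Longrightarrow> \<exists>h\<in>A. \<forall>p\<in>E. N h p \<longleftrightarrow> N f p \<or> N g p"
  shows "istopology (\<lambda>S. \<exists>F \<subseteq> A. S = E - {p \<in> E. \<forall>f\<in>F. N f p})"
  unfolding istopology_def
proof (intro conjI allI impI)
  fix S T
  assume "\<exists>F \<subseteq> A. S = E - {p \<in> E. \<forall>f\<in>F. N f p}" "\<exists>F \<subseteq> A. T = E - {p \<in> E. \<forall>f\<in>F. N f p}"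
  then obtain F G where F: "F \<subseteq> A" "S = E - {p \<in> E. \<forall>f\<in>F. N f p}"
    and G: "G \<subseteq> A" "T = E - {p \<in> E. \<forall>f\<in>G. N f p}" by blast
  define H where "H = {h \<in> A. \<exists>f\<in>F. \<exists>g\<in>G. \<forall>p\<in>E. N h p \<longleftrightarrow> N f p \<or> N g p}"
  have "S \<inter> T = E - {p \<in> E. \<forall>h\<in>H. N h p}"
  proof (intro equalityI subsetI)
    fix p assume "p \<in> S \<inter> T"
    then obtain f g where fg: "f \<in> F" "g \<in> G" "\<not> N f p" "\<not> N g p" "p \<in> E"
      using F G by blast
    then obtain h where "h \<in> A" "\<forall>p\<in>E. N h p \<longleftrightarrow> N f p \<or> N g p"
      using mult F G by blast
    with fg have "h \<in> H" "\<not> N h p" by (auto simp: H_def)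
    with fg show "p \<in> E - {p \<in> E. \<forall>h\<in>H. N h p}" by blast
  next
    fix p assume "p \<in> E - {p \<in> E. \<forall>h\<in>H. N h p}"
    then obtain h where "p \<in> E" "h \<in> H" "\<not> N h p" by blast
    then show "p \<in> S \<inter> T" unfolding F G H_def by blast
  qed
  then show "\<exists>H \<subseteq> A. S \<inter> T = E - {p \<in> E. \<forall>f\<in>H. N f p}"
    by (intro exI[of _ H]) (auto simp: H_def)
next
  fix K assume "\<forall>S\<in>K. \<exists>F \<subseteq> A. S = E - {p \<in> E. \<forall>f\<in>F. N f p}"
  then obtain F where F: "\<And>S. S \<in> K \<Longrightarrow> F S \<subseteq> A \<and> S = E - {p \<in> E. \<forall>f\<in>F S. N f p}"
    by metis
  then have "\<Union>K = E - {p \<in> E. \<forall>f\<in>\<Union>(F ` K). N f p}"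
    by blast
  with F show "\<exists>F \<subseteq> A. \<Union>K = E - {p \<in> E. \<forall>f\<in>F. N f p}"
    by (intro exI[of _ "\<Union>(F ` K)"]) blast
qed

lemma closedin_zeros:
  assumes X: "openin X = (\<lambda>S. \<exists>F \<subseteq> A. S = E - {p \<in> E. \<forall>f\<in>F. N f p})"
    and u: "u \<in> A" "\<And>p. p \<in> E \<Longrightarrow> \<not> N u p"
  shows "topspace X = E" and "closedin X Z \<longleftrightarrow> (\<exists>F \<subseteq> A. Z = {p \<in> E. \<forall>f\<in>F. N f p})"
proof -
  have "openin X E"
    unfolding X using u by (intro exI[of _ "{u}"]) auto
  then show *: "topspace X = E"
    unfolding topspace_def X by blast
  show "closedin X Z \<longleftrightarrow> (\<exists>F \<subseteq> A. Z = {p \<in> E. \<forall>f\<in>F. N f p})"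
    unfolding closedin_def * X by blast
qed

lemma
  shows topspace_zariski: "topspace (zariski s E) = E"
    and closedin_zariski: "closedin (zariski s E) Z \<longleftrightarrow>
      (\<exists>F \<subseteq> polyfun s E. Z = {x \<in> E. \<forall>f\<in>F. f x = 0})"
proof -
  have "istopology (\<lambda>S. \<exists>F \<subseteq> polyfun s E. S = E - {x \<in> E. \<forall>f\<in>F. f x = 0})"
    by (rule istopology_zeros[where N = "\<lambda>f x. f x = 0"])
      (rule bexI[OF _ polyfun.mult], rule ballI, rule mult_eq_0_iff)
  then have "openin (zariski s E) = (\<lambda>S. \<exists>F \<subseteq> polyfun s E. S = E - {x \<in> E. \<forall>f\<in>F. f x = 0})"
    unfolding zariski_def by (rule topology_inverse')
  from closedin_zeros[where N = "\<lambda>f x. f x = 0", OF this polyfun.const[of 1]]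
  show "topspace (zariski s E) = E" "closedin (zariski s E) Z \<longleftrightarrow>
      (\<exists>F \<subseteq> polyfun s E. Z = {x \<in> E. \<forall>f\<in>F. f x = 0})" by simp_all
qed

lemma hom_polyfun_scale:
  assumes "hom_polyfun s E d f" "x \<in> E"
  shows "f (s c x) = c ^ d * f x"
  using assms(1)
  by (induction) (use assms(2) in \<open>auto simp: linear_on_def algebra_simps power_add\<close>)

lemma
  assumes s: "vector_space s" and E: "module.subspace s E"
  shows topspace_proj_zariski: "topspace (proj_zariski s E) = proj_space s E"
    and closedin_proj_zariski: "closedin (proj_zariski s E) Z \<longleftrightarrow>
      (\<exists>F \<subseteq> {f. \<exists>d. hom_polyfun s E d f}. Z = {L \<in> proj_space s E. \<forall>f\<in>F. \<forall>x\<in>L. f x = 0})"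
proof -
  interpret vector_space s by fact
  let ?A = "{f. \<exists>d. hom_polyfun s E d f}"
  have line: "(\<forall>y\<in>span {x}. f y = 0) \<longleftrightarrow> f x = 0" if "f \<in> ?A" "x \<in> E" for f x
  proof -
    from that obtain d where d: "hom_polyfun s E d f" by blast
    have "f y = 0" if "y \<in> span {x}" "f x = 0" for y
      using that hom_polyfun_scale[OF d \<open>x \<in> E\<close>] by (auto simp: span_singleton)
    then show ?thesis by (auto intro: span_base)
  qed
  have mult: "\<exists>h\<in>?A. \<forall>L\<in>proj_space s E. (\<forall>x\<in>L. h x = 0) \<longleftrightarrow> (\<forall>x\<in>L. f x = 0) \<or> (\<forall>x\<in>L. g x = 0)"
    if f: "f \<in> ?A" and g: "g \<in> ?A" for f g
  proof (intro bexI ballI)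
    show h: "(\<lambda>x. f x * g x) \<in> ?A" using f g hom_polyfun.mult by blast
    fix L assume "L \<in> proj_space s E"
    then obtain x where "x \<in> E" "L = span {x}" by (auto simp: proj_space_def)
    with line[OF f] line[OF g] line[OF h]
    show "(\<forall>x\<in>L. f x * g x = 0) \<longleftrightarrow> (\<forall>x\<in>L. f x = 0) \<or> (\<forall>x\<in>L. g x = 0)" by simp
  qed
  have "istopology (\<lambda>S. \<exists>F \<subseteq> ?A. S = proj_space s E - {L \<in> proj_space s E. \<forall>f\<in>F. \<forall>x\<in>L. f x = 0})"
    by (rule istopology_zeros[where N = "\<lambda>f L. \<forall>x\<in>L. f x = 0"]) (fact mult)
  then have *: "openin (proj_zariski s E) =
      (\<lambda>S. \<exists>F \<subseteq> ?A. S = proj_space s E - {L \<in> proj_space s E. \<forall>f\<in>F. \<forall>x\<in>L. f x = 0})"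
    unfolding proj_zariski_def by (rule topology_inverse')
  have u: "(\<lambda>_. 1) \<in> ?A" using hom_polyfun.const[of s E 1] by blast
  have n: "\<not> (\<forall>x\<in>L. (1::'a) = 0)" if "L \<in> proj_space s E" for L
    using that by (auto simp: proj_space_def intro: span_zero)
  from closedin_zeros[where N = "\<lambda>f L. \<forall>x\<in>L. f x = 0", OF * u n]
  show "topspace (proj_zariski s E) = proj_space s E" "closedin (proj_zariski s E) Z \<longleftrightarrow>
      (\<exists>F \<subseteq> ?A. Z = {L \<in> proj_space s E. \<forall>f\<in>F. \<forall>x\<in>L. f x = 0})" by simp_all
qed

definition irreducible_in :: "'a topology \<Rightarrow> 'a set \<Rightarrow> bool" where
  "irreducible_in X S \<longleftrightarrow> S \<subseteq> topspace X \<and> S \<noteq> {} \<and>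
     (\<forall>A B. closedin X A \<and> closedin X B \<and> S \<subseteq> A \<union> B \<longrightarrow> S \<subseteq> A \<or> S \<subseteq> B)"

text \<open>In the Zariski topology of a projective space these are the quasiprojective subsets.\<close>

definition locally_closedin :: "'a topology \<Rightarrow> 'a set \<Rightarrow> bool" where
  "locally_closedin X S \<longleftrightarrow> (\<exists>O' Z. openin X O' \<and> closedin X Z \<and> S = O' \<inter> Z)"

text \<open>Krull dimension of a topological space; the value for the empty space (0) is not used.\<close>

definition krull_dim :: "'a topology \<Rightarrow> enat" where
  "krull_dim X = Sup {enat n |n. \<exists>Z :: nat \<Rightarrow> 'a set.
     (\<forall>i\<le>n. closedin X (Z i) \<and> irreducible_in X (Z i)) \<and> (\<forall>i<n. Z i \<subset> Z (Suc i))}"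


section \<open>The incidence variety\<close>

abbreviation dscale :: "'k::field \<Rightarrow> (nat \<Rightarrow> ('k, 'v, 'w) tensor) \<Rightarrow> nat \<Rightarrow> ('k, 'v, 'w) tensor" where
  "dscale \<equiv> fun_scale tscale"

abbreviation bscale ::
  "('k::field \<Rightarrow> 'v::ab_group_add \<Rightarrow> 'v) \<Rightarrow> 'k \<Rightarrow> (nat \<Rightarrow> 'v \<Rightarrow> 'v) \<Rightarrow> nat \<Rightarrow> 'v \<Rightarrow> 'v" where
  "bscale sV \<equiv> fun_scale (fun_scale sV)"

definition right_omnipresent_max_rank ::
  "('k::field \<Rightarrow> 'v::ab_group_add \<Rightarrow> 'v) \<Rightarrow> ('k \<Rightarrow> 'w::ab_group_add \<Rightarrow> 'w) \<Rightarrow> nat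
    \<Rightarrow> (nat \<Rightarrow> 'v set) \<Rightarrow> (nat \<Rightarrow> 'w set) \<Rightarrow> 'u set
    \<Rightarrow> ((nat \<Rightarrow> ('k, 'v, 'w) tensor) \<Rightarrow> 'u) \<Rightarrow> bool" where
  "right_omnipresent_max_rank sV sW l V W U T \<longleftrightarrow>
     (\<forall>W'. (\<forall>i\<in>{1..l}. module.subspace sW (W' i) \<and> W' i \<subseteq> W i) \<longrightarrow>
        max_rank T (indexed_dsum l (\<lambda>i. tensor_space sV sW (V i) (W' i))) U)"

definition end_prod ::
  "('k::field \<Rightarrow> 'v::ab_group_add \<Rightarrow> 'v) \<Rightarrow> nat \<Rightarrow> (nat \<Rightarrow> 'v set) \<Rightarrow> (nat \<Rightarrow> 'v \<Rightarrow> 'v) set" where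
  "end_prod sV l V = indexed_dsum l (\<lambda>i. endos sV (V i))"

definition eval_map ::
  "('k::field \<Rightarrow> 'v::ab_group_add \<Rightarrow> 'v) \<Rightarrow> ('k \<Rightarrow> 'w::ab_group_add \<Rightarrow> 'w) \<Rightarrow> nat
    \<Rightarrow> (nat \<Rightarrow> 'v set) \<Rightarrow> (nat \<Rightarrow> 'w set)
    \<Rightarrow> (nat \<Rightarrow> 'v \<Rightarrow> 'v) \<Rightarrow> (nat \<Rightarrow> ('k, 'v, 'w) tensor) \<Rightarrow> nat \<Rightarrow> ('k, 'v, 'w) tensor" where
  "eval_map sV sW l V W b x =
     (\<lambda>i. if i \<in> {1..l} then tensor_act sV sW (V i) (W i) (b i) (x i) else 0)"

definition incidence ::
  "('k::field \<Rightarrow> 'v::ab_group_add \<Rightarrow> 'v) \<Rightarrow> ('k \<Rightarrow> 'w::ab_group_add \<Rightarrow> 'w) \<Rightarrow> nat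
    \<Rightarrow> (nat \<Rightarrow> 'v set) \<Rightarrow> (nat \<Rightarrow> 'w set)
    \<Rightarrow> ((nat \<Rightarrow> ('k, 'v, 'w) tensor) \<Rightarrow> 'u::zero)
    \<Rightarrow> ((nat \<Rightarrow> 'v \<Rightarrow> 'v) \<times> (nat \<Rightarrow> ('k, 'v, 'w) tensor) set) set" where
  "incidence sV sW l V W T =
     {(b, L). b \<in> end_prod sV l V
            \<and> L \<in> proj_space dscale (indexed_dsum l (\<lambda>i. tensor_space sV sW (V i) (W i)))
            \<and> (\<forall>x\<in>L. x \<noteq> 0 \<longrightarrow> T (eval_map sV sW l V W b x) = 0)}"

text \<open>Points of a projective space are lines, as sets of vectors containing 0.\<close>

definition affine_cone :: "'a set set \<Rightarrow> 'a set" where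
  "affine_cone X = \<Union> X"

text \<open>The set of lines whose affine cone is the product of the cones over the \<open>X i\<close>.\<close>

definition proj_join ::
  "nat \<Rightarrow> (nat \<Rightarrow> ('k::field, 'v, 'w) tensor set set) \<Rightarrow> (nat \<Rightarrow> ('k, 'v, 'w) tensor) set set" where
  "proj_join l X = {module.span dscale {x} |x. x \<in> indexed_dsum l (\<lambda>i. affine_cone (X i)) \<and> x \<noteq> 0}"

end

theory Submission
  imports Defs
begin

text \<open>
  Write \<open>N = dim B\<close> and \<open>u = dim U\<close>. Fix a nonzero tuple \<open>x\<close> in the product of the cones and
  expand each \<open>x\<^sub>i\<close> along a basis of \<open>V\<^sub>i\<close>; if \<open>W'\<^sub>i\<close> is the span of the second components, then
  \<open>b \<mapsto> bx\<close> maps \<open>B\<close> onto the direct sum of the \<open>V\<^sub>i \<otimes> W'\<^sub>i\<close>. There \<open>T\<close> is injective or surjective.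
  In the first case \<open>T(bx) = 0\<close> forces some \<open>b\<^sub>i\<close> to be singular. In the second case the condition
  \<open>T(bx) = 0\<close> defines a subspace of \<open>B\<close> of codimension \<open>u\<close>, and one has to see that the union of
  these subspaces over all such \<open>x\<close> is not dense.

  This is done by counting polynomials instead of by dimension theory. Elimination expresses
  \<open>\<delta>(x) b\<close>, for \<open>b\<close> in the kernel, by \<open>N - u\<close> coordinates of \<open>b\<close> and polynomials in \<open>x\<close>; one of
  these coordinates can be normalised to 1, and the scalar lost in this way is recovered by
  rescaling \<open>x\<close>. The polynomials of degree at most \<open>n\<close> on the product of the cones form a space of
  dimension \<open>O(n\<^sup>u)\<close>, so that polynomials of degree at most \<open>n\<close> in \<open>\<delta>(x) b\<close> lie in a space of
  dimension \<open>O(n\<^sup>N\<^sup>-\<^sup>1)\<close>, too small for all \<open>N\<close>-variate polynomials. The singular \<open>b\<^sub>i\<close>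
  are covered by the same argument, applied to the kernels of \<open>b \<mapsto> b\<^sub>i v\<close> for \<open>v \<in> V\<^sub>i\<close>.

  The growth rate of a cone is at most its transcendence degree, and a transcendence basis yields a
  chain of primes, hence by the Nullstellensatz a chain of irreducible closed subsets of the cone.
\<close>

section \<open>Commutative algebra over a subring\<close>

text \<open>The count has no slack: the tuples \<open>x\<close> contribute \<open>u\<close>
  parameters and each kernel has dimension \<open>N - u\<close>, which adds up to \<open>N\<close>.
  Only the fact that \<open>x\<close> and its multiples share a kernel brings this down to
  \<open>N - 1\<close>. For this reason all coefficients produced by the elimination are kept
  homogeneous of one common degree \<open>D\<close> in \<open>x\<close>: passing from
  \<open>x\<close> to \<open>rx\<close> multiplies \<open>\<delta>\<close> by \<open>r ^ D\<close>,
  so a \<open>D\<close>-th root, which exists over an algebraically closed field, restores the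
  normalised coordinate once \<open>D > 0\<close>. Positivity of \<open>D\<close> comes from having
  at least one equation, that is from \<open>U\<close> being nonzero; for \<open>l > 0\<close> this
  follows from the dimension hypothesis because each cone contains a line. The singular
  \<open>b\<^sub>i\<close> show the same balance, with all of \<open>V\<^sub>i\<close> as the cone
  and dim \<open>V\<^sub>i\<close> equations. Only upper bounds for the growth enter, so of
  dimension theory a single inequality suffices: transcendence degree is at most Krull
  dimension.\<close>

definition subring_on :: "'a::comm_ring_1 set \<Rightarrow> bool" where
  "subring_on A \<longleftrightarrow> 1 \<in> A \<and> (\<forall>x\<in>A. \<forall>y\<in>A. x - y \<in> A \<and> x * y \<in> A)"

lemma subring_on_closed:
  assumes "subring_on A"
  shows "0 \<in> A" "1 \<in> A" "x \<in> A \<Longrightarrow> y \<in> A \<Longrightarrow> x - y \<in> A" "x \<in> A \<Longrightarrow> y \<in> A \<Longrightarrow> x * y \<in> A"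
    "x \<in> A \<Longrightarrow> - x \<in> A" "x \<in> A \<Longrightarrow> y \<in> A \<Longrightarrow> x + y \<in> A" "x \<in> A \<Longrightarrow> x ^ n \<in> A"
proof -
  have 1: "1 \<in> A" and *: "\<And>x y. x \<in> A \<Longrightarrow> y \<in> A \<Longrightarrow> x - y \<in> A \<and> x * y \<in> A"
    using assms by (auto simp: subring_on_def)
  have 0: "0 \<in> A" using *[of 1 1] 1 by simp
  have m: "- x \<in> A" if "x \<in> A" for x using *[of 0 x] 0 that by simp
  show "0 \<in> A" "1 \<in> A" by fact+
  show "x - y \<in> A" "x * y \<in> A" if "x \<in> A" "y \<in> A" using * that by blast+
  show "- x \<in> A" if "x \<in> A" using m that .
  show "x + y \<in> A" if "x \<in> A" "y \<in> A" using *[of x "- y"] m that by simp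
  show "x ^ n \<in> A" if "x \<in> A" using that by (induction n) (auto intro: 1 dest: *)
qed

text \<open>Rings and ideals are subsets of one ambient ring because the rings \<open>pf J\<close>,
  for varying sets \<open>J\<close> of coordinates, all lie in the ring of functions and primes are
  contracted from one to another.\<close>

definition ideal_in :: "'a::comm_ring_1 set \<Rightarrow> 'a set \<Rightarrow> bool" where
  "ideal_in R I \<longleftrightarrow> I \<subseteq> R \<and> 0 \<in> I \<and> (\<forall>x\<in>I. \<forall>y\<in>I. x + y \<in> I) \<and> (\<forall>x\<in>R. \<forall>y\<in>I. x * y \<in> I)"

lemma ideal_in_adjoin:
  assumes R: "subring_on R" and I: "ideal_in R I" and a: "a \<in> R"
  shows "ideal_in R {p + r * a |p r. p \<in> I \<and> r \<in> R}" (is "ideal_in R ?K")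
    and "I \<subseteq> {p + r * a |p r. p \<in> I \<and> r \<in> R}" and "a \<in> {p + r * a |p r. p \<in> I \<and> r \<in> R}"
proof -
  note Rc = subring_on_closed[OF R]
  have I': "I \<subseteq> R" "0 \<in> I" "\<And>x y. x \<in> I \<Longrightarrow> y \<in> I \<Longrightarrow> x + y \<in> I"
    "\<And>x y. x \<in> R \<Longrightarrow> y \<in> I \<Longrightarrow> x * y \<in> I" using I by (auto simp: ideal_in_def)
  have K: "p + r * a \<in> ?K" if "p \<in> I" "r \<in> R" for p r using that by blast
  show sub: "I \<subseteq> ?K" using K[OF _ Rc(1)] by auto
  show "a \<in> ?K" using K[OF I'(2) Rc(2)] by simp
  show "ideal_in R ?K"
    unfolding ideal_in_def
  proof (intro conjI ballI)
    show "?K \<subseteq> R" using I'(1) a by (auto intro!: Rc)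
    show "0 \<in> ?K" using sub I'(2) by blast
    fix x y assume "y \<in> ?K"
    then obtain p r where p: "y = p + r * a" "p \<in> I" "r \<in> R" by blast
    {
      assume "x \<in> ?K"
      then obtain q s where q: "x = q + s * a" "q \<in> I" "s \<in> R" by blast
      from K[OF I'(3)[OF q(2) p(2)] Rc(6)[OF q(3) p(3)]]
      show "x + y \<in> ?K" by (simp only: p(1) q(1) distrib_right add.assoc add.left_commute)
    }
    {
      assume "x \<in> R"
      from K[OF I'(4)[OF this p(2)] Rc(4)[OF this p(3)]]
      show "x * y \<in> ?K" by (simp only: p(1) distrib_left mult.assoc)
    }
  qed
qed

definition prime_in :: "'a::comm_ring_1 set \<Rightarrow> 'a set \<Rightarrow> bool" where
  "prime_in R P \<longleftrightarrow> ideal_in R P \<and> 1 \<notin> P \<and>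
     (\<forall>x\<in>R. \<forall>y\<in>R. x * y \<in> P \<longrightarrow> x \<in> P \<or> y \<in> P)"

lemma prime_inD:
  assumes "prime_in R P"
  shows "P \<subseteq> R" "0 \<in> P" "x \<in> P \<Longrightarrow> y \<in> P \<Longrightarrow> x + y \<in> P" "x \<in> R \<Longrightarrow> y \<in> P \<Longrightarrow> x * y \<in> P"
    "1 \<notin> P" "x \<in> R \<Longrightarrow> y \<in> R \<Longrightarrow> x * y \<in> P \<Longrightarrow> x \<in> P \<or> y \<in> P"
    "x \<in> R \<Longrightarrow> y \<in> P \<Longrightarrow> y * x \<in> P"
  using assms unfolding prime_in_def ideal_in_def by (auto simp: mult.commute)

lemma prime_in_uminus:
  assumes "subring_on R" "prime_in R P" "x \<in> P"
  shows "- x \<in> P"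
  using prime_inD(4)[OF assms(2), of "-1" x] subring_on_closed[OF assms(1)] assms(3) by simp

lemma prime_in_diff:
  assumes "subring_on R" "prime_in R P" "x \<in> P" "y \<in> P"
  shows "x - y \<in> P"
  using prime_inD(3)[OF assms(2) assms(3) prime_in_uminus[OF assms(1,2,4)]] by simp

lemma prime_in_power:
  assumes "subring_on R" "prime_in R P" "x \<in> R" "x ^ n \<in> P"
  shows "x \<in> P"
  using assms(4)
proof (induction n)
  case (Suc n)
  then show ?case
    using assms(3) subring_on_closed(7)[OF assms(1,3)] prime_inD(6)[OF assms(2), of x "x ^ n"] by auto
qed (use prime_inD[OF assms(2)] in simp)

lemma prime_in_restrict:
  assumes "subring_on A" "A \<subseteq> R" "prime_in R P"
  shows "prime_in A (P \<inter> A)"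
  using assms(2) prime_inD[OF assms(3)] subring_on_closed[OF assms(1)]
  unfolding prime_in_def ideal_in_def by (auto 0 4 simp: subset_iff)

text \<open>An ideal maximal among those disjoint from a multiplicative set is prime.\<close>

lemma prime_in_avoiding:
  assumes R: "subring_on R"
    and I: "ideal_in R I"
    and S: "1 \<in> S" "\<And>x y. x \<in> S \<Longrightarrow> y \<in> S \<Longrightarrow> x * y \<in> S" "I \<inter> S = {}"
  obtains P where "prime_in R P" "I \<subseteq> P" "P \<inter> S = {}"
proof -
  define \<I> where "\<I> = {K. ideal_in R K \<and> I \<subseteq> K \<and> K \<inter> S = {}}"
  note Rc = subring_on_closed[OF R]
  have "\<exists>M\<in>\<I>. \<forall>K\<in>\<I>. M \<subseteq> K \<longrightarrow> K = M"
  proof (rule subset_Zorn_nonempty)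
    have "I \<in> \<I>" unfolding \<I>_def by (intro CollectI conjI I S(3) order_refl)
    then show "\<I> \<noteq> {}" by blast
    fix \<C> assume C: "\<C> \<noteq> {}" "subset.chain \<I> \<C>"
    have add: "x + y \<in> \<Union>\<C>" if "x \<in> \<Union>\<C>" "y \<in> \<Union>\<C>" for x y
    proof -
      from that obtain K L where KL: "x \<in> K" "y \<in> L" "K \<in> \<C>" "L \<in> \<C>" by blast
      with C(2) have "K \<subseteq> L \<or> L \<subseteq> K" "K \<in> \<I>" "L \<in> \<I>" by (auto simp: subset_chain_def)
      then have "x + y \<in> K \<or> x + y \<in> L" using KL by (auto simp: \<I>_def ideal_in_def)
      with KL show ?thesis by blast
    qed
    have 1: "ideal_in R K" "I \<subseteq> K" "K \<inter> S = {}" if "K \<in> \<C>" for K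
      using C(2) that unfolding \<I>_def subset_chain_def by auto
    then have 2: "K \<subseteq> R" "0 \<in> K" "\<forall>x\<in>R. \<forall>y\<in>K. x * y \<in> K" if "K \<in> \<C>" for K
      using that by (auto simp: ideal_in_def)
    show "\<Union>\<C> \<in> \<I>"
      unfolding \<I>_def ideal_in_def
    proof (intro CollectI conjI ballI)
      show "\<Union>\<C> \<subseteq> R" "\<Union>\<C> \<inter> S = {}" using 1(3) 2(1) by blast+
      show "I \<subseteq> \<Union>\<C>" "0 \<in> \<Union>\<C>" using 1(2) 2(2) C(1) by blast+
    qed (use add 2(3) in \<open>blast+\<close>)
  qed
  then obtain P where P: "P \<in> \<I>" "\<And>K. K \<in> \<I> \<Longrightarrow> P \<subseteq> K \<Longrightarrow> K = P" by blast
  have PI: "ideal_in R P" and P': "P \<subseteq> R" "I \<subseteq> P" "P \<inter> S = {}" "\<And>x y. x \<in> P \<Longrightarrow> y \<in> P \<Longrightarrow> x + y \<in> P"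
    "\<And>x y. x \<in> R \<Longrightarrow> y \<in> P \<Longrightarrow> x * y \<in> P" using P(1) by (auto simp: \<I>_def ideal_in_def)
  have hit: "\<exists>p\<in>P. \<exists>r\<in>R. p + r * a \<in> S" if a: "a \<in> R" "a \<notin> P" for a
  proof (rule ccontr)
    assume no: "\<not> ?thesis"
    let ?K = "{p + r * a |p r. p \<in> P \<and> r \<in> R}"
    note K = ideal_in_adjoin[OF R PI a(1)]
    have "?K \<inter> S = {}" using no by blast
    then have "?K \<in> \<I>" unfolding \<I>_def using K(1,2) P'(2) by blast
    from P(2)[OF this K(2)] K(3) a(2) show False by simp
  qed
  have "prime_in R P"
    unfolding prime_in_def
  proof (intro conjI ballI impI PI)
    show "1 \<notin> P" using P' S by blast
    fix x y assume xy: "x \<in> R" "y \<in> R" "x * y \<in> P"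
    show "x \<in> P \<or> y \<in> P"
    proof (rule ccontr)
      assume "\<not> ?thesis"
      with hit xy obtain p r q s where pr: "p \<in> P" "r \<in> R" "p + r * x \<in> S"
        and qs: "q \<in> P" "s \<in> R" "q + s * y \<in> S" by metis
      have "(p + r * x) * (q + s * y) = (q + s * y) * p + ((r * x) * q + (r * s) * (x * y))"
        by (simp add: algebra_simps)
      also have "\<dots> \<in> P"
      proof -
        have "q + s * y \<in> R" "r * x \<in> R" "r * s \<in> R" using pr qs xy P'(1) by (auto intro!: Rc)
        then have "(q + s * y) * p \<in> P" "r * x * q \<in> P" "r * s * (x * y) \<in> P"
          using P'(5) pr qs xy by blast+
        then show ?thesis using P'(4) by blast
      qed
      finally show False using S(2)[OF pr(3) qs(3)] P'(3) by blast
    qed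
  qed
  with P' that show ?thesis by blast
qed

text \<open>Besides subrings, \<open>A\<close> may be an ideal: \<open>over P F\<close> says that
  \<open>F\<close> is zero modulo \<open>P\<close>.\<close>

definition over :: "'a::comm_ring_1 set \<Rightarrow> 'a poly \<Rightarrow> bool" where
  "over A F \<longleftrightarrow> (\<forall>i. coeff F i \<in> A)"

lemma sum_closed:
  assumes "0 \<in> A" "\<And>x y. x \<in> A \<Longrightarrow> y \<in> A \<Longrightarrow> x + y \<in> A" "\<And>i. i \<in> I \<Longrightarrow> f i \<in> A"
  shows "sum f I \<in> A"
  using assms(3) by (induction I rule: infinite_finite_induct) (auto intro: assms)

lemma over_closed:
  assumes "subring_on A"
  shows "over A 0" "over A F \<Longrightarrow> over A G \<Longrightarrow> over A (F + G)"
    "over A F \<Longrightarrow> over A G \<Longrightarrow> over A (F - G)" "over A F \<Longrightarrow> over A G \<Longrightarrow> over A (F * G)"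
    "a \<in> A \<Longrightarrow> over A F \<Longrightarrow> over A (smult a F)" "a \<in> A \<Longrightarrow> over A (monom a n)"
    "a \<in> A \<Longrightarrow> over A F \<Longrightarrow> over A (pCons a F)"
  using subring_on_closed[OF assms]
  by (auto simp: over_def coeff_mult coeff_pCons intro!: sum_closed split: nat.split)

lemma poly_over_ideal:
  assumes B: "subring_on B" "X \<in> B" and P: "prime_in B P" and F: "over (P \<inter> A) F"
  shows "poly F X \<in> P"
proof -
  have "over P F" using F by (auto simp: over_def)
  then show ?thesis
  proof (induction F)
    case (pCons a F)
    from pCons.prems have "coeff (pCons a F) 0 \<in> P" "coeff (pCons a F) (Suc i) \<in> P" for i
      unfolding over_def by blast+
    then have "a \<in> P" "over P F" by (auto simp: over_def)
    with pCons.IH show ?case using prime_inD[OF P] B by simp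
  qed (use prime_inD[OF P] in simp)
qed

lemma over_mult_ideal:
  assumes "prime_in A P" "over A F" "over P G"
  shows "over P (F * G)"
  using assms prime_inD[OF assms(1)] by (auto simp: over_def coeff_mult intro!: sum_closed)

text \<open>Instead of dividing by the leading coefficient of \<open>p\<close>, each reduction step
  multiplies by it; \<open>e\<close> counts these steps. The bound on \<open>degree s\<close> later
  allows a quotient to be compared with a polynomial of minimal degree.\<close>

lemma pseudo_division_over:
  assumes A: "subring_on A" and p: "over A p" "degree p > 0" and f: "over A f"
  obtains e s r where "over A s" "over A r" "smult (lead_coeff p ^ e) f = s * p + r"
    "degree r < degree p" "degree s \<le> degree f - degree p"
proof -
  note oc = over_closed[OF A] and Ac = subring_on_closed[OF A]
  have a: "lead_coeff p \<in> A" using p by (simp add: over_def)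
  have "\<exists>e s r. over A s \<and> over A r \<and> smult (lead_coeff p ^ e) f = s * p + r \<and>
    degree r < degree p \<and> degree s \<le> degree f - degree p"
    using f
  proof (induction "degree f" arbitrary: f rule: less_induct)
    case less
    show ?case
    proof (cases "degree f < degree p")
      case True
      then show ?thesis
        by (intro exI[of _ 0] exI[of _ "0 :: 'a poly"] exI[of _ f]) (auto simp: less oc)
    next
      case False
      define m where "m = monom (lead_coeff f) (degree f - degree p)"
      define f' where "f' = smult (lead_coeff p) f - m * p"
      have lf: "lead_coeff f \<in> A" using less.prems by (simp add: over_def)
      have m: "over A m" using lf by (simp add: m_def oc)
      have f': "over A f'" using less.prems p a m by (auto simp: f'_def intro!: oc)
      have "degree f' \<le> degree f"
        unfolding f'_def
      proof (rule degree_diff_le)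
        show "degree (m * p) \<le> degree f"
          using degree_mult_le[of m p] degree_monom_le[of "lead_coeff f" "degree f - degree p"] False
          by (simp add: m_def)
      qed (simp add: degree_smult_le)
      moreover have "coeff f' (degree f) = 0"
        using False by (simp add: f'_def m_def coeff_monom_mult mult.commute[of "lead_coeff f"])
      moreover have "degree f > 0" using False p by simp
      ultimately have lt: "degree f' < degree f"
        by (metis degree_0 leading_coeff_0_iff le_neq_implies_less)
      from less.hyps[OF lt f'] obtain e s r where *: "over A s" "over A r"
        "smult (lead_coeff p ^ e) f' = s * p + r" "degree r < degree p"
        "degree s \<le> degree f' - degree p" by blast
      have "smult (lead_coeff p ^ Suc e) f = smult (lead_coeff p ^ e) f' + smult (lead_coeff p ^ e) (m * p)"
        by (simp add: f'_def smult_diff_right mult.commute)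
      also have "\<dots> = (s + smult (lead_coeff p ^ e) m) * p + r"
        using *(3) by (simp add: algebra_simps)
      finally have eq: "smult (lead_coeff p ^ Suc e) f = (s + smult (lead_coeff p ^ e) m) * p + r" .
      have "degree m \<le> degree f - degree p"
        unfolding m_def by (rule degree_monom_le)
      then have "degree (s + smult (lead_coeff p ^ e) m) \<le> degree f - degree p"
        using *(5) lt degree_smult_le[of "lead_coeff p ^ e" m] by (intro degree_add_le) linarith+
      with eq * show ?thesis
        using m a by (intro exI[of _ "Suc e"] exI[of _ "s + smult (lead_coeff p ^ e) m"] exI[of _ r])
          (auto intro!: oc Ac)
    qed
  qed
  with that show ?thesis by blast
qed

text \<open>For choices of minimal degree: a polynomial that is nonzero modulo \<open>P\<close> but
  has its leading coefficient in \<open>P\<close> can be shortened, so minimality forces the leading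
  coefficient out of \<open>P\<close>.\<close>

lemma over_drop_lead:
  assumes A: "subring_on A" and P: "P \<subseteq> A" "0 \<in> P" and p: "over A p" "\<not> over P p" "lead_coeff p \<in> P"
  shows "over A (p - monom (lead_coeff p) (degree p))" "\<not> over P (p - monom (lead_coeff p) (degree p))"
    "degree (p - monom (lead_coeff p) (degree p)) < degree p"
proof -
  let ?q = "p - monom (lead_coeff p) (degree p)"
  show "over A ?q" using p(1,3) P by (intro over_closed[OF A]) auto
  have co: "coeff ?q i = (if i = degree p then 0 else coeff p i)" for i by simp
  from p(2) obtain i where i: "coeff p i \<notin> P" by (auto simp: over_def)
  with p(3) have "i \<noteq> degree p" by auto
  moreover from i P have "coeff p i \<noteq> 0" by auto
  ultimately have lt: "i < degree p" using le_degree[of p i] by simp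
  show "\<not> over P ?q" unfolding over_def co using i lt by (metis less_irrefl)
  have "degree ?q \<le> degree p" by (rule degree_diff_le) (auto simp: degree_monom_le)
  moreover have "coeff ?q (degree p) = 0" by simp
  ultimately show "degree ?q < degree p"
    using lt by (metis degree_0 leading_coeff_0_iff le_neq_implies_less not_less_zero gr0I)
qed

text \<open>
  For a prime \<open>P\<close> of \<open>A[X]\<close>, either \<open>X\<close> is transcendental over \<open>A\<close> modulo \<open>P\<close>, or, after inverting
  a leading coefficient, \<open>P\<close> is generated by its elements over \<open>A\<close> and a polynomial of minimal
  degree. In the latter case Bezout's identity shows that an element outside \<open>P\<close> divides, modulo
  \<open>P\<close>, an element of \<open>A\<close> outside \<open>P\<close>.
\<close>

lemma prime_in_adjoin_cases:
  assumes A: "subring_on A" and B: "subring_on B" and AB: "A \<subseteq> B" and X: "X \<in> B"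
    and BX: "\<And>F. over A F \<Longrightarrow> poly F X \<in> B"
    and P: "prime_in B P"
  obtains (transcendental) "\<forall>F. over A F \<longrightarrow> poly F X \<in> P \<longrightarrow> over (P \<inter> A) F"
    | (algebraic) p where "over A p" "poly p X \<in> P" "lead_coeff p \<notin> P" "degree p > 0"
      "\<forall>f. over A f \<longrightarrow> poly f X \<in> P \<longrightarrow>
         (\<exists>e s r. over A s \<and> over (P \<inter> A) r \<and> smult (lead_coeff p ^ e) f = s * p + r)"
      "\<forall>v. over A v \<longrightarrow> poly v X \<notin> P \<longrightarrow> (\<exists>w u. over A w \<and> u \<in> A \<and> u \<notin> P \<and> poly (v * w) X - u \<in> P)"
proof (cases "\<forall>F. over A F \<longrightarrow> poly F X \<in> P \<longrightarrow> over (P \<inter> A) F")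
  case True
  with transcendental show ?thesis by blast
next
  case False
  note oc = over_closed[OF A] and Ac = subring_on_closed[OF A] and Bc = subring_on_closed[OF B]
    and Pd = prime_inD[OF P]
  have PA: "prime_in A (P \<inter> A)" by (rule prime_in_restrict[OF A AB P])
  \<comment> \<open>An element of least degree plays the role of a minimal polynomial of
    \<open>X\<close> over \<open>A\<close> modulo \<open>P\<close>.\<close>
  define \<Q> where "\<Q> = {F. over A F \<and> poly F X \<in> P \<and> \<not> over (P \<inter> A) F}"
  from False have "\<exists>p. p \<in> \<Q>" by (auto simp: \<Q>_def)
  then obtain p0 where "p0 \<in> \<Q>" ..
  from ex_has_least_nat[of "\<lambda>p. p \<in> \<Q>", OF this, of degree]
  obtain p where p: "p \<in> \<Q>" and min: "\<And>q. q \<in> \<Q> \<Longrightarrow> degree p \<le> degree q"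
    by (auto simp: \<Q>_def)
  have pA: "over A p" and pP: "poly p X \<in> P" and pN: "\<not> over (P \<inter> A) p" using p by (auto simp: \<Q>_def)
  have lcA: "lead_coeff p \<in> A" using pA by (simp add: over_def)
  have lc: "lead_coeff p \<notin> P"
  proof
    assume l: "lead_coeff p \<in> P"
    note d = over_drop_lead[OF A _ _ pA pN]
    have "poly (p - monom (lead_coeff p) (degree p)) X \<in> P"
      unfolding poly_diff poly_monom using pP l by (intro prime_in_diff[OF B P] Pd Bc X)
    then have "p - monom (lead_coeff p) (degree p) \<in> \<Q>"
      using d l lcA Pd(2) Ac(1) by (auto simp: \<Q>_def)
    with min d(3) l lcA Pd(2) Ac(1) show False by fastforce
  qed
  have deg: "degree p > 0"
  proof (rule ccontr)
    assume "\<not> ?thesis"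
    then have "poly p X = lead_coeff p" by (auto elim!: degree_eq_zeroE)
    with lc pP show False by simp
  qed
  have small: "over (P \<inter> A) r" if "over A r" "poly r X \<in> P" "degree r < degree p" for r
    using min[of r] that by (auto simp: \<Q>_def)
  have 1: "\<exists>e s r. over A s \<and> over (P \<inter> A) r \<and> smult (lead_coeff p ^ e) f = s * p + r"
    if f: "over A f" "poly f X \<in> P" for f
  proof -
    obtain e s r where *: "over A s" "over A r" "smult (lead_coeff p ^ e) f = s * p + r"
      "degree r < degree p" using pseudo_division_over[OF A pA deg f(1)] by metis
    have "r = smult (lead_coeff p ^ e) f - s * p" using *(3) by simp
    then have "poly r X = lead_coeff p ^ e * poly f X - poly s X * poly p X" by simp
    also have "\<dots> \<in> P"
      using f pP lcA AB BX[OF *(1)] by (intro prime_in_diff[OF B P] Pd Bc) auto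
    finally show ?thesis using * small by blast
  qed
  have 2: "\<exists>w u. over A w \<and> u \<in> A \<and> u \<notin> P \<and> poly (v * w) X - u \<in> P"
    if v: "over A v" "poly v X \<notin> P" for v
  proof -
    \<comment> \<open>A least-degree element among the multiples of \<open>v\<close>, modulo
      \<open>P\<close>, that stay outside \<open>P\<close> acts as a greatest common divisor of
      \<open>v\<close> and \<open>p\<close>; it turns out to be a constant \<open>u\<close>.\<close>
    define \<G> where "\<G> = {g. over A g \<and> poly g X \<notin> P \<and> (\<exists>w. over A w \<and> poly (v * w) X - poly g X \<in> P)}"
    have "over A 1" using oc(6)[OF Ac(2), of 0] by (simp add: one_pCons monom_0)
    then have "v \<in> \<G>" using v Pd(2) by (auto simp: \<G>_def intro!: exI[of _ 1])
    then have "\<exists>g. g \<in> \<G>" by blast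
    then obtain g0 where "g0 \<in> \<G>" ..
    from ex_has_least_nat[of "\<lambda>g. g \<in> \<G>", OF this, of degree]
    obtain g where g: "g \<in> \<G>" and gmin: "\<And>q. q \<in> \<G> \<Longrightarrow> degree g \<le> degree q"
      by blast
    from g obtain w where gA: "over A g" and gP: "poly g X \<notin> P" and w: "over A w"
      "poly (v * w) X - poly g X \<in> P" by (auto simp: \<G>_def)
    have gN: "\<not> over (P \<inter> A) g" using poly_over_ideal[OF B X P] gP by blast
    have lgA: "lead_coeff g \<in> A" using gA by (simp add: over_def)
    have lg: "lead_coeff g \<notin> P"
    proof
      assume l: "lead_coeff g \<in> P"
      let ?m = "monom (lead_coeff g) (degree g)"
      note d = over_drop_lead[OF A _ _ gA gN]
      have mP: "poly ?m X \<in> P" unfolding poly_monom using l by (intro Pd Bc X)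
      have "poly (g - ?m) X \<notin> P"
      proof
        assume "poly (g - ?m) X \<in> P"
        from Pd(3)[OF this mP] gP show False by simp
      qed
      moreover have "poly (v * w) X - poly (g - ?m) X \<in> P"
        using Pd(3)[OF w(2) mP] by (simp add: algebra_simps)
      ultimately have "g - ?m \<in> \<G>"
        using d l lgA Pd(2) Ac(1) w by (auto simp: \<G>_def)
      with gmin d(3) l lgA Pd(2) Ac(1) show False by fastforce
    qed
    have red: "poly r X \<in> P"
      if r: "over A r" "degree r < degree g" "over A w'" "poly (v * w') X - poly r X \<in> P" for r w'
      using gmin[of r] r by (auto simp: \<G>_def)
    have gp: "degree g < degree p"
    proof (rule ccontr)
      assume ge: "\<not> ?thesis"
      obtain e s r where *: "over A s" "over A r" "smult (lead_coeff p ^ e) g = s * p + r"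
        "degree r < degree p" using pseudo_division_over[OF A pA deg gA] by metis
      have r: "poly r X = lead_coeff p ^ e * poly g X - poly s X * poly p X"
        using arg_cong[OF *(3), of "\<lambda>f. poly f X"] by simp
      have "poly (v * smult (lead_coeff p ^ e) w) X - poly r X =
        lead_coeff p ^ e * (poly (v * w) X - poly g X) + poly s X * poly p X"
        by (simp add: r algebra_simps)
      also have "\<dots> \<in> P"
        using w pP lcA AB BX[OF *(1)] by (intro Pd Bc) auto
      finally have "poly r X \<in> P"
        using * ge w lcA by (intro red[of r "smult (lead_coeff p ^ e) w"]) (auto intro!: oc Ac)
      then have "lead_coeff p ^ e * poly g X \<in> P"
        using Pd(3)[of "poly r X" "poly s X * poly p X"] Pd(4)[OF BX[OF *(1)] pP] r by simp
      moreover have "lead_coeff p ^ e \<in> B" using lcA AB by (auto intro: Bc)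
      ultimately have "lead_coeff p ^ e \<in> P" using Pd(6) BX[OF gA] gP by blast
      then show False using prime_in_power[OF B P] lc lcA AB by blast
    qed
    have g0: "degree g = 0"
    proof (rule ccontr)
      assume "degree g \<noteq> 0"
      then have g1: "degree g > 0" by simp
      obtain e s r where *: "over A s" "over A r" "smult (lead_coeff g ^ e) p = s * g + r"
        "degree r < degree g" "degree s \<le> degree p - degree g"
        using pseudo_division_over[OF A gA g1 pA] by metis
      have r: "poly r X = lead_coeff g ^ e * poly p X - poly s X * poly g X"
        using arg_cong[OF *(3), of "\<lambda>f. poly f X"] by simp
      have "poly (v * (0 - s * w)) X - poly r X =
        - (poly s X * (poly (v * w) X - poly g X) + lead_coeff g ^ e * poly p X)"
        by (simp add: r algebra_simps)
      also have "\<dots> \<in> P"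
        using w(2) pP lgA AB BX[OF *(1)]
        by (intro prime_in_uminus[OF B P] Pd(3) Pd(4)[of "poly s X"] Pd(4)[of "lead_coeff g ^ e"] Bc(7)) auto
      finally have rP: "poly r X \<in> P"
        using * w by (intro red[of r "0 - s * w"] oc) auto
      then have rN: "over (P \<inter> A) r" using small * gp by auto
      have "poly s X * poly g X = lead_coeff g ^ e * poly p X - poly r X" by (simp add: r)
      also have "\<dots> \<in> P" using rP pP lgA AB by (intro prime_in_diff[OF B P] Pd Bc) auto
      \<comment> \<open>The cofactor \<open>s\<close> has degree below that of \<open>p\<close>, so
        minimality of \<open>p\<close> makes it zero modulo \<open>P\<close>. Then
        \<open>smult (lead_coeff g ^ e) p\<close> is zero modulo \<open>P\<close> too, although both
        leading coefficients lie outside \<open>P\<close>.\<close>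
      finally have "poly s X \<in> P" using Pd(6) BX *(1) gA gP by blast
      then have "over (P \<inter> A) s" using small *(1,5) g1 gp by (meson diff_less le_less_trans order.strict_trans)
      then have "over (P \<inter> A) (g * s)" by (rule over_mult_ideal[OF PA gA])
      then have "over (P \<inter> A) (smult (lead_coeff g ^ e) p)"
        using rN *(3) prime_inD(3)[OF PA] unfolding over_def
        by (metis coeff_add mult.commute)
      then have "lead_coeff g ^ e * lead_coeff p \<in> P"
        unfolding over_def by (metis coeff_smult IntD1)
      moreover have "lead_coeff g ^ e \<in> B" using lgA AB by (auto intro: Bc)
      ultimately have "lead_coeff g ^ e \<in> P" using Pd(6) lcA AB lc by blast
      then show False using prime_in_power[OF B P] lg lgA AB by blast
    qed
    then obtain u where u: "g = [:u:]" by (rule degree_eq_zeroE)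
    then show ?thesis using w lg lgA by auto
  qed
  show ?thesis using 1 2 by (intro algebraic[OF pA pP lc deg]) blast+
qed


section \<open>Polynomial functions and the Nullstellensatz\<close>

text \<open>Polynomials are represented by the functions they induce, and \<open>d\<close> is an
  upper bound for the degree. Multiplying in one variable at a time leaves a single product case in
  inductions.\<close>

inductive pdeg :: "'i set \<Rightarrow> nat \<Rightarrow> (('i \<Rightarrow> 'k::field) \<Rightarrow> 'k) \<Rightarrow> bool" for J where
  const: "pdeg J d (\<lambda>_. c)"
| var: "pdeg J d f \<Longrightarrow> i \<in> J \<Longrightarrow> pdeg J (Suc d) (\<lambda>z. z i * f z)"
| add: "pdeg J d f \<Longrightarrow> pdeg J d g \<Longrightarrow> pdeg J d (\<lambda>z. f z + g z)"

definition pf :: "'i set \<Rightarrow> (('i \<Rightarrow> 'k::field) \<Rightarrow> 'k) set" where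
  "pf J = {f. \<exists>d. pdeg J d f}"

lemma pdeg_mono: "pdeg J d f \<Longrightarrow> d \<le> e \<Longrightarrow> J \<subseteq> J' \<Longrightarrow> pdeg J' e f"
proof (induction arbitrary: e rule: pdeg.induct)
  case (var d f i)
  then obtain e' where "e = Suc e'" "d \<le> e'" by (cases e) auto
  with var show ?case by (auto intro!: pdeg.var)
qed (auto intro: pdeg.intros)

lemma pdeg_cmult: "pdeg J d f \<Longrightarrow> pdeg J d (\<lambda>z. c * f z)"
proof (induction rule: pdeg.induct)
  case (var d f i)
  then have "pdeg J (Suc d) (\<lambda>z. z i * (c * f z))" by (intro pdeg.var)
  then show ?case by (simp add: algebra_simps)
qed (auto simp: algebra_simps intro: pdeg.intros)

lemma pdeg_mult: "pdeg J d f \<Longrightarrow> pdeg J e g \<Longrightarrow> pdeg J (d + e) (\<lambda>z. f z * g z)"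
proof (induction rule: pdeg.induct)
  case (const d c)
  then show ?case by (intro pdeg_cmult) (auto intro: pdeg_mono)
next
  case (var d f i)
  then have "pdeg J (Suc (d + e)) (\<lambda>z. z i * (f z * g z))" by (intro pdeg.var)
  then show ?case by (simp add: algebra_simps)
next
  case (add d f g')
  then have "pdeg J (d + e) (\<lambda>z. f z * g z + g' z * g z)" by (intro pdeg.add)
  then show ?case by (simp add: algebra_simps)
qed

lemma pdeg_diff: "pdeg J d f \<Longrightarrow> pdeg J d g \<Longrightarrow> pdeg J d (\<lambda>z. f z - g z)"
  using pdeg.add[of J d f "\<lambda>z. (-1) * g z"] pdeg_cmult[of J d g "-1"] by simp

lemma pdeg_uminus: "pdeg J d f \<Longrightarrow> pdeg J d (\<lambda>z. - f z)"
  using pdeg_cmult[of J d f "-1"] by simp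

lemma pdeg_coord: "i \<in> J \<Longrightarrow> pdeg J (Suc 0) (\<lambda>z. z i)"
  using pdeg.var[OF pdeg.const[of J 0 1]] by simp

lemma pdeg_sum: "(\<And>i. i \<in> L \<Longrightarrow> pdeg J d (f i)) \<Longrightarrow> pdeg J d (\<lambda>z. \<Sum>i\<in>L. f i z)"
  by (induction L rule: infinite_finite_induct) (auto intro: pdeg.intros)

lemma pdeg_power: "pdeg J d f \<Longrightarrow> pdeg J (n * d) (\<lambda>z. f z ^ n)"
  by (induction n) (auto intro: pdeg.const pdeg_mult)

lemma pdeg_prod:
  "(\<And>i. i \<in> L \<Longrightarrow> pdeg J (d i) (f i)) \<Longrightarrow> pdeg J (\<Sum>i\<in>L. d i) (\<lambda>z. \<Prod>i\<in>L. f i z)"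
  by (induction L rule: infinite_finite_induct) (simp_all add: pdeg.const pdeg_mult)

lemma pdeg_cong: "pdeg J d f \<Longrightarrow> (\<And>j. j \<in> J \<Longrightarrow> z j = z' j) \<Longrightarrow> f z = f z'"
  by (induction rule: pdeg.induct) auto

lemma pdeg_comp:
  assumes "pdeg J d f" "\<And>j. j \<in> J \<Longrightarrow> pdeg J' e (\<lambda>z. g j z)"
  shows "pdeg J' (d * e) (\<lambda>z. f (\<lambda>j. g j z))"
  using assms(1)
proof induction
  case (var d f i)
  then show ?case using pdeg_mult[OF assms(2)[OF var(2)] var.IH] by simp
qed (auto intro: pdeg.intros)

lemma pdeg_line:
  assumes "pdeg J d f"
  shows "\<exists>F. \<forall>s. f (\<lambda>j. a j + s * v j) = poly F s"
  using assms
proof induction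
  case (const d c)
  show ?case by (intro exI[of _ "[:c:]"]) simp
next
  case (var d f i)
  then obtain F where "\<forall>s. f (\<lambda>j. a j + s * v j) = poly F s" by blast
  then show ?case by (intro exI[of _ "[:a i, v i:] * F"]) (simp add: algebra_simps)
next
  case (add d f g)
  then obtain F G where "\<forall>s. f (\<lambda>j. a j + s * v j) = poly F s"
    "\<forall>s. g (\<lambda>j. a j + s * v j) = poly G s" by blast
  then show ?case by (intro exI[of _ "F + G"]) simp
qed

lemma pf_subring: "subring_on (pf J)"
  unfolding subring_on_def
proof (intro conjI ballI)
  show "1 \<in> pf J" unfolding pf_def one_fun_def using pdeg.const by blast
  fix f g :: "('a \<Rightarrow> 'b) \<Rightarrow> 'b" assume "f \<in> pf J" "g \<in> pf J"
  then obtain d e where de: "pdeg J d f" "pdeg J e g" by (auto simp: pf_def)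
  then have "pdeg J (max d e) f" "pdeg J (max d e) g" by (auto intro: pdeg_mono)
  from pdeg_diff[OF this] show "f - g \<in> pf J" by (auto simp: pf_def fun_diff_def)
  from pdeg_mult[OF de] show "f * g \<in> pf J" by (auto simp: pf_def times_fun_def)
qed

lemmas pf_closed = subring_on_closed[OF pf_subring]

lemma pf_pdeg: "pdeg J d f \<Longrightarrow> f \<in> pf J"
  by (auto simp: pf_def)

lemma pf_coord: "i \<in> J \<Longrightarrow> (\<lambda>z. z i) \<in> pf J"
  using pf_pdeg[OF pdeg_coord] .

lemma pf_mono: "J \<subseteq> J' \<Longrightarrow> pf J \<subseteq> pf J'"
  unfolding pf_def by (auto intro: pdeg_mono)

lemma pf_cong: "f \<in> pf J \<Longrightarrow> (\<And>j. j \<in> J \<Longrightarrow> z j = z' j) \<Longrightarrow> f z = f z'"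
  unfolding pf_def using pdeg_cong by blast

lemma pf_empty: "f \<in> pf {} \<Longrightarrow> \<exists>c. f = (\<lambda>_. c)"
  by (intro exI[of _ "f undefined"] ext) (auto intro: pf_cong)

text \<open>A root of \<open>F - 1\<close> is a point where \<open>F\<close> takes the value 1, so
  algebraic closedness provides the point when \<open>F\<close> is not constant.\<close>

lemma poly_nonroot:
  fixes F :: "'k::alg_closed_field poly"
  assumes "F \<noteq> 0"
  obtains x where "poly F x \<noteq> 0"
proof (cases "degree F = 0")
  case True
  then obtain c where "F = [:c:]" by (rule degree_eq_zeroE)
  with assms that show ?thesis by auto
next
  case False
  then have "degree (F - 1) > 0"
    using degree_add_eq_left[of "-1" F] by simp
  then obtain x where "poly (F - 1) x = 0"
    using alg_closed_imp_poly_has_root by blast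
  then have "poly F x \<noteq> 0" by simp
  with that show ?thesis .
qed

text \<open>On the line through \<open>a\<close> and \<open>b\<close> both functions restrict to
  nonzero polynomials in one variable, whose product is nonzero and has a nonroot. In particular
  nonzero polynomial functions have a nonzero product.\<close>

lemma pf_common_nonzero:
  fixes f g :: "('i \<Rightarrow> 'k::alg_closed_field) \<Rightarrow> 'k"
  assumes "f \<in> pf J" "g \<in> pf J'" "f a \<noteq> 0" "g b \<noteq> 0"
  obtains z where "f z \<noteq> 0" "g z \<noteq> 0"
proof -
  let ?l = "\<lambda>s j. a j + s * (b j - a j)"
  obtain F G where F: "\<forall>s. f (?l s) = poly F s" and G: "\<forall>s. g (?l s) = poly G s"
  proof -
    from assms(1,2) obtain d e where "pdeg J d f" "pdeg J' e g" by (auto simp: pf_def)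
    from pdeg_line[OF this(1), of a "\<lambda>j. b j - a j"] pdeg_line[OF this(2), of a "\<lambda>j. b j - a j"] that
    show ?thesis by blast
  qed
  have "F \<noteq> 0" using F[rule_format, of 0] assms(3) by auto
  moreover have "G \<noteq> 0" using G[rule_format, of 1] assms(4) by auto
  ultimately have "F * G \<noteq> 0" by simp
  then obtain s where "poly (F * G) s \<noteq> 0" by (rule poly_nonroot)
  with F G that[of "?l s"] show ?thesis by simp
qed

section \<open>Adjoining one coordinate\<close>

lemma pdeg_adjoin:
  assumes "pdeg (insert j J) d f"
  shows "\<exists>F. (\<forall>i. pdeg J d (coeff F i)) \<and> degree F \<le> d \<and> f = poly F (\<lambda>z. z j)"
  using assms
proof induction
  case (const d c)
  have "pdeg J d 0" using pdeg.const[of J d 0] by (simp add: zero_fun_def)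
  then show ?case
    by (intro exI[of _ "[:\<lambda>_. c:]"]) (auto simp: coeff_pCons pdeg.const fun_eq_iff split: nat.split)
next
  case (var d f i)
  then obtain F where F: "\<forall>i. pdeg J d (coeff F i)" "degree F \<le> d" "f = poly F (\<lambda>z. z j)" by blast
  have 0: "pdeg J (Suc d) 0" using pdeg.const[of J "Suc d" 0] by (simp add: zero_fun_def)
  show ?case
  proof (cases "i = j")
    case True
    have "degree (pCons 0 F) \<le> Suc d" using F(2) degree_pCons_le[of 0 F] by linarith
    with True F 0 show ?thesis
      by (intro exI[of _ "pCons 0 F"])
        (auto simp: coeff_pCons fun_eq_iff split: nat.split intro: pdeg_mono)
  next
    case False
    with var have i: "i \<in> J" by simp
    have "degree (smult (\<lambda>z. z i) F) \<le> Suc d"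
      using F(2) degree_smult_le[of "\<lambda>z. z i" F] by linarith
    with F pdeg.var[OF _ i] show ?thesis
      by (intro exI[of _ "smult (\<lambda>z. z i) F"]) (auto simp: fun_eq_iff times_fun_def)
  qed
next
  case (add d f g)
  then obtain F G where F: "\<forall>i. pdeg J d (coeff F i)" "degree F \<le> d" "f = poly F (\<lambda>z. z j)"
    and G: "\<forall>i. pdeg J d (coeff G i)" "degree G \<le> d" "g = poly G (\<lambda>z. z j)" by blast
  then show ?case
    by (intro exI[of _ "F + G"])
      (auto simp: fun_eq_iff plus_fun_def intro: pdeg.add degree_add_le)
qed

lemma pf_adjoin:
  assumes "f \<in> pf (insert j J)"
  shows "\<exists>F. over (pf J) F \<and> f = poly F (\<lambda>z. z j)"
  using assms pdeg_adjoin[of j J _ f] unfolding pf_def over_def by blast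

lemma poly_over_pf:
  assumes "over (pf J) F"
  shows "poly F (\<lambda>z. z j) \<in> pf (insert j J)"
proof -
  have "(\<lambda>z. z j) \<in> pf (insert j J)" by (intro pf_coord) simp
  then show ?thesis
    unfolding poly_altdef using assms pf_mono[of J "insert j J"]
    by (intro sum_closed pf_closed) (auto simp: over_def)
qed

lemma poly_fun_apply: "poly F X z = poly (map_poly (\<lambda>c. c z) F) (X z)"
  by (induction F) (auto simp: map_poly_pCons)

text \<open>The coefficients do not depend on coordinate \<open>j\<close>, so moving this coordinate
  alone evaluates one fixed polynomial in one variable.\<close>

lemma poly_over_pf_upd:
  assumes "over (pf J) F" "j \<notin> J"
  shows "poly F (\<lambda>z. z j) (z(j := x)) = poly (map_poly (\<lambda>c. c z) F) x"
proof -
  have "map_poly (\<lambda>c. c (z(j := x))) F = map_poly (\<lambda>c. c z) F"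
  proof (rule poly_eqI)
    fix n
    have "coeff F n (z(j := x)) = coeff F n z"
      by (rule pf_cong[of _ J]) (use assms in \<open>auto simp: over_def\<close>)
    then show "coeff (map_poly (\<lambda>c. c (z(j := x))) F) n = coeff (map_poly (\<lambda>c. c z) F) n"
      by (simp add: coeff_map_poly)
  qed
  then show ?thesis by (simp add: poly_fun_apply)
qed

text \<open>If coordinate \<open>j\<close> is transcendental modulo \<open>P\<close>, a coefficient
  of \<open>v\<close> outside \<open>P\<close> serves as \<open>u\<close>, and any \<open>x\<close>
  off the roots of the specialised \<open>v\<close> extends the point. If it is algebraic,
  \<open>x\<close> has to be a root of the specialised \<open>p\<close>; the Bezout identity and the
  leading coefficient of \<open>p\<close> supply \<open>u\<close>.\<close>

lemma point_extension_step:
  fixes P :: "(('i \<Rightarrow> 'k::alg_closed_field) \<Rightarrow> 'k) set"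
  assumes P: "prime_in (pf (insert j J)) P" and j: "j \<notin> J"
    and v: "v \<in> pf (insert j J)" "v \<notin> P"
  obtains u where "u \<in> pf J" "u \<notin> P"
    "\<And>z. (\<And>f. f \<in> P \<inter> pf J \<Longrightarrow> f z = 0) \<Longrightarrow> u z \<noteq> 0 \<Longrightarrow>
       \<exists>x. (\<forall>f\<in>P. f (z(j := x)) = 0) \<and> v (z(j := x)) \<noteq> 0"
proof -
  let ?X = "\<lambda>z. z j :: 'k" and ?m = "\<lambda>z. map_poly (\<lambda>c. c z)"
  have X: "?X \<in> pf (insert j J)" by (intro pf_coord) simp
  obtain V where V: "over (pf J) V" "v = poly V ?X" using pf_adjoin[OF v(1)] by blast
  have ev: "poly F ?X (z(j := x)) = poly (?m z F) x" if "over (pf J) F" for F z x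
    by (rule poly_over_pf_upd[OF that j])
  have zero: "poly F ?X (z(j := x)) = 0"
    if "over (P \<inter> pf J) F" "\<And>f. f \<in> P \<inter> pf J \<Longrightarrow> f z = 0" for F z x
  proof -
    have "?m z F = 0" using that by (intro poly_eqI) (auto simp: coeff_map_poly over_def)
    then show ?thesis using that(1) by (subst ev) (auto simp: over_def)
  qed
  have AB: "pf J \<subseteq> (pf (insert j J) :: (('i \<Rightarrow> 'k) \<Rightarrow> 'k) set)" by (intro pf_mono subset_insertI)
  have BX: "over (pf J) F \<Longrightarrow> poly F ?X \<in> pf (insert j J)" for F by (rule poly_over_pf)
  show ?thesis
  proof (rule prime_in_adjoin_cases[OF pf_subring pf_subring AB X BX P])
    assume transcendental: "\<forall>F. over (pf J) F \<longrightarrow> poly F ?X \<in> P \<longrightarrow> over (P \<inter> pf J) F"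
    from poly_over_ideal[OF pf_subring X P] V v(2) have "\<not> over (P \<inter> pf J) V" by blast
    then obtain i where i: "coeff V i \<in> pf J" "coeff V i \<notin> P" using V by (auto simp: over_def)
    show ?thesis
    proof (rule that[OF i])
      fix z assume z: "\<And>f. f \<in> P \<inter> pf J \<Longrightarrow> f z = 0" "coeff V i z \<noteq> 0"
      then have "coeff (?m z V) i \<noteq> 0" by (simp add: coeff_map_poly)
      then obtain x where "poly (?m z V) x \<noteq> 0"
        using poly_nonroot[of "?m z V"] by fastforce
      moreover have "f (z(j := x)) = 0" if f: "f \<in> P" for f
      proof -
        from f prime_inD(1)[OF P] have "f \<in> pf (insert j J)" by blast
        from pf_adjoin[OF this] obtain F where F: "over (pf J) F" "f = poly F ?X" by blast
        have "over (P \<inter> pf J) F" by (rule transcendental[rule_format, OF F(1)]) (use F(2) f in simp)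
        then show ?thesis unfolding F(2) using z(1) by (rule zero)
      qed
      ultimately show "\<exists>x. (\<forall>f\<in>P. f (z(j := x)) = 0) \<and> v (z(j := x)) \<noteq> 0"
        using ev[OF V(1)] V(2) by auto
    qed
  next
    fix p
    assume algebraic: "over (pf J) p" "poly p ?X \<in> P" "lead_coeff p \<notin> P" "degree p > 0"
      "\<forall>f. over (pf J) f \<longrightarrow> poly f ?X \<in> P \<longrightarrow>
         (\<exists>e s r. over (pf J) s \<and> over (P \<inter> pf J) r \<and> smult (lead_coeff p ^ e) f = s * p + r)"
      "\<forall>v. over (pf J) v \<longrightarrow> poly v ?X \<notin> P \<longrightarrow>
         (\<exists>w u. over (pf J) w \<and> u \<in> pf J \<and> u \<notin> P \<and> poly (v * w) ?X - u \<in> P)"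
    from algebraic(6)[rule_format, of V] V v obtain w u where w: "over (pf J) w" and u: "u \<in> pf J" "u \<notin> P"
      and uw: "poly (V * w) ?X - u \<in> P" by blast
    have a: "lead_coeff p \<in> pf J" using algebraic(1) by (simp add: over_def)
    show ?thesis
    proof (rule that)
      show "u * lead_coeff p \<in> pf J" using u a by (intro pf_closed)
      show "u * lead_coeff p \<notin> P"
        using prime_inD(6)[OF P, of u "lead_coeff p"] u a algebraic(3) pf_mono[of J "insert j J"] by blast
      fix z assume z: "\<And>f. f \<in> P \<inter> pf J \<Longrightarrow> f z = 0" "(u * lead_coeff p) z \<noteq> 0"
      then have uz: "u z \<noteq> 0" and az: "lead_coeff p z \<noteq> 0" by auto
      \<comment> \<open>The leading coefficient survives at \<open>z\<close>, so the specialised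
        polynomial is not constant and has a root.\<close>
      have "coeff (?m z p) (degree p) \<noteq> 0" using az by (simp add: coeff_map_poly)
      then have "degree (?m z p) \<ge> degree p" by (rule le_degree)
      then obtain x where x: "poly (?m z p) x = 0"
        using algebraic(4) alg_closed_imp_poly_has_root[of "?m z p"] by auto
      have van: "f (z(j := x)) = 0" if f: "f \<in> P" for f
      proof -
        from f prime_inD(1)[OF P] have "f \<in> pf (insert j J)" by blast
        from pf_adjoin[OF this] obtain F where F: "over (pf J) F" "f = poly F ?X" by blast
        then have "poly F ?X \<in> P" using f by simp
        from algebraic(5)[rule_format, OF F(1) this] obtain e s r where s: "over (pf J) s" "over (P \<inter> pf J) r"
          "smult (lead_coeff p ^ e) F = s * p + r" by blast
        have "(lead_coeff p ^ e * f) (z(j := x)) = poly s ?X (z(j := x)) * poly p ?X (z(j := x))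
            + poly r ?X (z(j := x))"
          using arg_cong[OF s(3), of "\<lambda>F. poly F ?X (z(j := x))"] F by simp
        also have "\<dots> = 0" using ev[OF algebraic(1)] x zero[OF s(2) z(1)] by simp
        finally have "(lead_coeff p ^ e) (z(j := x)) = 0 \<or> f (z(j := x)) = 0" by simp
        moreover have "(lead_coeff p ^ e) (z(j := x)) = (lead_coeff p ^ e) z"
        proof (rule pf_cong[of "lead_coeff p ^ e" J])
          show "lead_coeff p ^ e \<in> pf J" by (rule pf_closed(7)[OF a])
        qed (use j in auto)
        moreover have "(lead_coeff p ^ e) z = lead_coeff p z ^ e" by (induction e) auto
        ultimately show ?thesis using az by simp
      qed
      \<comment> \<open>By the Bezout relation the value of \<open>v\<close> at the new point
        divides that of \<open>u\<close>, which is nonzero.\<close>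
      have "v (z(j := x)) * poly w ?X (z(j := x)) = u (z(j := x))"
        using van[OF uw] V by simp
      also have "\<dots> = u z" by (rule pf_cong[of u J]) (use u j in auto)
      finally have "v (z(j := x)) \<noteq> 0" using uz by auto
      with van show "\<exists>x. (\<forall>f\<in>P. f (z(j := x)) = 0) \<and> v (z(j := x)) \<noteq> 0" by blast
    qed
  qed
qed

text \<open>The coordinates in \<open>L\<close> are restored one at a time. As in Chevalley's
  theorem, the projection of the part \<open>v \<noteq> 0\<close> of the zero set of
  \<open>P\<close> contains the part \<open>u \<noteq> 0\<close> of the zero set of
  \<open>P \<inter> pf J\<close>.\<close>

lemma point_extension:
  fixes P :: "(('i \<Rightarrow> 'k::alg_closed_field) \<Rightarrow> 'k) set"
  assumes "finite L" "prime_in (pf (J \<union> L)) P" "v \<in> pf (J \<union> L)" "v \<notin> P"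
  shows "\<exists>u\<in>pf J. u \<notin> P \<and> (\<forall>z. (\<forall>f\<in>P \<inter> pf J. f z = 0) \<longrightarrow> u z \<noteq> 0 \<longrightarrow>
       (\<exists>z'. (\<forall>j\<in>J. z' j = z j) \<and> (\<forall>f\<in>P. f z' = 0) \<and> v z' \<noteq> 0))"
  using assms
proof (induction L arbitrary: P v rule: finite_induct)
  case empty
  then show ?case using prime_inD(1)[OF empty(1)] by (intro bexI[of _ v]) auto
next
  case (insert j L)
  show ?case
  proof (cases "j \<in> J \<union> L")
    case True
    then have "J \<union> insert j L = J \<union> L" by blast
    with insert show ?thesis by simp
  next
    case False
    let ?P = "P \<inter> pf (J \<union> L)"
    from insert.prems False obtain u1 where u1: "u1 \<in> pf (J \<union> L)" "u1 \<notin> P"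
      and ext: "\<And>z. (\<And>f. f \<in> ?P \<Longrightarrow> f z = 0) \<Longrightarrow> u1 z \<noteq> 0 \<Longrightarrow>
        \<exists>x. (\<forall>f\<in>P. f (z(j := x)) = 0) \<and> v (z(j := x)) \<noteq> 0"
      using point_extension_step[of j "J \<union> L" P v] by (metis Un_insert_right)
    have "prime_in (pf (J \<union> L)) ?P"
      using insert.prems(1) by (intro prime_in_restrict[OF pf_subring]) (use pf_mono[of "J \<union> L" "J \<union> insert j L"] in auto)
    from insert.IH[OF this u1(1)] u1(2) obtain u where u: "u \<in> pf J" "u \<notin> ?P"
      and uz: "\<And>z. (\<forall>f\<in>?P \<inter> pf J. f z = 0) \<Longrightarrow> u z \<noteq> 0 \<Longrightarrow>
       (\<exists>z'. (\<forall>j\<in>J. z' j = z j) \<and> (\<forall>f\<in>?P. f z' = 0) \<and> u1 z' \<noteq> 0)" by blast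
    show ?thesis
    proof (intro bexI conjI allI impI)
      show "u \<notin> P" using u pf_mono[of J "J \<union> L"] by blast
      fix z assume "\<forall>f\<in>P \<inter> pf J. f z = 0" "u z \<noteq> 0"
      with uz obtain z' where z': "\<forall>j\<in>J. z' j = z j" "\<forall>f\<in>?P. f z' = 0" "u1 z' \<noteq> 0" by blast
      with ext obtain x where x: "\<forall>f\<in>P. f (z'(j := x)) = 0" "v (z'(j := x)) \<noteq> 0" by blast
      with z' False show "\<exists>z'. (\<forall>j\<in>J. z' j = z j) \<and> (\<forall>f\<in>P. f z' = 0) \<and> v z' \<noteq> 0"
        by (intro exI[of _ "z'(j := x)"]) auto
    qed (fact u)
  qed
qed

text \<open>Projecting away all coordinates leaves only constants. A nonzero constant is a unit and
  cannot lie in \<open>P\<close>, so every point satisfies the equations from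
  \<open>P \<inter> pf {}\<close>, and \<open>u\<close> is a nonzero constant.\<close>

lemma nullstellensatz:
  fixes P :: "(('i \<Rightarrow> 'k::alg_closed_field) \<Rightarrow> 'k) set"
  assumes I: "finite I" and P: "prime_in (pf I) P" and v: "v \<in> pf I" "v \<notin> P"
  obtains z where "\<And>f. f \<in> P \<Longrightarrow> f z = 0" "v z \<noteq> 0"
proof -
  obtain u where u: "u \<in> pf {}" "u \<notin> P"
    and ext: "\<And>z. (\<forall>f\<in>P \<inter> pf {}. f z = 0) \<Longrightarrow> u z \<noteq> 0 \<Longrightarrow> (\<exists>z'. (\<forall>f\<in>P. f z' = 0) \<and> v z' \<noteq> 0)"
    using point_extension[of I "{}" P v] assms by auto
  from u prime_inD(2)[OF P] pf_empty[OF u(1)] have uz: "u z \<noteq> 0" for z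
    by (auto simp: zero_fun_def)
  have "f z = 0" if f: "f \<in> P \<inter> pf {}" for f z
  proof (rule ccontr)
    assume n: "f z \<noteq> 0"
    obtain c where c: "f = (\<lambda>_. c)" using pf_empty f by blast
    have "(\<lambda>_. inverse c) * f = 1" using n c by (simp add: times_fun_def one_fun_def)
    moreover have "(\<lambda>_. inverse c) * f \<in> P"
      using f by (intro prime_inD(4)[OF P]) (auto intro: pf_pdeg pdeg.const)
    ultimately show False using prime_inD(5)[OF P] by (simp only:)
  qed
  with ext uz that show ?thesis by blast
qed

text \<open>
  Slicing by \<open>x\<^sub>t = a\<close> for general \<open>a\<close>: some prime containing \<open>Q\<close> and \<open>x\<^sub>t - a\<close> avoids all
  \<open>p h\<^sup>k\<close> with nonzero \<open>p\<close> in the remaining independent coordinates, because by the extension of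
  points such a product is nonzero somewhere on the slice.
\<close>

lemma prime_slice:
  fixes Q :: "(('i \<Rightarrow> 'k::alg_closed_field) \<Rightarrow> 'k) set"
  assumes I: "finite I" and Q: "prime_in (pf I) Q" and h: "h \<in> pf I" "h \<notin> Q"
    and J: "insert t J \<subseteq> I" "t \<notin> J" "Q \<inter> pf (insert t J) \<subseteq> {0}"
  obtains Q' where "prime_in (pf I) Q'" "h \<notin> Q'" "Q \<subset> Q'" "Q' \<inter> pf J \<subseteq> {0}"
proof -
  let ?J = "insert t J"
  have IJ: "?J \<union> I = I" using J by blast
  obtain u where u: "u \<in> pf ?J" "u \<notin> Q"
    and ext: "\<And>z. (\<forall>f\<in>Q \<inter> pf ?J. f z = 0) \<Longrightarrow> u z \<noteq> 0 \<Longrightarrow>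
      (\<exists>z'. (\<forall>j\<in>?J. z' j = z j) \<and> (\<forall>f\<in>Q. f z' = 0) \<and> h z' \<noteq> 0)"
    using point_extension[of I ?J Q h] I Q h IJ by auto
  have "u \<noteq> 0" using u prime_inD(2)[OF Q] by blast
  then obtain z0 where z0: "u z0 \<noteq> 0" by (auto simp: fun_eq_iff)
  \<comment> \<open>The value \<open>a\<close> is read off from a point with \<open>u\<close>
    nonzero, so that \<open>u'\<close>, the restriction of \<open>u\<close> to the slice as a
    function of the coordinates in \<open>J\<close>, is not the zero function.\<close>
  define a where "a = z0 t"
  define \<tau> :: "('i \<Rightarrow> 'k) \<Rightarrow> 'k" where "\<tau> = (\<lambda>z. z t - a)"
  have \<tau>J: "\<tau> \<in> pf ?J"
    unfolding \<tau>_def by (intro pf_pdeg[of _ 1] pdeg_diff pdeg.const) (simp add: pdeg_coord)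
  then have \<tau>: "\<tau> \<in> pf I" using pf_mono[OF J(1)] by blast
  obtain d where d: "pdeg ?J d u" using u by (auto simp: pf_def)
  define u' where "u' = (\<lambda>z. u (z(t := a)))"
  have u': "u' \<in> pf J"
  proof (rule pf_pdeg)
    show "pdeg J (d * 1) u'"
      unfolding u'_def
    proof (rule pdeg_comp[OF d])
      fix j assume "j \<in> insert t J"
      then show "pdeg J 1 (\<lambda>z. (z(t := a)) j)"
        using pdeg_coord[of j J] by (cases "j = t") (auto simp: pdeg.const)
    qed
  qed
  have u'0: "u' z0 \<noteq> 0" using z0 by (simp add: u'_def a_def)
  define K where "K = {p + r * \<tau> |p r. p \<in> Q \<and> r \<in> pf I}"
  \<comment> \<open>\<open>S\<close> contains \<open>h\<close> and every nonzero function of the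
    coordinates in \<open>J\<close>; a prime disjoint from it omits \<open>h\<close> and leaves
    \<open>J\<close> independent.\<close>
  define S where "S = {p * h ^ k |p k. p \<in> pf J \<and> p \<noteq> 0}"
  note c = pf_closed and Qd = prime_inD[OF Q]
  have disj: "K \<inter> S = {}"
  proof (rule ccontr)
    assume "K \<inter> S \<noteq> {}"
    then obtain y where "y \<in> K" "y \<in> S" by blast
    then obtain f g p k where f: "f \<in> Q" "f + g * \<tau> = p * h ^ k" "p \<in> pf J" "p \<noteq> 0"
      unfolding K_def S_def by blast
    from f(4) obtain z1 where z1: "p z1 \<noteq> 0" by (auto simp: fun_eq_iff)
    obtain z where z: "p z \<noteq> 0" "u' z \<noteq> 0"
      using pf_common_nonzero[of p J u' J z1 z0] f(3) u' z1 u'0 by blast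
    let ?z = "z(t := a)"
    have "u ?z \<noteq> 0" using z by (simp add: u'_def)
    moreover have "\<forall>f\<in>Q \<inter> pf ?J. f ?z = 0" using J(3) by auto
    ultimately obtain z' where z': "\<forall>j\<in>?J. z' j = ?z j" "\<forall>f\<in>Q. f z' = 0" "h z' \<noteq> 0"
      using ext by blast
    have "p z' = p z" using z'(1) J(2) f(3) by (intro pf_cong[of p J]) auto
    moreover have "\<tau> z' = 0" using z'(1) by (simp add: \<tau>_def)
    moreover have "(h ^ k) z' = h z' ^ k" by (induction k) auto
    ultimately show False
      using arg_cong[OF f(2), of "\<lambda>f. f z'"] z z' f(1) by auto
  qed
  have "ideal_in (pf I) Q" using Q by (simp add: prime_in_def)
  note K = ideal_in_adjoin[OF pf_subring this \<tau>, folded K_def]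
  obtain Q' where Q': "prime_in (pf I) Q'" "K \<subseteq> Q'" "Q' \<inter> S = {}"
  proof (rule prime_in_avoiding[OF pf_subring K(1), of S])
    show "K \<inter> S = {}" by fact
    show "1 \<in> S" unfolding S_def using c(2)[of J]
      by (intro CollectI exI[of _ 1] exI[of _ 0]) auto
  next
    fix x y :: "('i \<Rightarrow> 'k) \<Rightarrow> 'k" assume xy: "x \<in> S" "y \<in> S"
    then obtain p k q m where pq: "x = p * h ^ k" "y = q * h ^ m" "p \<in> pf J" "q \<in> pf J" "p \<noteq> 0" "q \<noteq> 0"
      by (auto simp: S_def)
    from pq(5,6) obtain z1 z2 where z12: "p z1 \<noteq> 0" "q z2 \<noteq> 0" by (auto simp: fun_eq_iff)
    obtain z where "p z \<noteq> 0" "q z \<noteq> 0"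
      using pf_common_nonzero[of p J q J z1 z2] pq(3,4) z12 by blast
    then have "(p * q) z \<noteq> 0" by simp
    then have "p * q \<noteq> 0" by (metis zero_fun_apply)
    moreover have "x * y = (p * q) * h ^ (k + m)" using pq by (simp add: algebra_simps power_add)
    moreover have "p * q \<in> pf J" using pq by (intro c)
    ultimately show "x * y \<in> S" unfolding S_def by blast
  qed
  show ?thesis
  proof
    show "prime_in (pf I) Q'" by fact
    have "h = 1 * h ^ 1" by simp
    then have "h \<in> S" unfolding S_def using c(2)[of J] by (metis (mono_tags, lifting) mem_Collect_eq zero_neq_one)
    then show "h \<notin> Q'" using Q' by blast
    have "\<tau> (\<lambda>_. a + 1) \<noteq> 0" by (simp add: \<tau>_def)
    then have "\<tau> \<noteq> 0" by (metis zero_fun_apply)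
    with \<tau>J J(3) have "\<tau> \<notin> Q" by blast
    then show "Q \<subset> Q'" using K(2,3) Q'(2) by blast
    show "Q' \<inter> pf J \<subseteq> {0}"
    proof
      fix p assume p: "p \<in> Q' \<inter> pf J"
      have "p = p * h ^ 0" by simp
      with p Q'(3) show "p \<in> {0}" unfolding S_def by blast
    qed
  qed
qed

text \<open>Each slice uses up one independent coordinate. The primes shrink with the index and end
  in \<open>Q\<close>, so that their zero sets increase as in \<open>krull_dim\<close>; omitting
  \<open>h\<close> keeps enough of each zero set inside a set that is only locally closed.\<close>

lemma prime_chain:
  fixes Q :: "(('i \<Rightarrow> 'k::alg_closed_field) \<Rightarrow> 'k) set"
  assumes I: "finite I" and "prime_in (pf I) Q" and h: "h \<in> pf I" and "h \<notin> Q"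
    and "J \<subseteq> I" "Q \<inter> pf J \<subseteq> {0}"
  shows "\<exists>Qs. (\<forall>i\<le>card J. prime_in (pf I) (Qs i) \<and> h \<notin> Qs i \<and> Q \<subseteq> Qs i) \<and> Qs (card J) = Q \<and>
    (\<forall>i<card J. Qs (Suc i) \<subset> Qs i)"
proof -
  have "finite J" using assms(1,5) finite_subset by blast
  then show ?thesis
    using assms(2,4-6)
  proof (induction J arbitrary: Q rule: finite_induct)
    case empty
    then show ?case by (intro exI[of _ "\<lambda>_. Q"]) auto
  next
    case (insert t J)
    obtain Q' where Q': "prime_in (pf I) Q'" "h \<notin> Q'" "Q \<subset> Q'" "Q' \<inter> pf J \<subseteq> {0}"
      using prime_slice[OF I insert.prems(1) h insert.prems(2,3) insert.hyps(2) insert.prems(4)] .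
    from insert.IH[OF Q'(1,2) _ Q'(4)] insert.prems(3) obtain Qs where
      Qs: "\<forall>i\<le>card J. prime_in (pf I) (Qs i) \<and> h \<notin> Qs i \<and> Q' \<subseteq> Qs i" "Qs (card J) = Q'"
        "\<forall>i<card J. Qs (Suc i) \<subset> Qs i" by auto
    define R where "R = Qs(Suc (card J) := Q)"
    have c: "card (insert t J) = Suc (card J)" using insert.hyps by simp
    have "\<forall>i\<le>Suc (card J). prime_in (pf I) (R i) \<and> h \<notin> R i \<and> Q \<subseteq> R i"
      using Qs(1) insert.prems Q'(3) by (auto simp: R_def le_Suc_eq)
    moreover have "R (Suc (card J)) = Q" by (simp add: R_def)
    moreover have "\<forall>i<Suc (card J). R (Suc i) \<subset> R i"
      using Qs Q'(3) by (auto simp: R_def less_Suc_eq)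
    ultimately show ?case unfolding c by blast
  qed
qed


section \<open>Growth of spaces of polynomial functions\<close>

interpretation fun_vs: vector_space "fun_scale (*) :: 'k::field \<Rightarrow> ('p \<Rightarrow> 'k) \<Rightarrow> 'p \<Rightarrow> 'k"
  by (intro vector_space_fun_scale vector_space_mult)

lemma fun_span_mult:
  assumes "f \<in> fun_vs.span G" "\<And>g. g \<in> G \<Longrightarrow> (\<lambda>x. w x * g x) \<in> fun_vs.span H"
  shows "(\<lambda>x. w x * f x) \<in> fun_vs.span H"
  using assms(1)
proof (induction rule: fun_vs.span_induct_alt)
  case base
  then show ?case by (simp add: fun_vs.span_zero[unfolded zero_fun_def])
next
  case (step c g f)
  have "(\<lambda>x. w x * (fun_scale (*) c g + f) x) =
    fun_scale (*) c (\<lambda>x. w x * g x) + (\<lambda>x. w x * f x)"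
    by (simp add: fun_eq_iff fun_scale_def algebra_simps)
  also have "\<dots> \<in> fun_vs.span H"
    by (intro fun_vs.span_add fun_vs.span_scale assms(2) step)
  finally show ?case .
qed

lemma fun_span_comp:
  assumes "f \<in> fun_vs.span G"
  shows "(\<lambda>x. f (\<phi> x)) \<in> fun_vs.span ((\<lambda>g x. g (\<phi> x)) ` G)"
  using assms
proof (induction rule: fun_vs.span_induct_alt)
  case base
  then show ?case by (simp add: fun_vs.span_zero[unfolded zero_fun_def])
next
  case (step c g f)
  have "(\<lambda>x. (fun_scale (*) c g + f) (\<phi> x)) =
    fun_scale (*) c (\<lambda>x. g (\<phi> x)) + (\<lambda>x. f (\<phi> x))"
    by (simp add: fun_eq_iff fun_scale_def)
  also have "\<dots> \<in> fun_vs.span ((\<lambda>g x. g (\<phi> x)) ` G)"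
    by (rule fun_vs.span_add[OF fun_vs.span_scale[OF fun_vs.span_base[OF imageI[OF step(1)]]] step(2)])
  finally show ?case .
qed

text \<open>For the polynomials of degree at most \<open>d\<close> as \<open>Fs\<close>, the number
  \<open>K\<close> bounds the affine Hilbert function of \<open>S\<close> at
  \<open>d\<close>.\<close>

definition spanned :: "'p set \<Rightarrow> ('p \<Rightarrow> 'k::field) set \<Rightarrow> nat \<Rightarrow> bool" where
  "spanned S Fs K \<longleftrightarrow>
     (\<exists>G. finite G \<and> card G \<le> K \<and> (\<forall>f\<in>Fs. \<exists>g\<in>fun_vs.span G. \<forall>x\<in>S. f x = g x))"

lemma spanned_mono: "spanned S Fs K \<Longrightarrow> S' \<subseteq> S \<Longrightarrow> K \<le> K' \<Longrightarrow> spanned S' Fs K'"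
  unfolding spanned_def by (meson order_trans subset_iff)

lemma agree_span:
  assumes "f \<in> fun_vs.span Fs" "\<And>f. f \<in> Fs \<Longrightarrow> \<exists>g\<in>fun_vs.span G. \<forall>x\<in>S. f x = g x"
  shows "\<exists>g\<in>fun_vs.span G. \<forall>x\<in>S. f x = g x"
  using assms(1)
proof (induction rule: fun_vs.span_induct_alt)
  case base
  then show ?case using fun_vs.span_zero by blast
next
  case (step c f1 f2)
  then obtain g1 g2 where g: "g1 \<in> fun_vs.span G" "\<forall>x\<in>S. f1 x = g1 x" "g2 \<in> fun_vs.span G" "\<forall>x\<in>S. f2 x = g2 x"
    using assms(2) by blast
  then have "fun_scale (*) c g1 + g2 \<in> fun_vs.span G"
    by (intro fun_vs.span_add fun_vs.span_scale)
  moreover have "\<forall>x\<in>S. (fun_scale (*) c f1 + f2) x = (fun_scale (*) c g1 + g2) x"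
    using g by (simp add: fun_scale_def)
  ultimately show ?case by blast
qed

text \<open>The products of \<open>w\<close>, some \<open>m i\<close> and a spanning function for
  \<open>Fs\<close> span the new functions. The common factor \<open>w\<close> is there to hold the
  inverse of a denominator.\<close>

lemma spanned_adjoin:
  assumes "spanned S Fs K"
    and F: "\<And>f. f \<in> Fs' \<Longrightarrow>
      \<exists>a. (\<forall>i<s. a i \<in> Fs) \<and> (\<forall>x\<in>S. f x = w x * (\<Sum>i<(s::nat). a i x * m i x))"
  shows "spanned S Fs' (s * K)"
proof -
  from assms(1) obtain G where G: "finite G" "card G \<le> K"
    and g: "\<And>f. f \<in> Fs \<Longrightarrow> \<exists>g\<in>fun_vs.span G. \<forall>x\<in>S. f x = g x"
    unfolding spanned_def by blast
  define H where "H = (\<lambda>(i, g) x. w x * m i x * g x) ` ({..<s} \<times> G)"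
  show ?thesis
    unfolding spanned_def
  proof (intro exI[of _ H] conjI ballI)
    show "finite H" using G by (simp add: H_def)
    have "card H \<le> card ({..<s} \<times> G)" unfolding H_def using G by (intro card_image_le) simp
    then show "card H \<le> s * K" using G(2) by (simp add: card_cartesian_product) (meson le_trans mult_le_mono2)
    fix f assume "f \<in> Fs'"
    from F[OF this] obtain a where a: "\<And>i. i < s \<Longrightarrow> a i \<in> Fs"
      "\<And>x. x \<in> S \<Longrightarrow> f x = w x * (\<Sum>i<s. a i x * m i x)" by blast
    have "\<forall>i\<in>{..<s}. \<exists>g\<in>fun_vs.span G. \<forall>x\<in>S. a i x = g x" using a g by simp
    from bchoice[OF this[unfolded Bex_def]] obtain b where
      b: "\<And>i. i < s \<Longrightarrow> b i \<in> fun_vs.span G" "\<And>i x. i < s \<Longrightarrow> x \<in> S \<Longrightarrow> a i x = b i x"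
      by auto
    have "(\<lambda>x. w x * m i x * b i x) \<in> fun_vs.span H" if "i < s" for i
      using b(1)[OF that] by (rule fun_span_mult) (use that in \<open>auto simp: H_def intro!: fun_vs.span_base\<close>)
    then have "(\<Sum>i<s. (\<lambda>x. w x * m i x * b i x)) \<in> fun_vs.span H"
      by (intro fun_vs.span_sum) simp
    moreover have "(\<Sum>i\<in>T. (\<lambda>x. w x * m i x * b i x)) x = (\<Sum>i\<in>T. w x * m i x * b i x)"
      for x and T :: "nat set" by (induction T rule: infinite_finite_induct) auto
    ultimately show "\<exists>g\<in>fun_vs.span H. \<forall>x\<in>S. f x = g x"
      using a(2) b(2)
      by (intro bexI[of _ "\<Sum>i<s. (\<lambda>x. w x * m i x * b i x)"])
        (auto simp: sum_distrib_left algebra_simps intro!: sum.cong)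
  qed
qed

text \<open>Sorting the variables into two groups writes a polynomial of degree at most
  \<open>d\<close> as a combination of products \<open>p z * q z\<close> with both factors of degree
  at most \<open>d\<close>. The bounds multiply, hence exponents of growth add.\<close>

lemma spanned_prod:
  fixes S1 S2 :: "('i \<Rightarrow> 'k::field) set"
  assumes "spanned S1 {f. pdeg J1 d f} K1" "spanned S2 {f. pdeg J2 d f} K2"
  shows "spanned (S1 \<inter> S2) {f. pdeg (J1 \<union> J2) d f} (K1 * K2)"
proof -
  from assms(1) obtain G1 where G1: "finite G1" "card G1 \<le> K1"
    and g1: "\<And>f. pdeg J1 d f \<Longrightarrow> \<exists>g\<in>fun_vs.span G1. \<forall>x\<in>S1. f x = g x"
    unfolding spanned_def by blast
  from assms(2) obtain G2 where G2: "finite G2" "card G2 \<le> K2"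
    and g2: "\<And>f. pdeg J2 d f \<Longrightarrow> \<exists>g\<in>fun_vs.span G2. \<forall>x\<in>S2. f x = g x"
    unfolding spanned_def by blast
  define H where "H = (\<lambda>(g, h) x. g x * h x) ` (G1 \<times> G2)"
  define R where "R = (\<lambda>e. {\<lambda>z :: 'i \<Rightarrow> 'k. p z * q z |p q. pdeg J1 e p \<and> pdeg J2 e q})"
  have R: "f \<in> fun_vs.span (R e)" if "pdeg (J1 \<union> J2) e f" for e f
    using that
  proof induction
    case (const e c)
    have "(\<lambda>_. c) \<in> R e"
      unfolding R_def by (intro CollectI exI[of _ "\<lambda>_. c"] exI[of _ "\<lambda>_. 1"] conjI pdeg.const) simp
    then show ?case by (rule fun_vs.span_base)
  next
    case (var e f i)
    show ?case
    proof (rule fun_span_mult[OF var.IH])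
      fix g assume "g \<in> R e"
      then obtain p q where pq: "g = (\<lambda>z. p z * q z)" "pdeg J1 e p" "pdeg J2 e q" by (auto simp: R_def)
      from pq have pq': "pdeg J1 (Suc e) p" "pdeg J2 (Suc e) q" by (auto intro: pdeg_mono)
      have "(\<lambda>z. z i * g z) \<in> R (Suc e)"
      proof (cases "i \<in> J1")
        case True
        show ?thesis
          unfolding R_def using pdeg.var[OF pq(2) True] pq'(2)
          by (intro CollectI exI[of _ "\<lambda>z. z i * p z"] exI[of _ q]) (simp add: pq algebra_simps)
      next
        case False
        then have "i \<in> J2" using var.hyps by blast
        then show ?thesis
          unfolding R_def using pdeg.var[OF pq(3)] pq'(1)
          by (intro CollectI exI[of _ p] exI[of _ "\<lambda>z. z i * q z"]) (simp add: pq algebra_simps)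
      qed
      then show "(\<lambda>z. z i * g z) \<in> fun_vs.span (R (Suc e))" by (rule fun_vs.span_base)
    qed
  next
    case (add e f g)
    then show ?case using fun_vs.span_add[of f "R e" g] by (simp add: plus_fun_def)
  qed
  show ?thesis
    unfolding spanned_def
  proof (intro exI[of _ H] conjI ballI)
    show "finite H" using G1 G2 by (simp add: H_def)
    have "card H \<le> card (G1 \<times> G2)" unfolding H_def using G1 G2 by (intro card_image_le) simp
    then show "card H \<le> K1 * K2"
      using G1(2) G2(2) by (simp add: card_cartesian_product) (meson le_trans mult_le_mono)
    fix f :: "('i \<Rightarrow> 'k) \<Rightarrow> 'k" assume "f \<in> {f. pdeg (J1 \<union> J2) d f}"
    then have "f \<in> fun_vs.span (R d)" using R by blast
    then show "\<exists>g\<in>fun_vs.span H. \<forall>x\<in>S1 \<inter> S2. f x = g x"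
    proof (rule agree_span)
      fix f assume "f \<in> R d"
      then obtain p q where pq: "f = (\<lambda>z. p z * q z)" "pdeg J1 d p" "pdeg J2 d q" by (auto simp: R_def)
      from g1[OF pq(2)] g2[OF pq(3)] obtain a b where a: "a \<in> fun_vs.span G1" "\<forall>x\<in>S1. p x = a x"
        and b: "b \<in> fun_vs.span G2" "\<forall>x\<in>S2. q x = b x" by blast
      have "(\<lambda>x. g x * b x) \<in> fun_vs.span H" if "g \<in> G1" for g
        using b(1) by (rule fun_span_mult) (use that in \<open>auto simp: H_def intro!: fun_vs.span_base\<close>)
      then have "(\<lambda>x. b x * a x) \<in> fun_vs.span H"
        by (intro fun_span_mult[OF a(1)]) (simp add: mult.commute)
      then show "\<exists>g\<in>fun_vs.span H. \<forall>x\<in>S1 \<inter> S2. f x = g x"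
        by (rule bexI[rotated]) (use a b pq in auto)
    qed
  qed
qed

lemma pdeg_image:
  assumes "pdeg (\<phi> ` I) d f"
  shows "\<exists>g. pdeg I d g \<and> (\<forall>z. f z = g (\<lambda>i. z (\<phi> i)))"
  using assms
proof induction
  case (const d c)
  show ?case by (intro exI[of _ "\<lambda>_. c"]) (simp add: pdeg.const)
next
  case (var d f i)
  then obtain g j where "pdeg I d g" "\<forall>z. f z = g (\<lambda>i. z (\<phi> i))" "i = \<phi> j" "j \<in> I" by blast
  then show ?case by (intro exI[of _ "\<lambda>z. z j * g z"]) (simp add: pdeg.var)
next
  case (add d f f')
  then obtain g g' where "pdeg I d g" "\<forall>z. f z = g (\<lambda>i. z (\<phi> i))"
    "pdeg I d g'" "\<forall>z. f' z = g' (\<lambda>i. z (\<phi> i))" by blast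
  then show ?case by (intro exI[of _ "\<lambda>z. g z + g' z"]) (simp add: pdeg.add)
qed

text \<open>This renaming places factors into a common set of coordinates: by \<open>Pair a\<close>
  for a direct sum, by \<open>Inl\<close> for pairs of an \<open>x\<close> and a
  \<open>b\<close>.\<close>

lemma spanned_cylinder:
  fixes S :: "('i \<Rightarrow> 'k::field) set" and \<phi> :: "'i \<Rightarrow> 'j"
  assumes "spanned S {f. pdeg I d f} K"
  shows "spanned {z. (\<lambda>i. z (\<phi> i)) \<in> S} {f. pdeg (\<phi> ` I) d f} K"
proof -
  from assms obtain G where G: "finite G" "card G \<le> K"
    and g: "\<And>f. pdeg I d f \<Longrightarrow> \<exists>g\<in>fun_vs.span G. \<forall>x\<in>S. f x = g x"
    unfolding spanned_def by blast
  let ?H = "(\<lambda>g z. g (\<lambda>i. z (\<phi> i))) ` G"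
  show ?thesis
    unfolding spanned_def
  proof (intro exI[of _ ?H] conjI ballI)
    show "finite ?H" using G by simp
    show "card ?H \<le> K" using G card_image_le le_trans by blast
    fix f :: "('j \<Rightarrow> 'k) \<Rightarrow> 'k" assume "f \<in> {f. pdeg (\<phi> ` I) d f}"
    then obtain f' where f': "pdeg I d f'" "\<forall>z. f z = f' (\<lambda>i. z (\<phi> i))" using pdeg_image by blast
    from g[OF this(1)] obtain h where h: "h \<in> fun_vs.span G" "\<forall>x\<in>S. f' x = h x" by blast
    show "\<exists>g\<in>fun_vs.span ?H. \<forall>x\<in>{z. (\<lambda>i. z (\<phi> i)) \<in> S}. f x = g x"
      using fun_span_comp[OF h(1), of "\<lambda>z i. z (\<phi> i)"] h(2) f'(2)
      by (intro bexI[of _ "\<lambda>z. h (\<lambda>i. z (\<phi> i))"]) auto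
  qed
qed

lemma poly_sum_bound:
  fixes p :: "'a::comm_semiring_1 poly"
  assumes "degree p \<le> n"
  shows "poly p x = (\<Sum>i<Suc n. coeff p i * x ^ i)"
proof -
  have "(\<Sum>i\<le>degree p. coeff p i * x ^ i) = (\<Sum>i<Suc n. coeff p i * x ^ i)"
    using assms by (intro sum.mono_neutral_left) (auto simp: coeff_eq_0)
  then show ?thesis by (simp add: poly_altdef)
qed

lemma poly_fun_sum:
  fixes F :: "(('i \<Rightarrow> 'k::field) \<Rightarrow> 'k) poly"
  assumes "degree F \<le> n"
  shows "poly F (\<lambda>z. z j) z = (\<Sum>i<Suc n. coeff F i z * z j ^ i)"
proof -
  have "degree (map_poly (\<lambda>c. c z) F) \<le> n" using assms map_poly_degree_leq[of "\<lambda>c. c z" F] by simp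
  from poly_sum_bound[OF this] show ?thesis
    by (simp add: poly_fun_apply coeff_map_poly del: sum.lessThan_Suc)
qed

text \<open>Each exponent is bounded by \<open>d\<close> separately, which overcounts the monomials
  of degree at most \<open>d\<close> but gives the right power of \<open>d\<close>.\<close>

lemma spanned_monomials:
  assumes "finite J"
  shows "spanned UNIV {f :: ('i \<Rightarrow> 'k::field) \<Rightarrow> 'k. pdeg J d f} ((d + 1) ^ card J)"
  using assms
proof (induction J rule: finite_induct)
  case empty
  show ?case
    unfolding spanned_def
  proof (intro exI[of _ "{1}"] conjI ballI)
    fix f :: "('i \<Rightarrow> 'k) \<Rightarrow> 'k" assume "f \<in> {f. pdeg {} d f}"
    then obtain c where "f = (\<lambda>_. c)" using pf_empty[of f] pf_pdeg by blast
    then have "f = fun_scale (*) c 1" by (simp add: fun_scale_def)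
    then show "\<exists>g\<in>fun_vs.span {1}. \<forall>x\<in>UNIV. f x = g x"
      using fun_vs.span_scale[OF fun_vs.span_base[of 1 "{1}"], of c] by blast
  qed auto
next
  case (insert j J)
  have "spanned UNIV {f :: ('i \<Rightarrow> 'k) \<Rightarrow> 'k. pdeg (insert j J) d f} (Suc d * (d + 1) ^ card J)"
  proof (rule spanned_adjoin[OF insert.IH, where w = "\<lambda>_. 1" and m = "\<lambda>i z. z j ^ i"])
    fix f :: "('i \<Rightarrow> 'k) \<Rightarrow> 'k" assume "f \<in> {f. pdeg (insert j J) d f}"
    then have "pdeg (insert j J) d f" by simp
    from pdeg_adjoin[OF this]
    obtain F where F: "\<forall>i. pdeg J d (coeff F i)" "degree F \<le> d" "f = poly F (\<lambda>z. z j)" by blast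
    then show "\<exists>a. (\<forall>i<Suc d. a i \<in> {f. pdeg J d f}) \<and>
      (\<forall>x\<in>UNIV. f x = 1 * (\<Sum>i<Suc d. a i x * x j ^ i))"
      by (intro exI[of _ "coeff F"]) (simp add: poly_fun_sum del: sum.lessThan_Suc)
  qed
  with insert.hyps show ?case by simp
qed

text \<open>High powers of \<open>y j\<close> are rewritten by the relation, at the price of one
  factor \<open>q y\<close> for each variable multiplied in. Every such step raises the degree of
  the coefficients by at most \<open>Suc D\<close>, so the bound stays linear in
  \<open>d\<close>.\<close>

lemma algebraic_reduction:
  assumes q: "pdeg J D q" and b: "\<And>i. i < s \<Longrightarrow> pdeg J D (b i)" and s: "s > 0"
    and rel: "\<And>y. y \<in> S \<Longrightarrow> q y * y j ^ s = (\<Sum>i<s. b i y * y j ^ i)"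
    and f: "pdeg (insert j J) d f"
  shows "\<exists>a. (\<forall>i<s. pdeg J (Suc D * d) (a i)) \<and> (\<forall>y\<in>S. q y ^ d * f y = (\<Sum>i<s. a i y * y j ^ i))"
  using f
proof induction
  case (const d c)
  have "d * D \<le> Suc D * d" by simp
  then have "pdeg J (Suc D * d) (\<lambda>y. q y ^ d * c)"
    using pdeg_cmult[OF pdeg_power[OF q, of d], of c] by (auto simp: mult.commute intro: pdeg_mono)
  moreover have "q y ^ d * c = (\<Sum>i<s. (if i = 0 then \<lambda>y. q y ^ d * c else (\<lambda>_. 0)) y * y j ^ i)" for y
  proof -
    have "(\<Sum>i<s. (if i = 0 then \<lambda>y. q y ^ d * c else (\<lambda>_. 0)) y * y j ^ i) =
        (\<Sum>i<s. if i = 0 then q y ^ d * c else 0)" by (intro sum.cong) auto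
    then show ?thesis using s by simp
  qed
  moreover have "pdeg J (Suc D * d) (if i = 0 then \<lambda>y. q y ^ d * c else (\<lambda>_. 0))" for i :: nat
    using calculation(1) by (simp add: pdeg.const)
  ultimately show ?case
    by (intro exI[of _ "\<lambda>i. if i = 0 then \<lambda>y. q y ^ d * c else (\<lambda>_. 0)"] conjI allI ballI impI)
next
  case (var d f i)
  then obtain a where a: "\<And>i. i < s \<Longrightarrow> pdeg J (Suc D * d) (a i)"
    "\<And>y. y \<in> S \<Longrightarrow> q y ^ d * f y = (\<Sum>i<s. a i y * y j ^ i)" by blast
  show ?case
  proof (cases "i = j")
    case False
    with var have "i \<in> J" by simp
    then have "pdeg J (Suc D + Suc D * d) (\<lambda>y. (y i * q y) * a k y)" if "k < s" for k
      using pdeg_mult[OF pdeg.var[OF q] a(1)[OF that]] by simp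
    moreover have "q y ^ Suc d * (y i * f y) = (\<Sum>k<s. ((y i * q y) * a k y) * y j ^ k)" if "y \<in> S" for y
    proof -
      have "q y ^ Suc d * (y i * f y) = (y i * q y) * (q y ^ d * f y)" by (simp add: algebra_simps)
      then show ?thesis by (simp add: a(2)[OF that] sum_distrib_left mult.assoc)
    qed
    ultimately show ?thesis by (intro exI[of _ "\<lambda>k y. (y i * q y) * a k y"]) simp
  next
    case True
    \<comment> \<open>Multiplication by \<open>y j\<close> shifts the coefficients; the overflow at
      \<open>y j ^ s\<close> has coefficient \<open>a (s - 1)\<close> and is folded back through
      \<open>b\<close>.\<close>
    define a' where "a' = (\<lambda>k y. (if k = 0 then 0 else q y * a (k - 1) y) + a (s - 1) y * b k y)"
    have qa: "pdeg J (Suc D * Suc d) (\<lambda>y. q y * a k y)" if "k < s" for k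
      using pdeg_mult[OF q a(1)[OF that]] by (auto intro: pdeg_mono)
    have ab: "pdeg J (Suc D * Suc d) (\<lambda>y. a (s - 1) y * b k y)" if "k < s" for k
      using pdeg_mult[OF a(1)[of "s - 1"] b[OF that]] s by (auto intro: pdeg_mono)
    have "pdeg J (Suc D * Suc d) (a' k)" if "k < s" for k
      unfolding a'_def using qa[of "k - 1"] ab[OF that] that
      by (cases "k = 0") (auto intro!: pdeg.add pdeg.const)
    moreover have "q y ^ Suc d * (y i * f y) = (\<Sum>k<s. a' k y * y j ^ k)" if y: "y \<in> S" for y
    proof -
      obtain r where r: "s = Suc r" using s by (cases s) auto
      have "q y ^ Suc d * (y i * f y) = q y * y j * (q y ^ d * f y)"
        using True by (simp add: algebra_simps)
      also have "\<dots> = (\<Sum>k<Suc r. q y * a k y * y j ^ Suc k)"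
        using a(2)[OF y] by (simp add: sum_distrib_left algebra_simps r del: sum.lessThan_Suc)
      also have "\<dots> = (\<Sum>k<r. q y * a k y * y j ^ Suc k) + a r y * (q y * y j ^ s)"
        by (simp add: r algebra_simps)
      also have "(\<Sum>k<r. q y * a k y * y j ^ Suc k) =
          (\<Sum>k<s. (if k = 0 then 0 else q y * a (k - 1) y) * y j ^ k)"
        unfolding r sum.lessThan_Suc_shift by simp
      also have "a r y * (q y * y j ^ s) = (\<Sum>k<s. a r y * b k y * y j ^ k)"
        using rel[OF y] by (simp add: sum_distrib_left algebra_simps)
      finally show ?thesis by (simp add: a'_def r sum.distrib distrib_right del: sum.lessThan_Suc)
    qed
    ultimately show ?thesis by blast
  qed
next
  case (add d f g)
  then obtain a a' where a: "\<And>i. i < s \<Longrightarrow> pdeg J (Suc D * d) (a i)"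
    "\<And>y. y \<in> S \<Longrightarrow> q y ^ d * f y = (\<Sum>i<s. a i y * y j ^ i)" 
    and a': "\<And>i. i < s \<Longrightarrow> pdeg J (Suc D * d) (a' i)"
    "\<And>y. y \<in> S \<Longrightarrow> q y ^ d * g y = (\<Sum>i<s. a' i y * y j ^ i)" by blast
  then show ?case
    by (intro exI[of _ "\<lambda>i y. a i y + a' i y"])
      (simp add: pdeg.add distrib_left distrib_right sum.distrib)
qed

text \<open>An algebraic coordinate changes only the constant: the powers of \<open>y j\<close>
  contribute \<open>s\<close>, the linear increase of degrees contributes \<open>Suc D ^ r\<close>,
  and the denominator \<open>q y ^ d\<close> is absorbed into the spanning functions.\<close>

lemma growth_adjoin:
  fixes q :: "('i \<Rightarrow> 'k::field) \<Rightarrow> 'k"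
  assumes sp: "\<And>d. spanned S {f. pdeg J d f} (K * (d + 1) ^ r)"
    and q: "pdeg J D q" "\<And>y. y \<in> S \<Longrightarrow> q y \<noteq> 0" and b: "\<And>i. i < s \<Longrightarrow> pdeg J D (b i)" and s: "s > 0"
    and rel: "\<And>y. y \<in> S \<Longrightarrow> q y * y j ^ s = (\<Sum>i<s. b i y * y j ^ i)"
  shows "spanned S {f. pdeg (insert j J) d f} (s * K * Suc D ^ r * (d + 1) ^ r)"
proof -
  have "spanned S {f. pdeg (insert j J) d f} (s * (K * (Suc D * d + 1) ^ r))"
  proof (rule spanned_adjoin[OF sp, where w = "\<lambda>y. inverse (q y ^ d)" and m = "\<lambda>i y. y j ^ i"])
    fix f :: "('i \<Rightarrow> 'k) \<Rightarrow> 'k" assume "f \<in> {f. pdeg (insert j J) d f}"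
    then have "pdeg (insert j J) d f" by simp
    from algebraic_reduction[OF q(1) b s rel this] obtain a where
      a: "\<forall>i<s. pdeg J (Suc D * d) (a i)" "\<forall>y\<in>S. q y ^ d * f y = (\<Sum>i<s. a i y * y j ^ i)" by blast
    have "f y = inverse (q y ^ d) * (\<Sum>i<s. a i y * y j ^ i)" if "y \<in> S" for y
      using a(2)[rule_format, OF that, symmetric] q(2)[OF that] by (simp add: field_simps)
    with a(1) show "\<exists>a. (\<forall>i<s. a i \<in> {f. pdeg J (Suc D * d) f}) \<and>
        (\<forall>y\<in>S. f y = inverse (q y ^ d) * (\<Sum>i<s. a i y * y j ^ i))" by blast
  qed
  moreover have "s * (K * (Suc D * d + 1) ^ r) \<le> s * K * Suc D ^ r * (d + 1) ^ r"
  proof -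
    have "(Suc D * d + 1) ^ r \<le> (Suc D * (d + 1)) ^ r" by (intro power_mono) auto
    then have "(Suc D * d + 1) ^ r \<le> Suc D ^ r * (d + 1) ^ r" by (simp only: power_mult_distrib)
    then have "s * K * (Suc D * d + 1) ^ r \<le> s * K * (Suc D ^ r * (d + 1) ^ r)" by (rule mult_le_mono2)
    then show ?thesis by (simp only: mult.assoc)
  qed
  ultimately show ?thesis using spanned_mono by blast
qed

definition vanishing :: "'i set \<Rightarrow> ('i \<Rightarrow> 'k::field) set \<Rightarrow> (('i \<Rightarrow> 'k) \<Rightarrow> 'k) set" where
  "vanishing I Y = {f \<in> pf I. \<forall>y\<in>Y. f y = 0}"

text \<open>
  The spanning functions need not be polynomial, and are only required on a dense subset, so that
  denominators are allowed.
\<close>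

definition growth_le :: "'i set \<Rightarrow> ('i \<Rightarrow> 'k::field) set \<Rightarrow> nat \<Rightarrow> bool" where
  "growth_le I Y c \<longleftrightarrow> (\<exists>Y' K. Y' \<subseteq> Y \<and> vanishing I Y' \<subseteq> vanishing I Y \<and>
     (\<forall>d. spanned Y' {f. pdeg I d f} (K * (d + 1) ^ c)))"

lemma growth_le_mono:
  assumes "growth_le I Y c" "c \<le> c'"
  shows "growth_le I Y c'"
proof -
  from assms(1) obtain Y' K where Y': "Y' \<subseteq> Y" "vanishing I Y' \<subseteq> vanishing I Y"
    "\<And>d. spanned Y' {f. pdeg I d f} (K * (d + 1) ^ c)" unfolding growth_le_def by blast
  have "K * (d + 1) ^ c \<le> K * (d + 1) ^ c'" for d
    using assms(2) by (intro mult_le_mono2 power_increasing) auto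
  with Y' show ?thesis unfolding growth_le_def by (meson spanned_mono order_refl)
qed

lemma growth_le_UNIV:
  assumes "finite I"
  shows "growth_le I (UNIV :: ('i \<Rightarrow> 'k::field) set) (card I)"
proof -
  have "spanned UNIV {f :: ('i \<Rightarrow> 'k) \<Rightarrow> 'k. pdeg I d f} (1 * (d + 1) ^ card I)" for d
    using spanned_monomials[OF assms, of d] by simp
  then show ?thesis unfolding growth_le_def by blast
qed

lemma prime_in_pf_empty:
  assumes P: "prime_in (pf I) P"
  shows "P \<inter> pf {} \<subseteq> {0}"
proof
  fix f assume f: "f \<in> P \<inter> pf {}"
  then obtain c where c: "f = (\<lambda>_. c)" using pf_empty by blast
  show "f \<in> {0}"
  proof (rule ccontr)
    assume "f \<notin> {0}"
    then have "c \<noteq> 0" using c by (auto simp: zero_fun_def)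
    then have "(\<lambda>_. inverse c) * f = 1" using c by (simp add: times_fun_def one_fun_def)
    moreover have "(\<lambda>_. inverse c) * f \<in> P"
      using f by (intro prime_inD(4)[OF P]) (auto intro: pf_pdeg pdeg.const)
    ultimately show False using prime_inD(5)[OF P] by (simp only:)
  qed
qed

text \<open>A nonzero equation of \<open>Y\<close> is read as a polynomial in coordinate
  \<open>j\<close>. Its leading coefficient is a nonzero function of the coordinates in
  \<open>J\<close>, so by independence it does not vanish on all of \<open>Y\<close>; it becomes
  \<open>q\<close>.\<close>

lemma algebraic_relation:
  assumes P: "prime_in (pf I) (vanishing I Y)" and J: "insert j J \<subseteq> I" "vanishing I Y \<inter> pf J \<subseteq> {0}"
    and j: "\<not> vanishing I Y \<inter> pf (insert j J) \<subseteq> {0}"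
  obtains D q s b where "pdeg J D q" "q \<notin> vanishing I Y" "\<And>i. i < s \<Longrightarrow> pdeg J D (b i)" "s > 0"
    "\<And>y. y \<in> Y \<Longrightarrow> q y * y j ^ s = (\<Sum>i<s. b i y * y j ^ i)"
proof -
  from j obtain p where p: "p \<in> vanishing I Y" "p \<in> pf (insert j J)" "p \<noteq> 0" by blast
  then obtain D where "pdeg (insert j J) D p" by (auto simp: pf_def)
  from pdeg_adjoin[OF this] obtain F where F: "\<forall>i. pdeg J D (coeff F i)" "p = poly F (\<lambda>z. z j)" by blast
  have F0: "F \<noteq> 0" using F(2) p(3) by auto
  have lc: "lead_coeff F \<noteq> 0" "lead_coeff F \<in> pf J" using F0 F(1) by (auto intro: pf_pdeg)
  then have lc': "lead_coeff F \<notin> vanishing I Y" using J(2) by blast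
  have y: "lead_coeff F y * y j ^ degree F = (\<Sum>i<degree F. (- coeff F i y) * y j ^ i)" if "y \<in> Y" for y
  proof -
    have "0 = p y" using p(1) that by (simp add: vanishing_def)
    also have "\<dots> = (\<Sum>i<Suc (degree F). coeff F i y * y j ^ i)" using poly_fun_sum[of F "degree F" j y] F(2) by simp
    finally show ?thesis by (simp add: sum_negf add_eq_0_iff algebra_simps)
  qed
  have "degree F > 0"
  proof (rule ccontr)
    assume "\<not> ?thesis"
    then have "degree F = 0" by simp
    with y lc(2) pf_mono[of J I] J(1) have "lead_coeff F \<in> vanishing I Y" by (auto simp: vanishing_def)
    with lc' show False by blast
  qed
  show ?thesis
  proof
    show "pdeg J D (lead_coeff F)" using F(1) by simp
    show "lead_coeff F \<notin> vanishing I Y" by fact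
    show "pdeg J D (\<lambda>y. - coeff F i y)" if "i < degree F" for i using F(1) by (intro pdeg_uminus) simp
    show "degree F > 0" by fact
  qed (rule y)
qed

text \<open>For a maximal independent \<open>J\<close> every other coordinate is algebraic over
  \<open>J\<close> on \<open>Y\<close>, so adjoining it keeps the exponent \<open>card J\<close>.
  The product \<open>g\<close> of the leading coefficients is nonzero on a dense subset because the
  vanishing ideal is prime.\<close>

lemma growth_transcendence_degree:
  assumes I: "finite I" and P: "prime_in (pf I) (vanishing I Y)"
  obtains J where "J \<subseteq> I" "vanishing I Y \<inter> pf J \<subseteq> {0}" "growth_le I Y (card J)"
proof -
  let ?P = "vanishing I Y"
  let ?\<J> = "{J. J \<subseteq> I \<and> ?P \<inter> pf J \<subseteq> {0}}"
  have "finite ?\<J>" using I by (intro finite_subset[of ?\<J> "Pow I"]) auto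
  moreover have "{} \<in> ?\<J>" using prime_in_pf_empty[OF P] by simp
  ultimately have "\<exists>J\<in>?\<J>. \<forall>J'\<in>?\<J>. J \<subseteq> J' \<longrightarrow> J = J'"
    by (intro finite_has_maximal) (assumption, rule ex_in_conv[THEN iffD1], rule exI)
  then obtain J where "J \<in> ?\<J>" and max: "\<And>J'. J' \<in> ?\<J> \<Longrightarrow> J \<subseteq> J' \<Longrightarrow> J = J'"
    by (elim bexE) (meson)
  then have J: "J \<subseteq> I" "?P \<inter> pf J \<subseteq> {0}" by auto
  have fin: "finite (I - J)" using I by simp
  have "\<exists>g\<in>pf I. g \<notin> ?P \<and> (\<exists>K. \<forall>d. spanned {y \<in> Y. g y \<noteq> 0} {f. pdeg (J \<union> L) d f} (K * (d + 1) ^ card J))"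
    if "finite L" "L \<subseteq> I - J" for L
    using that
  proof (induction L rule: finite_induct)
    case empty
    have "spanned {y \<in> Y. (1 :: ('a \<Rightarrow> 'b) \<Rightarrow> 'b) y \<noteq> 0} {f :: ('a \<Rightarrow> 'b) \<Rightarrow> 'b. pdeg J d f} (1 * (d + 1) ^ card J)" for d
      by (rule spanned_mono[OF spanned_monomials[OF finite_subset[OF J(1) I]]]) simp_all
    then have "\<forall>d. spanned {y \<in> Y. (1 :: ('a \<Rightarrow> 'b) \<Rightarrow> 'b) y \<noteq> 0} {f :: ('a \<Rightarrow> 'b) \<Rightarrow> 'b. pdeg (J \<union> {}) d f} (1 * (d + 1) ^ card J)"
      by simp
    moreover have "1 \<in> pf I" "1 \<notin> ?P" using prime_inD(5)[OF P] pf_closed(2) by auto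
    ultimately show ?case by blast
  next
    case (insert j L)
    then obtain g K where g: "g \<in> pf I" "g \<notin> ?P"
      and K: "\<And>d. spanned {y \<in> Y. g y \<noteq> 0} {f. pdeg (J \<union> L) d f} (K * (d + 1) ^ card J)" by auto
    have j: "insert j J \<subseteq> I" "j \<notin> J" using insert.prems J(1) by auto
    have "\<not> ?P \<inter> pf (insert j J) \<subseteq> {0}" using max[of "insert j J"] j by blast
    from algebraic_relation[OF P j(1) J(2) this] obtain D q s b where q: "pdeg J D q" "q \<notin> ?P"
      and b: "\<And>i. i < s \<Longrightarrow> pdeg J D (b i)" and s: "s > 0"
      and rel: "\<And>y. y \<in> Y \<Longrightarrow> q y * y j ^ s = (\<Sum>i<s. b i y * y j ^ i)" by blast
    have qI: "q \<in> pf I" using pf_pdeg[OF q(1)] pf_mono[OF J(1)] by blast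
    let ?S = "{y \<in> Y. (g * q) y \<noteq> 0}"
    have "spanned ?S {f. pdeg (insert j (J \<union> L)) d f} (s * K * Suc D ^ card J * (d + 1) ^ card J)" for d
    proof (rule growth_adjoin)
      show "spanned ?S {f. pdeg (J \<union> L) d f} (K * (d + 1) ^ card J)" for d
        by (rule spanned_mono[OF K]) auto
      show "pdeg (J \<union> L) D q" using q(1) by (rule pdeg_mono) auto
      show "pdeg (J \<union> L) D (b i)" if "i < s" for i using b[OF that] by (rule pdeg_mono) auto
      show "q y \<noteq> 0" if "y \<in> ?S" for y using that by auto
      show "q y * y j ^ s = (\<Sum>i<s. b i y * y j ^ i)" if "y \<in> ?S" for y using that rel by auto
    qed (fact s)
    then have "\<forall>d. spanned ?S {f. pdeg (J \<union> insert j L) d f} (s * K * Suc D ^ card J * (d + 1) ^ card J)"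
      by simp
    moreover have "g * q \<in> pf I" using g(1) qI by (rule pf_closed)
    moreover have "g * q \<notin> ?P" using prime_inD(6)[OF P g(1) qI] g(2) q(2) by blast
    ultimately show ?case by blast
  qed
  from this[OF fin order_refl] J(1) obtain g K where g: "g \<in> pf I" "g \<notin> ?P"
    and K: "\<forall>d. spanned {y \<in> Y. g y \<noteq> 0} {f. pdeg I d f} (K * (d + 1) ^ card J)"
    by (auto simp: Un_absorb1)
  have "vanishing I {y \<in> Y. g y \<noteq> 0} \<subseteq> ?P"
  proof
    fix f assume f: "f \<in> vanishing I {y \<in> Y. g y \<noteq> 0}"
    then have fI: "f \<in> pf I" by (simp add: vanishing_def)
    have "f * g \<in> ?P" using f pf_closed(4)[OF fI g(1)] by (auto simp: vanishing_def)
    with prime_inD(6)[OF P fI g(1)] g(2) show "f \<in> ?P" by blast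
  qed
  with K have "growth_le I Y (card J)"
    unfolding growth_le_def by (intro exI[of _ "{y \<in> Y. g y \<noteq> 0}"] exI[of _ K]) auto
  with J that show ?thesis by blast
qed

lemma spanned_Sigma:
  assumes "finite A" "\<And>i. i \<in> A \<Longrightarrow> spanned (C i) {f. pdeg (I i) d f} (K i)"
  shows "spanned {z. \<forall>i\<in>A. (\<lambda>b. z (i, b)) \<in> C i} {f :: ('a \<times> 'b \<Rightarrow> 'k::field) \<Rightarrow> 'k. pdeg (Sigma A I) d f} (\<Prod>i\<in>A. K i)"
  using assms
proof (induction A rule: finite_induct)
  case empty
  show ?case using spanned_monomials[of "{} :: ('a \<times> 'b) set" d] by simp
next
  case (insert a A)
  have "spanned ({z. (\<lambda>b. z (a, b)) \<in> C a} \<inter> {z. \<forall>i\<in>A. (\<lambda>b. z (i, b)) \<in> C i})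
      {f :: ('a \<times> 'b \<Rightarrow> 'k) \<Rightarrow> 'k. pdeg (Pair a ` I a \<union> Sigma A I) d f} (K a * (\<Prod>i\<in>A. K i))"
    using insert by (intro spanned_prod spanned_cylinder[where \<phi> = "Pair a"]) auto
  moreover have "Pair a ` I a \<union> Sigma A I = Sigma (insert a A) I" by auto
  moreover have "{z. (\<lambda>b. z (a, b)) \<in> C a} \<inter> {z. \<forall>i\<in>A. (\<lambda>b. z (i, b)) \<in> C i} =
    {z. \<forall>i\<in>insert a A. (\<lambda>b. z (i, b)) \<in> C i}" by auto
  ultimately show ?case using insert.hyps by simp
qed

text \<open>The dense subsets are enlarged one factor at a time: with the other components frozen,
  \<open>f\<close> is a polynomial function of a single component, to which the density of that
  factor applies.\<close>

lemma vanishing_Sigma: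
  fixes C :: "'a \<Rightarrow> ('b \<Rightarrow> 'k::field) set"
  assumes "finite A" and dense: "\<And>i. i \<in> A \<Longrightarrow> vanishing (I i) (C' i) \<subseteq> vanishing (I i) (C i)"
  shows "vanishing (Sigma A I) {z. \<forall>i\<in>A. (\<lambda>b. z (i, b)) \<in> C' i} \<subseteq>
    vanishing (Sigma A I) {z. \<forall>i\<in>A. (\<lambda>b. z (i, b)) \<in> C i}"
proof
  fix f assume f: "f \<in> vanishing (Sigma A I) {z. \<forall>i\<in>A. (\<lambda>b. z (i, b)) \<in> C' i}"
  then obtain d where d: "pdeg (Sigma A I) d f" by (auto simp: vanishing_def pf_def)
  have "f z = 0" if "finite B" "B \<subseteq> A" "\<forall>i\<in>A. (\<lambda>b. z (i, b)) \<in> (if i \<in> B then C i else C' i)" for B z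
    using that
  proof (induction B arbitrary: z rule: finite_induct)
    case empty
    then show ?case using f by (auto simp: vanishing_def)
  next
    case (insert a B)
    define \<sigma> where "\<sigma> = (\<lambda>(w :: 'b \<Rightarrow> 'k) (i, b). if i = a then w b else z (i, b))"
    have a: "a \<in> A" using insert.prems by simp
    have "pdeg (I a) (d * 1) (\<lambda>w. f (\<lambda>j. \<sigma> w j))"
    proof (rule pdeg_comp[OF d])
      fix j assume "j \<in> Sigma A I"
      then show "pdeg (I a) 1 (\<lambda>w. \<sigma> w j)"
        using pdeg_coord[of "snd j" "I a"] by (cases "fst j = a") (auto simp: \<sigma>_def pdeg.const split: prod.splits)
    qed
    then have "(\<lambda>w. f (\<sigma> w)) \<in> pf (I a)" by (auto intro: pf_pdeg)
    moreover have "f (\<sigma> w) = 0" if w: "w \<in> C' a" for w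
    proof (rule insert.IH)
      show "B \<subseteq> A" using insert.prems by simp
      show "\<forall>i\<in>A. (\<lambda>b. \<sigma> w (i, b)) \<in> (if i \<in> B then C i else C' i)"
      proof
        fix i assume i: "i \<in> A"
        show "(\<lambda>b. \<sigma> w (i, b)) \<in> (if i \<in> B then C i else C' i)"
        proof (cases "i = a")
          case True
          then show ?thesis using insert.hyps w by (simp add: \<sigma>_def)
        next
          case False
          then have "(\<lambda>b. \<sigma> w (i, b)) = (\<lambda>b. z (i, b))" by (simp add: \<sigma>_def)
          then show ?thesis using insert.prems(2) i False by (auto split: if_splits)
        qed
      qed
    qed
    ultimately have "(\<lambda>w. f (\<sigma> w)) \<in> vanishing (I a) (C a)"
      using dense[OF a] by (auto simp: vanishing_def)
    moreover have "(\<lambda>b. z (a, b)) \<in> C a" using insert.prems(2) a by auto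
    ultimately have "f (\<sigma> (\<lambda>b. z (a, b))) = 0" by (simp add: vanishing_def)
    moreover have "\<sigma> (\<lambda>b. z (a, b)) = z" by (auto simp: \<sigma>_def fun_eq_iff)
    ultimately show ?case by simp
  qed
  from this[OF assms(1) order_refl] f
  show "f \<in> vanishing (Sigma A I) {z. \<forall>i\<in>A. (\<lambda>b. z (i, b)) \<in> C i}"
    by (simp add: vanishing_def)
qed

lemma growth_le_Sigma:
  assumes A: "finite A" and g: "\<And>i. i \<in> A \<Longrightarrow> growth_le (I i) (C i) (c i)"
  shows "growth_le (Sigma A I) {z. \<forall>i\<in>A. (\<lambda>b. z (i, b)) \<in> C i} (\<Sum>i\<in>A. c i)"
proof -
  have "\<forall>i\<in>A. \<exists>Y'. \<exists>K. Y' \<subseteq> C i \<and> vanishing (I i) Y' \<subseteq> vanishing (I i) (C i) \<and>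
     (\<forall>d. spanned Y' {f. pdeg (I i) d f} (K * (d + 1) ^ c i))"
    using g unfolding growth_le_def by blast
  then obtain C' K where C': "\<And>i. i \<in> A \<Longrightarrow> C' i \<subseteq> C i"
    "\<And>i. i \<in> A \<Longrightarrow> vanishing (I i) (C' i) \<subseteq> vanishing (I i) (C i)"
    "\<And>i d. i \<in> A \<Longrightarrow> spanned (C' i) {f. pdeg (I i) d f} (K i * (d + 1) ^ c i)"
    by metis
  show ?thesis
    unfolding growth_le_def
  proof (intro exI conjI allI)
    show "{z. \<forall>i\<in>A. (\<lambda>b. z (i, b)) \<in> C' i} \<subseteq> {z. \<forall>i\<in>A. (\<lambda>b. z (i, b)) \<in> C i}"
      using C'(1) by blast
    show "vanishing (Sigma A I) {z. \<forall>i\<in>A. (\<lambda>b. z (i, b)) \<in> C' i} \<subseteq>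
      vanishing (Sigma A I) {z. \<forall>i\<in>A. (\<lambda>b. z (i, b)) \<in> C i}"
      by (rule vanishing_Sigma[OF A C'(2)])
    fix d
    show "spanned {z. \<forall>i\<in>A. (\<lambda>b. z (i, b)) \<in> C' i} {f. pdeg (Sigma A I) d f}
      ((\<Prod>i\<in>A. K i) * (d + 1) ^ (\<Sum>i\<in>A. c i))"
      using spanned_Sigma[OF A, of C' I d "\<lambda>i. K i * (d + 1) ^ c i", OF C'(3)]
      by (simp add: prod.distrib power_sum)
  qed
qed


section \<open>Kernels of a family of linear maps\<close>

text \<open>Gaussian elimination: an equation that is not trivial on \<open>A\<close> is solved for
  one unknown \<open>a\<close>, which leaves one equation and one unknown fewer.\<close>

lemma homogeneous_system_nontrivial:
  fixes m :: "'a \<Rightarrow> 'b \<Rightarrow> 'k::field"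
  assumes "finite G" "finite A" "card G < card A"
  shows "\<exists>c. (\<exists>\<alpha>\<in>A. c \<alpha> \<noteq> 0) \<and> (\<forall>g\<in>G. (\<Sum>\<alpha>\<in>A. c \<alpha> * m \<alpha> g) = 0)"
  using assms
proof (induction G arbitrary: A m rule: finite_induct)
  case empty
  then show ?case by (intro exI[of _ "\<lambda>_. 1"]) (auto simp: card_gt_0_iff)
next
  case (insert g G)
  show ?case
  proof (cases "\<forall>\<alpha>\<in>A. m \<alpha> g = 0")
    case True
    with insert.IH[of A m] insert.prems insert.hyps show ?thesis by auto
  next
    case False
    then obtain a where a: "a \<in> A" "m a g \<noteq> 0" by blast
    define m' where "m' = (\<lambda>\<alpha> h. m \<alpha> h - m \<alpha> g / m a g * m a h)"
    have "card G < card (A - {a})" using insert.prems insert.hyps a by simp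
    from insert.IH[OF _ this, of m'] insert.prems obtain c where
      c: "\<exists>\<alpha>\<in>A - {a}. c \<alpha> \<noteq> 0" "\<And>h. h \<in> G \<Longrightarrow> (\<Sum>\<alpha>\<in>A - {a}. c \<alpha> * m' \<alpha> h) = 0" by auto
    define d where "d = c(a := - (\<Sum>\<alpha>\<in>A - {a}. c \<alpha> * m \<alpha> g) / m a g)"
    have split: "(\<Sum>\<alpha>\<in>A. d \<alpha> * m \<alpha> h) = d a * m a h + (\<Sum>\<alpha>\<in>A - {a}. c \<alpha> * m \<alpha> h)" for h
      using insert.prems(1) a(1) by (simp add: sum.remove d_def)
    have "(\<Sum>\<alpha>\<in>A. d \<alpha> * m \<alpha> h) = 0" if "h \<in> insert g G" for h
    proof (cases "h = g")
      case True
      then show ?thesis unfolding split using a(2) by (simp add: d_def)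
    next
      case False
      then have "0 = (\<Sum>\<alpha>\<in>A - {a}. c \<alpha> * m' \<alpha> h)" using c(2) that by simp
      also have "\<dots> = (\<Sum>\<alpha>\<in>A - {a}. c \<alpha> * m \<alpha> h) - (\<Sum>\<alpha>\<in>A - {a}. c \<alpha> * m \<alpha> g) / m a g * m a h"
        by (simp add: m'_def algebra_simps sum_subtractf sum_distrib_left sum_divide_distrib)
      finally show ?thesis unfolding split by (simp add: d_def)
    qed
    moreover have "\<exists>\<alpha>\<in>A. d \<alpha> \<noteq> 0" using c(1) by (auto simp: d_def)
    ultimately show ?thesis by blast
  qed
qed

lemma sum_fun_scale_apply: "(\<Sum>g\<in>T. fun_scale (*) (u g) (f g)) x = (\<Sum>g\<in>T. u g * f g x :: 'k::field)"
  by (induction T rule: infinite_finite_induct) (auto simp: fun_scale_def)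

text \<open>Expanding the \<open>\<Phi> \<alpha>\<close> in a spanning set reduces linear dependence
  on \<open>S\<close> to a homogeneous system of at most \<open>K\<close> equations in more than
  \<open>K\<close> unknowns.\<close>

lemma spanned_dependent:
  assumes sp: "spanned S Fs K" and A: "finite A" "K < card A" and \<Phi>: "\<forall>\<alpha>\<in>A. \<Phi> \<alpha> \<in> Fs"
  shows "\<exists>c. (\<exists>\<alpha>\<in>A. c \<alpha> \<noteq> 0) \<and> (\<forall>x\<in>S. (\<Sum>\<alpha>\<in>A. c \<alpha> * \<Phi> \<alpha> x) = 0)"
proof -
  from sp obtain G where G: "finite G" "card G \<le> K"
    and g: "\<And>f. f \<in> Fs \<Longrightarrow> \<exists>g\<in>fun_vs.span G. \<forall>x\<in>S. f x = g x"
    unfolding spanned_def by blast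
  have "\<exists>u. \<forall>x\<in>S. \<Phi> \<alpha> x = (\<Sum>g\<in>G. u g * g x)" if \<alpha>: "\<alpha> \<in> A" for \<alpha>
  proof -
    obtain f where f: "f \<in> fun_vs.span G" "\<forall>x\<in>S. \<Phi> \<alpha> x = f x" using g[OF \<Phi>[rule_format, OF \<alpha>]] by blast
    then obtain u where "f = (\<Sum>g\<in>G. fun_scale (*) (u g) g)"
      unfolding fun_vs.span_finite[OF G(1)] by blast
    with f(2) show ?thesis by (intro exI[of _ u]) (simp add: sum_fun_scale_apply)
  qed
  then obtain u where u: "\<And>\<alpha> x. \<alpha> \<in> A \<Longrightarrow> x \<in> S \<Longrightarrow> \<Phi> \<alpha> x = (\<Sum>g\<in>G. u \<alpha> g * g x)" by metis
  from homogeneous_system_nontrivial[OF G(1) A(1), of u] G(2) A(2) obtain c where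
    c: "\<exists>\<alpha>\<in>A. c \<alpha> \<noteq> 0" "\<And>g. g \<in> G \<Longrightarrow> (\<Sum>\<alpha>\<in>A. c \<alpha> * u \<alpha> g) = 0" by auto
  have "(\<Sum>\<alpha>\<in>A. c \<alpha> * \<Phi> \<alpha> x) = 0" if x: "x \<in> S" for x
  proof -
    have "(\<Sum>\<alpha>\<in>A. c \<alpha> * \<Phi> \<alpha> x) = (\<Sum>\<alpha>\<in>A. \<Sum>g\<in>G. c \<alpha> * u \<alpha> g * g x)"
      using u x by (intro sum.cong) (auto simp: sum_distrib_left mult.assoc)
    also have "\<dots> = (\<Sum>g\<in>G. (\<Sum>\<alpha>\<in>A. c \<alpha> * u \<alpha> g) * g x)"
      by (subst sum.swap) (simp add: sum_distrib_right)
    finally show ?thesis using c(2) by simp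
  qed
  with c(1) show ?thesis by blast
qed

text \<open>Grouping by the power of one variable gives a polynomial in it whose coefficients are
  sums over the other variables; by induction one of them is nonzero at a suitable point. This turns
  a linear dependence found by counting into a nonzero polynomial.\<close>

lemma box_monomials_independent:
  fixes c :: "('j \<Rightarrow> nat) \<Rightarrow> 'k::alg_closed_field"
  assumes "finite I" "\<exists>\<alpha>\<in>PiE I (\<lambda>_. {..n}). c \<alpha> \<noteq> 0"
  shows "\<exists>b. (\<Sum>\<alpha>\<in>PiE I (\<lambda>_. {..n}). c \<alpha> * (\<Prod>j\<in>I. b j ^ \<alpha> j)) \<noteq> 0"
  using assms
proof (induction I arbitrary: c rule: finite_induct)
  case empty
  then show ?case by simp
next
  case (insert j I)
  let ?A = "PiE I (\<lambda>_. {..n})"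
  let ?S = "\<lambda>b m. \<Sum>\<alpha>\<in>?A. c (\<alpha>(j := m)) * (\<Prod>i\<in>I. b i ^ \<alpha> i)"
  have PiE: "PiE (insert j I) (\<lambda>_. {..n}) = (\<lambda>(m, \<alpha>). \<alpha>(j := m)) ` ({..n} \<times> ?A)"
    by (rule PiE_insert_eq)
  have inj: "inj_on (\<lambda>(m, \<alpha>). \<alpha>(j := m)) ({..n} \<times> ?A)"
    using inj_combinator[of j I "\<lambda>_. {..n}"] insert.hyps by simp
  from insert.prems obtain m \<alpha> where m: "m \<le> n" "\<alpha> \<in> ?A" "c (\<alpha>(j := m)) \<noteq> 0"
    unfolding PiE by auto
  from insert.IH[of "\<lambda>\<alpha>. c (\<alpha>(j := m))"] m obtain b where b: "?S b m \<noteq> 0" by blast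
  define F where "F = (\<Sum>m\<le>n. monom (?S b m) m)"
  have "coeff F m = ?S b m" using m(1) by (simp add: F_def coeff_sum sum.delta)
  with b have "F \<noteq> 0" by auto
  then obtain x where x: "poly F x \<noteq> 0" by (rule poly_nonroot)
  have "(\<Sum>\<alpha>\<in>PiE (insert j I) (\<lambda>_. {..n}). c \<alpha> * (\<Prod>i\<in>insert j I. (b(j := x)) i ^ \<alpha> i)) =
    (\<Sum>(m, \<alpha>)\<in>{..n} \<times> ?A. c (\<alpha>(j := m)) * (\<Prod>i\<in>insert j I. (b(j := x)) i ^ (\<alpha>(j := m)) i))"
    unfolding PiE by (subst sum.reindex[OF inj]) (simp add: case_prod_unfold)
  also have "\<dots> = (\<Sum>(m, \<alpha>)\<in>{..n} \<times> ?A. x ^ m * (c (\<alpha>(j := m)) * (\<Prod>i\<in>I. b i ^ \<alpha> i)))"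
  proof (rule sum.cong[OF refl], clarify)
    fix m \<alpha>
    have "(\<Prod>i\<in>I. (b(j := x)) i ^ (\<alpha>(j := m)) i) = (\<Prod>i\<in>I. b i ^ \<alpha> i)"
      using insert.hyps by (intro prod.cong) auto
    then show "c (\<alpha>(j := m)) * (\<Prod>i\<in>insert j I. (b(j := x)) i ^ (\<alpha>(j := m)) i) =
      x ^ m * (c (\<alpha>(j := m)) * (\<Prod>i\<in>I. b i ^ \<alpha> i))"
      using insert.hyps by simp
  qed
  also have "\<dots> = (\<Sum>m\<le>n. x ^ m * ?S b m)"
    by (simp add: sum.cartesian_product[symmetric] sum_distrib_left)
  also have "\<dots> = poly F x" by (simp add: F_def poly_sum poly_monom mult.commute)
  finally show ?case using x by (intro exI[of _ "b(j := x)"]) simp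
qed

text \<open>The product of finitely many nonzero polynomials is nonzero, so the locus may be treated
  in finitely many pieces.\<close>

lemma pf_vanishing_union:
  fixes Z :: "'a \<Rightarrow> ('i \<Rightarrow> 'k::alg_closed_field) set"
  assumes "finite A" "\<And>a. a \<in> A \<Longrightarrow> \<exists>F\<in>pf I. F \<noteq> 0 \<and> (\<forall>b\<in>Z a. F b = 0)"
  shows "\<exists>F\<in>pf I. F \<noteq> 0 \<and> (\<forall>a\<in>A. \<forall>b\<in>Z a. F b = 0)"
  using assms
proof (induction A rule: finite_induct)
  case empty
  then show ?case by (intro bexI[of _ 1] conjI ballI one_neq_zero pf_closed(2)) auto
next
  case (insert a A)
  obtain F where F: "F \<in> pf I" "F \<noteq> 0" "\<forall>a\<in>A. \<forall>b\<in>Z a. F b = 0"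
    using insert.IH insert.prems by blast
  obtain G where G: "G \<in> pf I" "G \<noteq> 0" "\<forall>b\<in>Z a. G b = 0"
    using insert.prems by blast
  from F(2) G(2) obtain x y where "F x \<noteq> 0" "G y \<noteq> 0" by (auto simp: fun_eq_iff)
  then obtain z where "F z \<noteq> 0" "G z \<noteq> 0" using pf_common_nonzero[of F I G I x y] F G by blast
  then have "(F * G) z \<noteq> 0" by simp
  then have "F * G \<noteq> 0" by (metis zero_fun_apply)
  moreover have "\<forall>a\<in>insert a A. \<forall>b\<in>Z a. (F * G) b = 0" using F(3) G(3) by simp
  ultimately show ?case using pf_closed(4)[OF F(1) G(1)] by blast
qed

text \<open>
  Fraction-free elimination: where \<open>\<delta> \<noteq> 0\<close>, the variables \<open>b\<^sub>j\<close> with \<open>j \<in> J\<close> are expressed by the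
  others, with polynomial coefficients in \<open>x\<close>.
\<close>

definition elim_data ::
  "'i set \<Rightarrow> 'j set \<Rightarrow> nat \<Rightarrow> nat \<Rightarrow> 'j set \<Rightarrow> (('i \<Rightarrow> 'k::field) \<Rightarrow> 'k) \<Rightarrow>
    ('j \<Rightarrow> 'j \<Rightarrow> ('i \<Rightarrow> 'k) \<Rightarrow> 'k) \<Rightarrow> bool" where
  "elim_data Ix Ib n D J \<delta> h \<longleftrightarrow> J \<subseteq> Ib \<and> card J = n \<and> pdeg Ix D \<delta> \<and>
     (\<forall>c x. \<delta> (\<lambda>i. c * x i) = c ^ D * \<delta> x) \<and>
     (\<forall>j\<in>J. \<forall>i\<in>Ib - J. pdeg Ix D (h j i) \<and> (\<forall>c x. h j i (\<lambda>i. c * x i) = c ^ D * h j i x))"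

definition elim_rel ::
  "'j set \<Rightarrow> 'j set \<Rightarrow> (('i \<Rightarrow> 'k::field) \<Rightarrow> 'k) \<Rightarrow> ('j \<Rightarrow> 'j \<Rightarrow> ('i \<Rightarrow> 'k) \<Rightarrow> 'k) \<Rightarrow>
    ('i \<Rightarrow> 'k) \<Rightarrow> ('j \<Rightarrow> 'k) \<Rightarrow> bool" where
  "elim_rel Ib J \<delta> h x b \<longleftrightarrow> (\<forall>j\<in>J. \<delta> x * b j = (\<Sum>i\<in>Ib - J. h j i x * b i))"

text \<open>\<open>g i\<close> is the coefficient of \<open>b i\<close> in \<open>\<delta> x\<close>
  times the new form after substitution of the eliminated variables; \<open>i0\<close> is the pivot.
  Multiplying the old relations by \<open>g i0\<close> and the new one by \<open>\<delta>\<close>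
  brings all coefficients to the same degree \<open>D + Suc D\<close>.\<close>

lemma elimination_step:
  fixes m :: "'j \<Rightarrow> ('i \<Rightarrow> 'k::field) \<Rightarrow> 'k"
  assumes Ib: "finite Ib" and m': "\<forall>j\<in>Ib. pdeg Ix 1 (m j)"
    "\<forall>j\<in>Ib. \<forall>c x. m j (\<lambda>i. c * x i) = c * m j x"
    and E: "elim_data Ix Ib n D J \<delta> h" and i0: "i0 \<in> Ib - J"
    and g: "g = (\<lambda>i x. \<delta> x * m i x + (\<Sum>j\<in>J. m j x * h j i x))"
    and \<delta>': "\<delta>' = (\<lambda>x. \<delta> x * g i0 x)"
    and h': "h' = (\<lambda>j i x. if j = i0 then - (\<delta> x * g i x) else h j i x * g i0 x - h j i0 x * g i x)"
  shows "elim_data Ix Ib (Suc n) (D + Suc D) (insert i0 J) \<delta>' h'"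
    and "elim_rel Ib J \<delta> h x b \<Longrightarrow> (\<Sum>j\<in>Ib. m j x * b j) = 0 \<Longrightarrow> elim_rel Ib (insert i0 J) \<delta>' h' x b"
    and "elim_rel Ib J \<delta> h x b \<Longrightarrow> \<delta> x * (\<Sum>j\<in>Ib. m j x * b j) = (\<Sum>i\<in>Ib - J. g i x * b i)"
proof -
  note m = m'[rule_format]
  have J: "J \<subseteq> Ib" "card J = n" "finite J" and \<delta>: "pdeg Ix D \<delta>" "\<And>c x. \<delta> (\<lambda>i. c * x i) = c ^ D * \<delta> x"
    and h: "\<And>j i. j \<in> J \<Longrightarrow> i \<in> Ib - J \<Longrightarrow> pdeg Ix D (h j i)"
      "\<And>j i c x. j \<in> J \<Longrightarrow> i \<in> Ib - J \<Longrightarrow> h j i (\<lambda>i. c * x i) = c ^ D * h j i x"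
    using E Ib finite_subset unfolding elim_data_def by auto
  have gp: "pdeg Ix (Suc D) (g i)" if i: "i \<in> Ib - J" for i
  proof -
    have "pdeg Ix (D + 1) (\<lambda>x. \<delta> x * m i x)" using \<delta>(1) m(1) i by (intro pdeg_mult) auto
    moreover have "pdeg Ix (1 + D) (\<lambda>x. m j x * h j i x)" if "j \<in> J" for j
      using m(1) h(1) i J that by (intro pdeg_mult) auto
    ultimately show ?thesis unfolding g by (intro pdeg.add pdeg_sum) auto
  qed
  have gh: "g i (\<lambda>i. c * x i) = c ^ Suc D * g i x" if i: "i \<in> Ib - J" for i c x
  proof -
    have "(\<Sum>j\<in>J. m j (\<lambda>i. c * x i) * h j i (\<lambda>i. c * x i)) = (\<Sum>j\<in>J. c ^ Suc D * (m j x * h j i x))"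
      using m(2) h(2) i J by (intro sum.cong) (auto simp: algebra_simps)
    then show ?thesis using \<delta>(2) m(2) i by (simp add: g sum_distrib_left algebra_simps)
  qed
  have "pdeg Ix (D + Suc D) (h' j i)" if "j \<in> insert i0 J" "i \<in> Ib - insert i0 J" for i j
  proof (cases "j = i0")
    case True
    have "pdeg Ix (D + Suc D) (\<lambda>x. - (\<delta> x * g i x))"
      using that \<delta>(1) gp by (intro pdeg_uminus pdeg_mult) auto
    with True show ?thesis by (simp add: h')
  next
    case False
    have "pdeg Ix (D + Suc D) (\<lambda>x. h j i x * g i0 x - h j i0 x * g i x)"
      using that False h(1) gp i0 by (intro pdeg_diff pdeg_mult) auto
    with False show ?thesis by (simp add: h')
  qed
  moreover have "h' j i (\<lambda>i. c * x i) = c ^ (D + Suc D) * h' j i x"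
    if "j \<in> insert i0 J" "i \<in> Ib - insert i0 J" for i j c x
    using that h(2) gh \<delta>(2) i0 by (auto simp: h' power_add algebra_simps)
  moreover have "pdeg Ix (D + Suc D) \<delta>'" unfolding \<delta>' using \<delta>(1) gp[OF i0] by (rule pdeg_mult)
  moreover have "\<delta>' (\<lambda>i. c * x i) = c ^ (D + Suc D) * \<delta>' x" for c x
    using \<delta>(2) gh[OF i0] by (simp add: \<delta>' power_add algebra_simps)
  moreover have "insert i0 J \<subseteq> Ib" "card (insert i0 J) = Suc n" using J i0 by auto
  ultimately show "elim_data Ix Ib (Suc n) (D + Suc D) (insert i0 J) \<delta>' h'"
    unfolding elim_data_def by blast
  show 3: "\<delta> x * (\<Sum>j\<in>Ib. m j x * b j) = (\<Sum>i\<in>Ib - J. g i x * b i)" if rel: "elim_rel Ib J \<delta> h x b"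
    for x b
  proof -
    have "\<delta> x * (\<Sum>j\<in>Ib. m j x * b j) = (\<Sum>j\<in>Ib - J. \<delta> x * m j x * b j) + (\<Sum>j\<in>J. m j x * (\<delta> x * b j))"
      unfolding sum.subset_diff[OF J(1) Ib] by (simp add: distrib_left sum_distrib_left algebra_simps)
    also have "(\<Sum>j\<in>J. m j x * (\<delta> x * b j)) = (\<Sum>j\<in>J. m j x * (\<Sum>i\<in>Ib - J. h j i x * b i))"
      using rel by (intro sum.cong) (auto simp: elim_rel_def)
    also have "\<dots> = (\<Sum>i\<in>Ib - J. (\<Sum>j\<in>J. m j x * h j i x) * b i)"
      unfolding sum_distrib_left sum_distrib_right by (subst sum.swap) (simp add: mult.assoc)
    finally show ?thesis by (simp add: g sum.distrib distrib_right)
  qed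
  assume rel: "elim_rel Ib J \<delta> h x b" and 0: "(\<Sum>j\<in>Ib. m j x * b j) = 0"
  have fin: "finite (Ib - J)" using Ib by simp
  have Ib': "Ib - J - {i0} = Ib - insert i0 J" by blast
  from 3[OF rel] 0 have "g i0 x * b i0 + (\<Sum>i\<in>Ib - insert i0 J. g i x * b i) = 0"
    by (simp add: sum.remove[OF fin i0] Ib')
  then have s: "g i0 x * b i0 = - (\<Sum>i\<in>Ib - insert i0 J. g i x * b i)" by (simp add: add_eq_0_iff)
  show "elim_rel Ib (insert i0 J) \<delta>' h' x b"
    unfolding elim_rel_def
  proof
    fix j assume j: "j \<in> insert i0 J"
    show "\<delta>' x * b j = (\<Sum>i\<in>Ib - insert i0 J. h' j i x * b i)"
    proof (cases "j = i0")
      case True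
      have "\<delta>' x * b j = \<delta> x * (g i0 x * b i0)" using True by (simp add: \<delta>')
      also have "\<dots> = (\<Sum>i\<in>Ib - insert i0 J. h' j i x * b i)"
        unfolding s using True by (simp add: h' sum_distrib_left sum_negf algebra_simps)
      finally show ?thesis .
    next
      case False
      with j have jJ: "j \<in> J" by simp
      have "\<delta>' x * b j = g i0 x * (\<delta> x * b j)" by (simp add: \<delta>')
      also have "\<delta> x * b j = (\<Sum>i\<in>Ib - J. h j i x * b i)" using rel jJ by (simp add: elim_rel_def)
      also have "\<dots> = h j i0 x * b i0 + (\<Sum>i\<in>Ib - insert i0 J. h j i x * b i)"
        by (simp add: sum.remove[OF fin i0] Ib')
      also have "g i0 x * \<dots> = h j i0 x * (g i0 x * b i0) + (\<Sum>i\<in>Ib - insert i0 J. g i0 x * (h j i x * b i))"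
        by (simp add: sum_distrib_left algebra_simps)
      also have "\<dots> = (\<Sum>i\<in>Ib - insert i0 J. h' j i x * b i)"
        unfolding s using False
        by (simp add: h' sum_distrib_left sum_negf sum_subtractf left_diff_distrib algebra_simps)
      finally show ?thesis .
    qed
  qed
qed

definition forms_onto :: "'l set \<Rightarrow> 'j set \<Rightarrow> ('l \<Rightarrow> 'j \<Rightarrow> 'k::field) \<Rightarrow> bool" where
  "forms_onto L Ib m \<longleftrightarrow> (\<forall>c. \<exists>b. \<forall>k\<in>L. (\<Sum>j\<in>Ib. m k j * b j) = c k)"

definition forms_kernel :: "'l set \<Rightarrow> 'j set \<Rightarrow> ('l \<Rightarrow> 'j \<Rightarrow> 'k::field) \<Rightarrow> ('j \<Rightarrow> 'k) set" where
  "forms_kernel L Ib m = {b. \<forall>k\<in>L. (\<Sum>j\<in>Ib. m k j * b j) = 0}"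

text \<open>A pivot that is nonzero at one \<open>x\<close> may vanish at another, so all pivot
  choices are collected in a finite set. The degree grows from \<open>D\<close> to
  \<open>D + Suc D\<close> whatever the pivot, hence it is common to all choices and positive after
  the first form.\<close>

lemma elimination:
  fixes M :: "('i \<Rightarrow> 'k::field) \<Rightarrow> 'l \<Rightarrow> 'j \<Rightarrow> 'k"
  assumes L: "finite L" and Ib: "finite Ib"
    and M: "\<forall>k\<in>L. \<forall>j\<in>Ib. pdeg Ix 1 (\<lambda>x. M x k j)"
      "\<forall>k\<in>L. \<forall>j\<in>Ib. \<forall>c x. M (\<lambda>i. c * x i) k j = c * M x k j"
  shows "\<exists>D \<D>. finite \<D> \<and> (L \<noteq> {} \<longrightarrow> D > 0) \<and> (\<forall>J \<delta> h. (J, \<delta>, h) \<in> \<D> \<longrightarrow> elim_data Ix Ib (card L) D J \<delta> h) \<and>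
    (\<forall>x. forms_onto L Ib (M x) \<longrightarrow>
      (\<exists>J \<delta> h. (J, \<delta>, h) \<in> \<D> \<and> \<delta> x \<noteq> 0 \<and>
        (\<forall>b\<in>forms_kernel L Ib (M x). elim_rel Ib J \<delta> h x b)))"
  using L M
proof (induction L rule: finite_induct)
  case empty
  show ?case
    by (intro exI[of _ 0] exI[of _ "{({}, \<lambda>_. 1, \<lambda>_ _ _. 0)}"])
      (auto simp: elim_data_def elim_rel_def pdeg.const)
next
  case (insert l L)
  have p1: "\<forall>k\<in>L. \<forall>j\<in>Ib. pdeg Ix 1 (\<lambda>x. M x k j)"
    and p2: "\<forall>k\<in>L. \<forall>j\<in>Ib. \<forall>c x. M (\<lambda>i. c * x i) k j = c * M x k j"
    using insert.prems by blast+
  from insert.IH[OF p1 p2] obtain D \<D> where fin: "finite \<D>" and "L \<noteq> {} \<longrightarrow> D > 0"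
    and data': "\<forall>J \<delta> h. (J, \<delta>, h) \<in> \<D> \<longrightarrow> elim_data Ix Ib (card L) D J \<delta> h"
    and rel: "\<forall>x. forms_onto L Ib (M x) \<longrightarrow>
      (\<exists>J \<delta> h. (J, \<delta>, h) \<in> \<D> \<and> \<delta> x \<noteq> 0 \<and>
        (\<forall>b\<in>forms_kernel L Ib (M x). elim_rel Ib J \<delta> h x b))"
    by (elim exE conjE) (rule that; assumption)
  note data = data'[rule_format]
  define g where "g = (\<lambda>J \<delta> h i x. \<delta> x * M x l i + (\<Sum>j\<in>J. M x l j * h j i x))"
  define new where "new = (\<lambda>(J, \<delta>, h) i0. (insert i0 J, \<lambda>x. \<delta> x * g J \<delta> h i0 x,
    \<lambda>j i x. if j = i0 then - (\<delta> x * g J \<delta> h i x) else h j i x * g J \<delta> h i0 x - h j i0 x * g J \<delta> h i x))"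
  define \<D>' where "\<D>' = (\<Union>E\<in>\<D>. new E ` (Ib - fst E))"
  note step = elimination_step[where m = "\<lambda>j x. M x l j", OF Ib
      insert.prems(1)[THEN bspec, OF insertI1] insert.prems(2)[THEN bspec, OF insertI1] data _
      g_def[THEN fun_cong, THEN fun_cong, THEN fun_cong] refl refl]
  have card: "card (insert l L) = Suc (card L)" using insert.hyps by simp
  show ?case
  proof (intro exI[of _ "D + Suc D"] exI[of _ \<D>'] conjI allI impI)
    show "finite \<D>'" using fin Ib by (auto simp: \<D>'_def)
    {
      fix J' \<delta>' h' assume "(J', \<delta>', h') \<in> \<D>'"
      then obtain J \<delta> h i0 where *: "(J, \<delta>, h) \<in> \<D>" "i0 \<in> Ib - J" "(J', \<delta>', h') = new (J, \<delta>, h) i0"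
        by (auto simp: \<D>'_def)
      then show "elim_data Ix Ib (card (insert l L)) (D + Suc D) J' \<delta>' h'"
        using step(1)[OF *(1,2)] by (simp add: new_def card)
    }
    fix x assume surj: "forms_onto (insert l L) Ib (M x)"
    then have "forms_onto L Ib (M x)" unfolding forms_onto_def by (meson insertI2)
    from rel[rule_format, OF this] obtain J \<delta> h where E: "(J, \<delta>, h) \<in> \<D>" "\<delta> x \<noteq> 0"
      and r: "\<And>b. b \<in> forms_kernel L Ib (M x) \<Longrightarrow> elim_rel Ib J \<delta> h x b" by blast
    \<comment> \<open>A vector killed by the forms in \<open>L\<close> but not by the form
      \<open>l\<close> shows that some free variable has a nonzero coefficient, which serves as the
      pivot.\<close>
    from surj obtain b where b: "\<forall>k\<in>insert l L. (\<Sum>j\<in>Ib. M x k j * b j) = (if k = l then 1 else 0)"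
      unfolding forms_onto_def by (elim allE[of _ "\<lambda>k. if k = l then 1 else 0"] exE) (rule that)
    then have rb: "elim_rel Ib J \<delta> h x b" using insert.hyps by (intro r) (auto simp: forms_kernel_def)
    have "(\<Sum>i\<in>Ib - J. g J \<delta> h i x * b i) = \<delta> x * (\<Sum>j\<in>Ib. M x l j * b j)"
    proof (cases "Ib - J = {}")
      case False
      then obtain i0 where "i0 \<in> Ib - J" by blast
      then show ?thesis using step(3)[OF E(1)] rb by metis
    next
      case True
      then have "J = Ib" using data[OF E(1)] by (auto simp: elim_data_def)
      then have "\<forall>j\<in>Ib. b j = 0" using rb E(2) by (simp add: elim_rel_def)
      then show ?thesis using True by simp
    qed
    also have "\<dots> \<noteq> 0" using b E(2) by simp
    finally obtain i0 where i0: "i0 \<in> Ib - J" "g J \<delta> h i0 x \<noteq> 0"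
      by (metis (no_types, lifting) mult_zero_left sum.neutral)
    define N where "N = new (J, \<delta>, h) i0"
    have "N \<in> \<D>'" unfolding \<D>'_def N_def using i0(1) by (intro UN_I[OF E(1)] imageI) simp
    moreover have "fst (snd N) x \<noteq> 0" using E(2) i0(2) by (simp add: N_def new_def)
    moreover have "elim_rel Ib (fst N) (fst (snd N)) (snd (snd N)) x b"
      if "b \<in> forms_kernel (insert l L) Ib (M x)" for b
      using step(2)[OF E(1) i0(1) r, of b] that by (simp add: N_def new_def forms_kernel_def)
    ultimately show "\<exists>J \<delta> h. (J, \<delta>, h) \<in> \<D>' \<and> \<delta> x \<noteq> 0 \<and>
        (\<forall>b\<in>forms_kernel (insert l L) Ib (M x). elim_rel Ib J \<delta> h x b)"
      by (intro exI[of _ "fst N"] exI[of _ "fst (snd N)"] exI[of _ "snd (snd N)"]) simp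
  qed simp
qed

text \<open>
  On the slice \<open>b\<^sub>i\<^sub>0 = 1\<close> the functions \<open>F(\<delta>(x) b)\<close>, for \<open>F\<close> with all exponents at most \<open>n\<close>, are
  polynomials of degree \<open>O(n)\<close> in \<open>x \<in> C\<close> and the remaining \<open>N - u - 1\<close> coordinates of \<open>b\<close>. These
  span a space of dimension \<open>O(n\<^sup>N\<^sup>-\<^sup>1)\<close>, but there are \<open>(n + 1)\<^sup>N\<close> monomials \<open>F\<close>. Hence some
  nonzero \<open>F\<close> vanishes at all \<open>\<delta>(x) b\<close>, and rescaling \<open>x\<close> by a \<open>D\<close>-th root turns \<open>\<delta>(x) b\<close> into any multiple of \<open>b\<close>.
\<close>

lemma elimination_locus_not_dense:
  fixes \<delta> :: "('i \<Rightarrow> 'k::alg_closed_field) \<Rightarrow> 'k" and h :: "'j \<Rightarrow> 'j \<Rightarrow> ('i \<Rightarrow> 'k) \<Rightarrow> 'k"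
  assumes Ib: "finite Ib" and E: "elim_data Ix Ib u D J \<delta> h" and D: "D > 0"
    and cone: "\<And>c x. x \<in> C \<Longrightarrow> (\<lambda>i. c * x i) \<in> C"
    and growth: "growth_le Ix C u" and i0: "i0 \<in> Ib - J"
  shows "\<exists>F\<in>pf Ib. F \<noteq> 0 \<and> (\<forall>b\<in>{b. \<exists>x\<in>C. \<delta> x \<noteq> 0 \<and> b i0 \<noteq> 0 \<and> elim_rel Ib J \<delta> h x b}. F b = 0)"
proof -
  have J: "J \<subseteq> Ib" "card J = u" "finite J" and \<delta>: "pdeg Ix D \<delta>" "\<And>c x. \<delta> (\<lambda>i. c * x i) = c ^ D * \<delta> x"
    and h: "\<And>j i. j \<in> J \<Longrightarrow> i \<in> Ib - J \<Longrightarrow> pdeg Ix D (h j i)"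
      "\<And>j i c x. j \<in> J \<Longrightarrow> i \<in> Ib - J \<Longrightarrow> h j i (\<lambda>i. c * x i) = c ^ D * h j i x"
    using E Ib finite_subset unfolding elim_data_def by auto
  from growth obtain C' K where C': "vanishing Ix C' \<subseteq> vanishing Ix C"
    and K: "\<And>d. spanned C' {f. pdeg Ix d f} (K * (d + 1) ^ u)" unfolding growth_le_def by blast
  define N where "N = card Ib"
  \<comment> \<open>The free coordinates without \<open>i0\<close>: their number
    \<open>N - u - 1\<close> and the growth exponent \<open>u\<close> of the cone add up to
    \<open>N - 1\<close>.\<close>
  define B :: "('i + 'j) set" where "B = Inr ` (Ib - J - {i0})"
  define V where "V = Inl ` Ix \<union> B"
  define S :: "('i + 'j \<Rightarrow> 'k) set" where "S = {z. (\<lambda>i. z (Inl i)) \<in> C'}"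
  have "card Ib > 0" using i0 Ib by (auto simp: card_gt_0_iff)
  then have N: "N > 0" by (simp add: N_def)
  have cB: "card B = N - u - 1"
    using J i0 Ib by (simp add: B_def card_image N_def card_Diff_subset)
  have "card (insert i0 J) \<le> N" unfolding N_def using J i0 Ib by (intro card_mono) auto
  then have uN: "u + (N - u - 1) = N - 1" using J i0 by simp
  have sp: "spanned S {f. pdeg V d f} (K * (d + 1) ^ (N - 1))" for d
  proof -
    have "spanned (S \<inter> UNIV) {f. pdeg V d f} (K * (d + 1) ^ u * (d + 1) ^ card B)"
      unfolding V_def S_def
      using Ib by (intro spanned_prod spanned_cylinder[where \<phi> = Inl] K spanned_monomials) (simp add: B_def)
    then show ?thesis by (simp only: mult.assoc power_add[symmetric] cB uN Int_UNIV_right)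
  qed
  define \<beta> where "\<beta> = (\<lambda>i (z :: 'i + 'j \<Rightarrow> 'k). if i = i0 then 1 else z (Inr i))"
  \<comment> \<open>The coordinates of \<open>\<delta> x\<close> times the normalised vector, as
    polynomials in \<open>x\<close> and the remaining free coordinates; elimination supplies those
    with \<open>j \<in> J\<close>.\<close>
  define \<phi> where "\<phi> = (\<lambda>j (z :: 'i + 'j \<Rightarrow> 'k). if j \<in> J then \<Sum>i\<in>Ib - J. h j i (\<lambda>i. z (Inl i)) * \<beta> i z
    else \<delta> (\<lambda>i. z (Inl i)) * \<beta> j z)"
  have \<beta>: "pdeg V 1 (\<beta> i)" if "i \<in> Ib - J" for i
    using that pdeg_coord[of "Inr i" V] by (cases "i = i0") (auto simp: \<beta>_def V_def B_def pdeg.const)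
  have lift: "pdeg V D (\<lambda>z. f (\<lambda>i. z (Inl i)))" if "pdeg Ix D f" for f
    using pdeg_comp[OF that, of V 1 "\<lambda>i z. z (Inl i)"] pdeg_coord[of _ V] by (auto simp: V_def)
  have \<phi>: "pdeg V (D + 1) (\<phi> j)" if "j \<in> Ib" for j
  proof (cases "j \<in> J")
    case True
    have "pdeg V (D + 1) (\<lambda>z. \<Sum>i\<in>Ib - J. h j i (\<lambda>i. z (Inl i)) * \<beta> i z)"
      by (intro pdeg_sum pdeg_mult lift \<beta> h True)
    then show ?thesis using True by (simp add: \<phi>_def[abs_def])
  next
    case False
    have "pdeg V (D + 1) (\<lambda>z. \<delta> (\<lambda>i. z (Inl i)) * \<beta> j z)"
      using that False by (intro pdeg_mult lift \<beta> \<delta>) auto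
    then show ?thesis using False by (simp add: \<phi>_def[abs_def])
  qed
  \<comment> \<open>With this \<open>n\<close> the spanning functions of degree \<open>d\<close>
    number at most \<open>n * (n + 1) ^ (N - 1)\<close>, fewer than the \<open>(n + 1) ^ N\<close>
    monomials. Here \<open>d\<close> accounts for \<open>N\<close> factors with exponent at most
    \<open>n\<close> and degree at most \<open>D + 1\<close>.\<close>
  define n where "n = K * (N * (D + 1) + 1) ^ (N - 1)"
  define d where "d = N * (n * (D + 1))"
  define A where "A = PiE Ib (\<lambda>_. {..n})"
  define \<Phi> where "\<Phi> = (\<lambda>\<alpha> z. \<Prod>j\<in>Ib. \<phi> j z ^ \<alpha> j)"
  have finA: "finite A" using Ib by (simp add: A_def finite_PiE)
  have \<Phi>: "\<Phi> \<alpha> \<in> {f. pdeg V d f}" if \<alpha>: "\<alpha> \<in> A" for \<alpha>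
  proof -
    have "pdeg V (\<Sum>j\<in>Ib. n * (D + 1)) (\<lambda>z. \<Prod>j\<in>Ib. \<phi> j z ^ \<alpha> j)"
    proof (rule pdeg_prod)
      fix j assume j: "j \<in> Ib"
      have "\<alpha> j \<le> n" using \<alpha> j by (auto simp: A_def PiE_iff)
      then have "\<alpha> j * (D + 1) \<le> n * (D + 1)" by (rule mult_le_mono1)
      with pdeg_power[OF \<phi>[OF j]] show "pdeg V (n * (D + 1)) (\<lambda>z. \<phi> j z ^ \<alpha> j)"
        by (rule pdeg_mono) simp
    qed
    then show ?thesis by (simp add: \<Phi>_def d_def N_def)
  qed
  have "K * (d + 1) ^ (N - 1) \<le> K * ((N * (D + 1) + 1) * (n + 1)) ^ (N - 1)"
    unfolding d_def by (intro mult_le_mono2 power_mono) (auto simp: algebra_simps)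
  also have "\<dots> = n * (n + 1) ^ (N - 1)" by (simp only: power_mult_distrib n_def mult.assoc)
  also have "\<dots> < (n + 1) * (n + 1) ^ (N - 1)" by simp
  also have "\<dots> = (n + 1) ^ N" using N by (cases N) auto
  also have "\<dots> = card A" using Ib by (simp add: A_def card_PiE N_def)
  finally have "K * (d + 1) ^ (N - 1) < card A" .
  moreover have "\<forall>\<alpha>\<in>A. \<Phi> \<alpha> \<in> {f. pdeg V d f}" using \<Phi> by blast
  ultimately obtain c where c: "\<exists>\<alpha>\<in>A. c \<alpha> \<noteq> 0" "\<forall>z\<in>S. (\<Sum>\<alpha>\<in>A. c \<alpha> * \<Phi> \<alpha> z) = 0"
    using spanned_dependent[OF sp finA] by blast
  define F where "F = (\<lambda>b. \<Sum>\<alpha>\<in>A. c \<alpha> * (\<Prod>j\<in>Ib. b j ^ \<alpha> j))"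
  have "pdeg Ib (\<Sum>j\<in>Ib. n) (\<lambda>b. c \<alpha> * (\<Prod>j\<in>Ib. b j ^ \<alpha> j))" if \<alpha>: "\<alpha> \<in> A" for \<alpha>
  proof (intro pdeg_cmult pdeg_prod)
    fix j assume j: "j \<in> Ib"
    have "\<alpha> j \<le> n" using \<alpha> j by (auto simp: A_def PiE_iff)
    with pdeg_power[OF pdeg_coord[OF j], of "\<alpha> j"] show "pdeg Ib n (\<lambda>b. b j ^ \<alpha> j)"
      by (auto intro: pdeg_mono)
  qed
  then have "pdeg Ib (\<Sum>j\<in>Ib. n) F" unfolding F_def by (rule pdeg_sum)
  then have Fpf: "F \<in> pf Ib" by (rule pf_pdeg)
  have F0: "F \<noteq> 0"
    using box_monomials_independent[OF Ib c(1)[unfolded A_def]] by (auto simp: F_def A_def fun_eq_iff)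
  \<comment> \<open>The relation is known over the dense subset \<open>C'\<close>; with
    \<open>w\<close> fixed it is polynomial in \<open>x\<close> and extends to
    \<open>C\<close>.\<close>
  have vanish: "(\<Sum>\<alpha>\<in>A. c \<alpha> * \<Phi> \<alpha> (case_sum x w)) = 0" if x: "x \<in> C" for x w
  proof -
    let ?f = "\<lambda>x. \<Sum>\<alpha>\<in>A. c \<alpha> * \<Phi> \<alpha> (case_sum x w)"
    have "pdeg V d (\<lambda>z. \<Sum>\<alpha>\<in>A. c \<alpha> * \<Phi> \<alpha> z)"
      using \<Phi> by (intro pdeg_sum pdeg_cmult) auto
    then have "pdeg Ix (d * 1) (\<lambda>x. (\<lambda>z. \<Sum>\<alpha>\<in>A. c \<alpha> * \<Phi> \<alpha> z) (\<lambda>i. case_sum x w i))"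
    proof (rule pdeg_comp)
      fix i assume "i \<in> V"
      then show "pdeg Ix 1 (\<lambda>x. case_sum x w i)"
        using pdeg_coord[of _ Ix] by (auto simp: V_def B_def pdeg.const)
    qed
    then have "?f \<in> pf Ix" by (auto intro: pf_pdeg)
    moreover have "?f x = 0" if "x \<in> C'" for x using that by (intro c(2)[rule_format]) (simp add: S_def)
    ultimately have "?f \<in> vanishing Ix C'" by (simp add: vanishing_def)
    with C' x show ?thesis by (auto simp: vanishing_def)
  qed
  have "F b = 0" if x: "x \<in> C" "\<delta> x \<noteq> 0" and b: "b i0 \<noteq> 0" "elim_rel Ib J \<delta> h x b" for x b
  proof -
    \<comment> \<open>This root makes \<open>\<delta> y\<close> equal to \<open>b i0\<close>, so
      that \<open>\<delta> y\<close> times \<open>w\<close> is \<open>b\<close> itself.\<close>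
    obtain r where r: "r ^ D = b i0 / \<delta> x" using nth_root_exists[OF D] by blast
    define y where "y = (\<lambda>i. r * x i)"
    define w where "w = (\<lambda>j. b j / b i0)"
    have y: "y \<in> C" "\<delta> y = b i0" using cone[OF x(1)] x(2) by (auto simp: y_def \<delta>(2) r)
    have \<beta>w: "\<beta> i (case_sum y w) = w i" for i using b(1) by (simp add: \<beta>_def w_def)
    have "\<phi> j (case_sum y w) = b j" if j: "j \<in> Ib" for j
    proof (cases "j \<in> J")
      case True
      have "\<phi> j (case_sum y w) = (\<Sum>i\<in>Ib - J. h j i y * w i)" using True by (simp add: \<phi>_def \<beta>w)
      also have "\<dots> = (\<Sum>i\<in>Ib - J. r ^ D / b i0 * (h j i x * b i))"
        using True by (intro sum.cong) (auto simp: y_def h(2) w_def)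
      also have "\<dots> = r ^ D / b i0 * (\<delta> x * b j)"
        using b(2) True by (simp add: sum_distrib_left elim_rel_def)
      also have "\<dots> = b j" using b(1) x(2) by (simp add: r)
      finally show ?thesis .
    next
      case False
      then show ?thesis using b(1) y(2) by (simp add: \<phi>_def \<beta>w) (simp add: w_def)
    qed
    then have "F b = (\<Sum>\<alpha>\<in>A. c \<alpha> * \<Phi> \<alpha> (case_sum y w))" by (simp add: F_def \<Phi>_def)
    also have "\<dots> = 0" by (rule vanish[OF y(1)])
    finally show ?thesis .
  qed
  with Fpf F0 show ?thesis by blast
qed

text \<open>The pairs of a pivot choice and a free index \<open>i0\<close> with
  \<open>b i0 \<noteq> 0\<close> split the locus into finitely many pieces, apart from the vectors
  whose free coordinates all vanish.\<close>

theorem kernel_locus_not_dense: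
  fixes M :: "('i \<Rightarrow> 'k::alg_closed_field) \<Rightarrow> 'l \<Rightarrow> 'j \<Rightarrow> 'k"
  assumes L: "finite L" "L \<noteq> {}" and Ib: "finite Ib"
    and M: "\<forall>k\<in>L. \<forall>j\<in>Ib. pdeg Ix 1 (\<lambda>x. M x k j)"
      "\<forall>k\<in>L. \<forall>j\<in>Ib. \<forall>c x. M (\<lambda>i. c * x i) k j = c * M x k j"
    and cone: "\<And>c x. x \<in> C \<Longrightarrow> (\<lambda>i. c * x i) \<in> C"
    and growth: "growth_le Ix C (card L)"
  shows "\<exists>F\<in>pf Ib. F \<noteq> 0 \<and>
    (\<forall>x\<in>C. forms_onto L Ib (M x) \<longrightarrow> (\<forall>b\<in>forms_kernel L Ib (M x). F b = 0))"
proof (cases "Ib = {}")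
  case True
  have "\<not> forms_onto L Ib (M x)" for x
  proof
    assume "forms_onto L Ib (M x)"
    then have "\<exists>b :: 'j \<Rightarrow> 'k. \<forall>k\<in>L. (\<Sum>j\<in>Ib. M x k j * b j) = (\<lambda>_. 1) k"
      unfolding forms_onto_def ..
    with True L(2) show False by auto
  qed
  then show ?thesis by (intro bexI[of _ 1] conjI ballI allI impI one_neq_zero pf_closed(2)) blast
next
  case False
  then obtain i1 where i1: "i1 \<in> Ib" by blast
  from elimination[OF L(1) Ib M] obtain D \<D> where fin: "finite \<D>" and D': "L \<noteq> {} \<longrightarrow> D > 0"
    and data': "\<forall>J \<delta> h. (J, \<delta>, h) \<in> \<D> \<longrightarrow> elim_data Ix Ib (card L) D J \<delta> h"
    and rel: "\<forall>x. forms_onto L Ib (M x) \<longrightarrow>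
      (\<exists>J \<delta> h. (J, \<delta>, h) \<in> \<D> \<and> \<delta> x \<noteq> 0 \<and>
        (\<forall>b\<in>forms_kernel L Ib (M x). elim_rel Ib J \<delta> h x b))"
    by (elim exE conjE) (rule that; assumption)
  from D' L(2) have D: "D > 0" by simp
  note data = data'[rule_format]
  define \<E> where "\<E> = (SIGMA E:\<D>. Ib - fst E)"
  define Z where "Z = (\<lambda>((J, \<delta>, h), i0). {b. \<exists>x\<in>C. \<delta> x \<noteq> 0 \<and> b i0 \<noteq> 0 \<and> elim_rel Ib J \<delta> h x b})"
  have "\<exists>F\<in>pf Ib. F \<noteq> 0 \<and> (\<forall>e\<in>\<E>. \<forall>b\<in>Z e. F b = 0)"
  proof (rule pf_vanishing_union)
    show "finite \<E>" using fin Ib by (simp add: \<E>_def)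
    fix e assume "e \<in> \<E>"
    then obtain J \<delta> h i0 where e: "e = ((J, \<delta>, h), i0)" "(J, \<delta>, h) \<in> \<D>" "i0 \<in> Ib - J"
      by (cases e) (auto simp: \<E>_def)
    then show "\<exists>F\<in>pf Ib. F \<noteq> 0 \<and> (\<forall>b\<in>Z e. F b = 0)"
      using elimination_locus_not_dense[OF Ib data[OF e(2)] D cone growth e(3)] by (simp add: Z_def)
  qed
  then obtain F where F: "F \<in> pf Ib" "F \<noteq> 0" "\<And>e b. e \<in> \<E> \<Longrightarrow> b \<in> Z e \<Longrightarrow> F b = 0" by blast
  \<comment> \<open>The factor \<open>b i1\<close> covers the vectors whose free coordinates all
    vanish, since their eliminated coordinates then vanish as well.\<close>
  define G where "G = F * (\<lambda>b. b i1)"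
  from F(2) obtain a where a: "F a \<noteq> 0" by (auto simp: fun_eq_iff)
  obtain z where "F z \<noteq> 0" "z i1 \<noteq> 0"
    using pf_common_nonzero[OF F(1) pf_coord[OF i1], of a "\<lambda>_. 1"] a by auto
  then have "G z \<noteq> 0" by (simp add: G_def)
  then have "G \<noteq> 0" by (metis zero_fun_apply)
  moreover have "G \<in> pf Ib" unfolding G_def using F(1) pf_coord[OF i1] by (rule pf_closed)
  moreover have "G b = 0" if x: "x \<in> C" "forms_onto L Ib (M x)"
    and b: "b \<in> forms_kernel L Ib (M x)" for x b
  proof -
    from rel[rule_format, OF x(2)] b obtain J \<delta> h where E: "(J, \<delta>, h) \<in> \<D>" "\<delta> x \<noteq> 0" "elim_rel Ib J \<delta> h x b"
      by blast
    show ?thesis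
    proof (cases "\<exists>i0\<in>Ib - J. b i0 \<noteq> 0")
      case True
      then obtain i0 where "i0 \<in> Ib - J" "b i0 \<noteq> 0" by blast
      with E x(1) have "((J, \<delta>, h), i0) \<in> \<E>" "b \<in> Z ((J, \<delta>, h), i0)"
        by (auto simp: \<E>_def Z_def)
      then show ?thesis using F(3) by (simp add: G_def)
    next
      case False
      with E(2,3) have "b j = 0" if "j \<in> Ib" for j
        using that by (cases "j \<in> J") (auto simp: elim_rel_def)
      with i1 show ?thesis by (simp add: G_def)
    qed
  qed
  ultimately show ?thesis by blast
qed


section \<open>Coordinates and projective cones\<close>

lemma linear_on_0:
  assumes "linear_on s1 s2 E f" "vector_space s1" "vector_space s2" "module.subspace s1 E"
  shows "f 0 = 0"
proof -
  interpret v1: vector_space s1 by fact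
  interpret v2: vector_space s2 by fact
  have "f (s1 0 0) = s2 0 (f 0)" using assms(1) v1.subspace_0[OF assms(4)] unfolding linear_on_def by blast
  then show ?thesis by simp
qed

lemma linear_on_sum:
  assumes "linear_on s1 s2 E f" "vector_space s1" "vector_space s2" "module.subspace s1 E"
    and "\<And>i. i \<in> L \<Longrightarrow> x i \<in> E"
  shows "f (\<Sum>i\<in>L. x i) = (\<Sum>i\<in>L. f (x i))"
proof -
  interpret v1: vector_space s1 by fact
  from assms(5) show ?thesis
  proof (induction L rule: infinite_finite_induct)
    case (insert i L)
    then have "x i \<in> E" "(\<Sum>i\<in>L. x i) \<in> E" by (simp_all add: v1.subspace_sum[OF assms(4)])
    with insert assms(1) show ?case by (simp add: linear_on_def)
  qed (use linear_on_0[OF assms(1-4)] in auto)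
qed

text \<open>A chart carries the results on functions of coordinates over to a subspace of an ambient
  space. Coordinates are 0 outside \<open>I\<close>, so that \<open>\<kappa>\<close> is linear at
  every index and equalities of coordinate functions hold without case distinctions.\<close>

locale chart = vector_space s for s :: "'k::field \<Rightarrow> 'e::ab_group_add \<Rightarrow> 'e" +
  fixes E :: "'e set" and \<kappa> :: "'e \<Rightarrow> 'i \<Rightarrow> 'k" and I :: "'i set"
  assumes subspace_carrier: "subspace E" and finite_coords: "finite I"
    and coord_linear: "\<And>i. i \<in> I \<Longrightarrow> linear_on s (*) E (\<lambda>x. \<kappa> x i)"
    and coord_surj: "\<And>z. \<exists>x\<in>E. \<forall>i\<in>I. \<kappa> x i = z i"
    and coord_inj: "\<And>x y. x \<in> E \<Longrightarrow> y \<in> E \<Longrightarrow> (\<And>i. i \<in> I \<Longrightarrow> \<kappa> x i = \<kappa> y i) \<Longrightarrow> x = y"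
    and coord_support: "\<And>x i. x \<in> E \<Longrightarrow> i \<notin> I \<Longrightarrow> \<kappa> x i = 0"
begin

lemma carrier_closed: "0 \<in> E" "x \<in> E \<Longrightarrow> y \<in> E \<Longrightarrow> x + y \<in> E" "x \<in> E \<Longrightarrow> s c x \<in> E"
  using subspace_carrier subspace_0 subspace_add subspace_scale by blast+

lemma coord_add: "x \<in> E \<Longrightarrow> y \<in> E \<Longrightarrow> \<kappa> (x + y) i = \<kappa> x i + \<kappa> y i"
  using coord_linear[of i] coord_support carrier_closed by (cases "i \<in> I") (auto simp: linear_on_def)

lemma coord_scale: "x \<in> E \<Longrightarrow> \<kappa> (s c x) i = c * \<kappa> x i"
  using coord_linear[of i] coord_support carrier_closed by (cases "i \<in> I") (auto simp: linear_on_def)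

lemma coord_0: "\<kappa> 0 i = 0"
  using coord_scale[OF carrier_closed(1), of 0 i] by simp

lemma coord_sum: "(\<And>l. l \<in> L \<Longrightarrow> x l \<in> E) \<Longrightarrow> \<kappa> (\<Sum>l\<in>L. x l) i = (\<Sum>l\<in>L. \<kappa> (x l) i)"
proof (induction L rule: infinite_finite_induct)
  case (insert l L)
  then have "(\<Sum>l\<in>L. x l) \<in> E" by (intro subspace_sum[OF subspace_carrier]) simp
  with insert show ?case by (simp add: coord_add)
qed (auto simp: coord_0)

definition point :: "('i \<Rightarrow> 'k) \<Rightarrow> 'e" where
  "point z = (SOME x. x \<in> E \<and> (\<forall>i\<in>I. \<kappa> x i = z i))"

lemma point: "point z \<in> E" "i \<in> I \<Longrightarrow> \<kappa> (point z) i = z i"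
  using someI_ex[of "\<lambda>x. x \<in> E \<and> (\<forall>i\<in>I. \<kappa> x i = z i)"] coord_surj[of z]
  unfolding point_def by auto

definition unit :: "'i \<Rightarrow> 'e" where
  "unit i = point (\<lambda>j. if j = i then 1 else 0)"

lemma unit_in: "unit i \<in> E"
  by (simp add: unit_def point)

lemma expansion:
  assumes "x \<in> E"
  shows "x = (\<Sum>i\<in>I. s (\<kappa> x i) (unit i))"
proof (rule coord_inj[OF assms])
  show "(\<Sum>i\<in>I. s (\<kappa> x i) (unit i)) \<in> E"
    by (intro subspace_sum[OF subspace_carrier] carrier_closed unit_in)
  fix j assume j: "j \<in> I"
  have "\<kappa> (\<Sum>i\<in>I. s (\<kappa> x i) (unit i)) j = (\<Sum>i\<in>I. if j = i then \<kappa> x i else 0)"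
    using j by (subst coord_sum) (auto simp: carrier_closed unit_in coord_scale unit_def point intro!: sum.cong)
  then show "\<kappa> x j = \<kappa> (\<Sum>i\<in>I. s (\<kappa> x i) (unit i)) j"
    using j finite_coords by simp
qed

lemma linear_on_expansion:
  assumes "vector_space s'" "linear_on s s' E f" "x \<in> E"
  shows "f x = (\<Sum>i\<in>I. s' (\<kappa> x i) (f (unit i)))"
proof -
  have "f x = f (\<Sum>i\<in>I. s (\<kappa> x i) (unit i))" using expansion[OF assms(3)] by simp
  also have "\<dots> = (\<Sum>i\<in>I. f (s (\<kappa> x i) (unit i)))"
    by (intro linear_on_sum[OF assms(2) vector_space_axioms assms(1) subspace_carrier] carrier_closed unit_in)
  also have "\<dots> = (\<Sum>i\<in>I. s' (\<kappa> x i) (f (unit i)))"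
    using assms(2) unit_in by (intro sum.cong) (auto simp: linear_on_def)
  finally show ?thesis .
qed

lemma polyfun_pf:
  assumes "f \<in> polyfun s E"
  shows "\<exists>g\<in>pf I. \<forall>x\<in>E. f x = g (\<kappa> x)"
  using assms
proof induction
  case (const c)
  show ?case by (intro bexI[of _ "\<lambda>_. c"] pf_pdeg[OF pdeg.const]) simp
next
  case (lin f)
  have "pdeg I 1 (\<lambda>z. \<Sum>i\<in>I. f (unit i) * z i)"
    by (intro pdeg_sum pdeg_cmult) (simp add: pdeg_coord)
  moreover have "\<forall>x\<in>E. f x = (\<Sum>i\<in>I. f (unit i) * \<kappa> x i)"
    using linear_on_expansion[OF vector_space_mult lin] by (simp add: mult.commute)
  ultimately show ?case
    by (intro bexI[of _ "\<lambda>z. \<Sum>i\<in>I. f (unit i) * z i"]) (auto intro: pf_pdeg)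
next
  case (add f g)
  then obtain f' g' where "f' \<in> pf I" "\<forall>x\<in>E. f x = f' (\<kappa> x)" "g' \<in> pf I" "\<forall>x\<in>E. g x = g' (\<kappa> x)" by blast
  then show ?case by (intro bexI[of _ "f' + g'"] pf_closed) auto
next
  case (mult f g)
  then obtain f' g' where "f' \<in> pf I" "\<forall>x\<in>E. f x = f' (\<kappa> x)" "g' \<in> pf I" "\<forall>x\<in>E. g x = g' (\<kappa> x)" by blast
  then show ?case by (intro bexI[of _ "f' * g'"] pf_closed) auto
qed

lemma pf_polyfun:
  assumes "g \<in> pf I"
  shows "(\<lambda>x. g (\<kappa> x)) \<in> polyfun s E"
proof -
  from assms obtain d where "pdeg I d g" by (auto simp: pf_def)
  then show ?thesis
    by induction (simp_all add: polyfun.intros coord_linear)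
qed

text \<open>The projective topology is defined by homogeneous functions, while the vanishing ideal
  of a cone is formed among all polynomials; this decomposition links the two.\<close>

lemma pdeg_homogeneous_parts:
  assumes "pdeg I d f"
  shows "\<exists>fs. (\<forall>j. hom_polyfun s E j (fs j)) \<and> (\<forall>x\<in>E. f (\<kappa> x) = (\<Sum>j\<le>d. fs j x))"
  using assms
proof induction
  case (const d c)
  have zero: "hom_polyfun s E j (\<lambda>_. 0)" for j
  proof (induction j)
    case 0
    show ?case by (rule hom_polyfun.const)
  next
    case (Suc j)
    have "linear_on s (*) E (\<lambda>_. 0)" by (simp add: linear_on_def)
    from hom_polyfun.mult[OF hom_polyfun.lin[OF this] Suc] show ?case by simp
  qed
  have "hom_polyfun s E j (\<lambda>x. if j = 0 then c else 0)" for j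
    using zero[of j] hom_polyfun.const[of s E c] by (cases "j = 0") auto
  then show ?case by (intro exI[of _ "\<lambda>j x. if j = 0 then c else 0"]) simp
next
  case (var d f i)
  then obtain fs where fs: "\<And>j. hom_polyfun s E j (fs j)" "\<And>x. x \<in> E \<Longrightarrow> f (\<kappa> x) = (\<Sum>j\<le>d. fs j x)" by blast
  define gs where "gs = (\<lambda>j x. case j of 0 \<Rightarrow> 0 | Suc j' \<Rightarrow> \<kappa> x i * fs j' x)"
  have "hom_polyfun s E j (gs j)" for j
    using hom_polyfun.const[of s E 0] hom_polyfun.mult[OF hom_polyfun.lin[OF coord_linear[OF var.hyps(2)]] fs(1)]
    by (cases j) (auto simp: gs_def)
  moreover have "\<kappa> x i * f (\<kappa> x) = (\<Sum>j\<le>Suc d. gs j x)" if "x \<in> E" for x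
    unfolding sum.atMost_Suc_shift by (simp add: gs_def fs(2)[OF that] sum_distrib_left)
  ultimately show ?case by blast
next
  case (add d f g)
  then obtain fs gs where "\<forall>j. hom_polyfun s E j (fs j)" "\<forall>x\<in>E. f (\<kappa> x) = (\<Sum>j\<le>d. fs j x)"
    "\<forall>j. hom_polyfun s E j (gs j)" "\<forall>x\<in>E. g (\<kappa> x) = (\<Sum>j\<le>d. gs j x)" by blast
  then show ?case
    by (intro exI[of _ "\<lambda>j x. fs j x + gs j x"]) (auto simp: sum.distrib intro: hom_polyfun.add)
qed

end

lemma hom_polyfun_polyfun: "hom_polyfun s E d f \<Longrightarrow> f \<in> polyfun s E"
  by (induction rule: hom_polyfun.induct) (auto intro: polyfun.intros)

section \<open>Cones over irreducible quasiprojective sets\<close>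

locale projective_chart = chart s E \<kappa> I
  for s :: "'k::alg_closed_field \<Rightarrow> 'e::ab_group_add \<Rightarrow> 'e" and E :: "'e set" and \<kappa> :: "'e \<Rightarrow> 'i \<Rightarrow> 'k" and I +
  fixes X :: "'e set set"
  assumes locally_closed: "locally_closedin (proj_zariski s E) X"
    and irreducible: "irreducible_in (proj_zariski s E) X"
begin

abbreviation Y :: "'e set" where "Y \<equiv> affine_cone X"

lemmas proj_top = topspace_proj_zariski[OF vector_space_axioms subspace_carrier]
  closedin_proj_zariski[OF vector_space_axioms subspace_carrier]

lemma X_proj: "X \<subseteq> proj_space s E" "X \<noteq> {}"
  using irreducible by (auto simp: irreducible_in_def proj_top)

lemma X_line:
  assumes "L \<in> X"
  obtains x where "x \<in> E" "x \<noteq> 0" "L = span {x}"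
  using assms X_proj by (auto simp: proj_space_def)

lemma cone_subset: "Y \<subseteq> E"
proof
  fix y assume "y \<in> Y"
  then obtain L where L: "L \<in> X" "y \<in> L" by (auto simp: affine_cone_def)
  from L(1) obtain x where "x \<in> E" "L = span {x}" by (rule X_line)
  with L(2) show "y \<in> E" by (auto simp: span_singleton intro: carrier_closed)
qed

lemma cone_scale: "y \<in> Y \<Longrightarrow> s c y \<in> Y"
proof -
  assume "y \<in> Y"
  then obtain L where L: "L \<in> X" "y \<in> L" by (auto simp: affine_cone_def)
  from L(1) obtain x where "L = span {x}" by (rule X_line)
  with L show "s c y \<in> Y" by (auto simp: affine_cone_def intro: span_scale)
qed

lemma cone_nonzero:
  obtains y where "y \<in> Y" "y \<noteq> 0"
proof -
  from X_proj(2) obtain L where L: "L \<in> X" by blast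
  then obtain x where "x \<noteq> 0" "L = span {x}" by (rule X_line)
  moreover from this have "x \<in> Y" using L by (auto simp: affine_cone_def intro: span_base)
  ultimately show ?thesis using that by blast
qed

text \<open>
  Along each line of the cone, polynomials restrict to polynomials in one variable whose
  coefficients are values of homogeneous parts; so if \<open>f g\<close> vanishes on the cone, then on each line
  all homogeneous parts of \<open>f\<close> or all of \<open>g\<close> vanish, and projective irreducibility applies.
\<close>

lemma prime_vanishing: "prime_in (pf I) (vanishing I (\<kappa> ` Y))"
  unfolding prime_in_def ideal_in_def
proof (intro conjI ballI impI)
  show "1 \<notin> vanishing I (\<kappa> ` Y)" using cone_nonzero by (auto simp: vanishing_def)
  fix f g assume f: "f \<in> pf I" and g: "g \<in> pf I" and fg: "f * g \<in> vanishing I (\<kappa> ` Y)"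
  from f g obtain d e where de: "pdeg I d f" "pdeg I e g" by (auto simp: pf_def)
  from pdeg_homogeneous_parts[OF de(1)] obtain fs where fs: "\<And>j. hom_polyfun s E j (fs j)"
    "\<And>x. x \<in> E \<Longrightarrow> f (\<kappa> x) = (\<Sum>j\<le>d. fs j x)" by blast
  from pdeg_homogeneous_parts[OF de(2)] obtain gs where gs: "\<And>j. hom_polyfun s E j (gs j)"
    "\<And>x. x \<in> E \<Longrightarrow> g (\<kappa> x) = (\<Sum>j\<le>e. gs j x)" by blast
  define V where "V = (\<lambda>d (fs :: nat \<Rightarrow> 'e \<Rightarrow> 'k). {L \<in> proj_space s E. \<forall>f\<in>fs ` {..d}. \<forall>x\<in>L. f x = 0})"
  have closed: "closedin (proj_zariski s E) (V d fs)" if "\<And>j. hom_polyfun s E j (fs j)" for d fs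
    unfolding proj_top V_def using that by (intro exI[of _ "fs ` {..d}"]) auto
  have line: "span {x} \<in> V d fs"
    if "span {x} \<in> X" "x \<in> E" "\<forall>j\<le>d. fs j x = 0" "\<And>j. hom_polyfun s E j (fs j)" for x d fs
    using that X_proj(1) hom_polyfun_scale[OF that(4) that(2)]
    by (auto simp: V_def span_singleton)
  have "X \<subseteq> V d fs \<union> V e gs"
  proof
    fix L assume L: "L \<in> X"
    then obtain x where x: "x \<in> E" "L = span {x}" by (rule X_line)
    define F where "F = (\<Sum>j\<le>d. monom (fs j x) j)"
    define G where "G = (\<Sum>j\<le>e. monom (gs j x) j)"
    have cF: "coeff F j = fs j x" if "j \<le> d" for j using that by (simp add: F_def coeff_sum)
    have cG: "coeff G j = gs j x" if "j \<le> e" for j using that by (simp add: G_def coeff_sum)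
    have "F * G = 0"
    proof (rule ccontr)
      assume "F * G \<noteq> 0"
      then obtain c where c: "poly (F * G) c \<noteq> 0" by (rule poly_nonroot)
      have "s c x \<in> L" unfolding x(2) by (intro span_scale span_base) simp
      then have "s c x \<in> Y" using L by (auto simp: affine_cone_def)
      with fg have "f (\<kappa> (s c x)) * g (\<kappa> (s c x)) = 0" by (auto simp: vanishing_def)
      moreover have "f (\<kappa> (s c x)) = poly F c"
        using x(1) by (simp add: fs(2) carrier_closed F_def poly_sum poly_monom
            hom_polyfun_scale[OF fs(1)] mult.commute)
      moreover have "g (\<kappa> (s c x)) = poly G c"
        using x(1) by (simp add: gs(2) carrier_closed G_def poly_sum poly_monom
            hom_polyfun_scale[OF gs(1)] mult.commute)
      ultimately show False using c by simp
    qed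
    then have "F = 0 \<or> G = 0" by simp
    then have "(\<forall>j\<le>d. fs j x = 0) \<or> (\<forall>j\<le>e. gs j x = 0)" using cF cG by (metis coeff_0)
    with line[OF _ x(1)] L x(2) fs(1) gs(1) show "L \<in> V d fs \<union> V e gs" by blast
  qed
  with irreducible closed[OF fs(1)] closed[OF gs(1)] have X: "X \<subseteq> V d fs \<or> X \<subseteq> V e gs"
    unfolding irreducible_in_def by blast
  have van: "f \<in> vanishing I (\<kappa> ` Y)"
    if X: "X \<subseteq> V d fs" and f: "f \<in> pf I" "\<And>x. x \<in> E \<Longrightarrow> f (\<kappa> x) = (\<Sum>j\<le>d. fs j x)" for f d fs
  proof -
    have "f (\<kappa> y) = 0" if y: "y \<in> Y" for y
    proof -
      from y obtain L where "L \<in> X" "y \<in> L" by (auto simp: affine_cone_def)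
      with X have "\<forall>j\<le>d. fs j y = 0" by (auto simp: V_def)
      then show ?thesis using f(2) y cone_subset by auto
    qed
    with f(1) show ?thesis by (auto simp: vanishing_def)
  qed
  from X van[OF _ f fs(2)] van[OF _ g gs(2)]
  show "f \<in> vanishing I (\<kappa> ` Y) \<or> g \<in> vanishing I (\<kappa> ` Y)" by blast
qed (auto simp: vanishing_def intro: pf_closed)

text \<open>\<open>h\<close> comes from a homogeneous equation of the complement of the open set
  \<open>O'\<close> that does not vanish on all of \<open>X\<close>. The cone may fail to be closed,
  but it contains the part of its closure where \<open>h\<close> is nonzero.\<close>

lemma cone_locally_closed:
  obtains h where "h \<in> pf I" "h \<notin> vanishing I (\<kappa> ` Y)"
    "\<And>x. x \<in> E \<Longrightarrow> (\<forall>f\<in>vanishing I (\<kappa> ` Y). f (\<kappa> x) = 0) \<Longrightarrow> h (\<kappa> x) \<noteq> 0 \<Longrightarrow> x \<in> Y"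
proof -
  let ?H = "{f. \<exists>d. hom_polyfun s E d f}"
  from locally_closed obtain O' Z where X: "X = O' \<inter> Z" and "openin (proj_zariski s E) O'"
    and Z: "closedin (proj_zariski s E) Z" by (auto simp: locally_closedin_def)
  then have "closedin (proj_zariski s E) (proj_space s E - O')" and sub: "O' \<subseteq> proj_space s E"
    using openin_subset by (fastforce simp: proj_top(1)[symmetric])+
  with Z obtain F G where F: "F \<subseteq> ?H" "proj_space s E - O' = {L \<in> proj_space s E. \<forall>f\<in>F. \<forall>x\<in>L. f x = 0}"
    and G: "G \<subseteq> ?H" "Z = {L \<in> proj_space s E. \<forall>f\<in>G. \<forall>x\<in>L. f x = 0}"
    unfolding proj_top by blast
  from X_proj(2) obtain L0 where L0: "L0 \<in> X" by blast
  then have "L0 \<in> proj_space s E" "L0 \<notin> proj_space s E - O'" using X_proj X by auto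
  with F obtain h0 x0 where h0: "h0 \<in> F" "x0 \<in> L0" "h0 x0 \<noteq> 0" by auto
  have "h0 \<in> polyfun s E" using F(1) h0(1) hom_polyfun_polyfun by blast
  from polyfun_pf[OF this] obtain h where h: "h \<in> pf I" "\<And>x. x \<in> E \<Longrightarrow> h0 x = h (\<kappa> x)" by blast
  show ?thesis
  proof (rule that[OF h(1)])
    have "x0 \<in> Y" using L0 h0(2) by (auto simp: affine_cone_def)
    moreover from this have "h (\<kappa> x0) \<noteq> 0" using h(2)[of x0] h0(3) cone_subset by auto
    ultimately show "h \<notin> vanishing I (\<kappa> ` Y)" by (auto simp: vanishing_def)
    fix x assume x: "x \<in> E" "\<forall>f\<in>vanishing I (\<kappa> ` Y). f (\<kappa> x) = 0" "h (\<kappa> x) \<noteq> 0"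
    show "x \<in> Y"
    proof (cases "x = 0")
      case True
      from L0 obtain y where "L0 = span {y}" by (rule X_line)
      with True L0 show ?thesis by (auto simp: affine_cone_def intro: span_zero)
    next
      case False
      then have L: "span {x} \<in> proj_space s E" using x(1) by (auto simp: proj_space_def)
      have "g y = 0" if g: "g \<in> G" "y \<in> span {x}" for g y
      proof -
        from g(1) G(1) obtain d where d: "hom_polyfun s E d g" by blast
        from polyfun_pf[OF hom_polyfun_polyfun[OF d]] obtain g' where
          g': "g' \<in> pf I" "\<And>x. x \<in> E \<Longrightarrow> g x = g' (\<kappa> x)" by blast
        have "g' (\<kappa> y) = 0" if "y \<in> Y" for y
        proof -
          from that obtain L where "L \<in> X" "y \<in> L" by (auto simp: affine_cone_def)
          with X G(2) g(1) have "g y = 0" by blast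
          with g'(2) that cone_subset show ?thesis by auto
        qed
        then have "g' \<in> vanishing I (\<kappa> ` Y)" using g'(1) by (auto simp: vanishing_def)
        with x(1,2) g'(2) have "g x = 0" by simp
        with g(2) hom_polyfun_scale[OF d x(1)] show ?thesis by (auto simp: span_singleton)
      qed
      then have "span {x} \<in> Z" using L G(2) by blast
      moreover have "span {x} \<in> O'"
      proof (rule ccontr)
        assume "\<not> ?thesis"
        with L have "span {x} \<in> proj_space s E - O'" by blast
        with F(2) h0(1) have "h0 x = 0" by (auto intro: span_base)
        with h(2)[OF x(1)] x(3) show False by simp
      qed
      ultimately have "span {x} \<in> X" using X by blast
      then show ?thesis by (auto simp: affine_cone_def intro: span_base)
    qed
  qed
qed

abbreviation cone_dim :: enat where
  "cone_dim \<equiv> krull_dim (subtopology (zariski s E) Y)"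

text \<open>Since the primes of the chain omit \<open>h\<close>, each can be recovered from its
  zeros inside the cone: a function outside \<open>Q i\<close> is nonzero somewhere on
  \<open>Z i\<close>. Irreducibility and strictness of the inclusions both follow from this.\<close>

lemma card_independent_le_cone_dim:
  assumes J: "J \<subseteq> I" "vanishing I (\<kappa> ` Y) \<inter> pf J \<subseteq> {0}"
  shows "enat (card J) \<le> cone_dim"
proof -
  let ?P = "vanishing I (\<kappa> ` Y)" and ?T = "subtopology (zariski s E) Y"
  obtain h where h: "h \<in> pf I" "h \<notin> ?P"
    and hY: "\<And>x. x \<in> E \<Longrightarrow> (\<forall>f\<in>?P. f (\<kappa> x) = 0) \<Longrightarrow> h (\<kappa> x) \<noteq> 0 \<Longrightarrow> x \<in> Y"
    using cone_locally_closed by blast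
  from prime_chain[OF finite_coords prime_vanishing h J] obtain Q where
    Q': "\<forall>i\<le>card J. prime_in (pf I) (Q i) \<and> h \<notin> Q i \<and> ?P \<subseteq> Q i"
    and chain': "\<forall>i<card J. Q (Suc i) \<subset> Q i" by (elim exE conjE)
  have Q: "\<And>i. i \<le> card J \<Longrightarrow> prime_in (pf I) (Q i)" "\<And>i. i \<le> card J \<Longrightarrow> h \<notin> Q i"
      "\<And>i. i \<le> card J \<Longrightarrow> ?P \<subseteq> Q i" using Q' by simp_all
  note chain = chain'[rule_format]
  define Z where "Z = (\<lambda>i. {y \<in> Y. \<forall>f\<in>Q i. f (\<kappa> y) = 0})"
  have key: "\<exists>y\<in>Z i. v (\<kappa> y) \<noteq> 0" if i: "i \<le> card J" and v: "v \<in> pf I" "v \<notin> Q i" for i v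
  proof -
    \<comment> \<open>The Nullstellensatz is applied to \<open>v * h\<close> because a nonzero value
      of \<open>h\<close> is what places the point in the cone.\<close>
    have "v * h \<in> pf I" using v h by (intro pf_closed)
    moreover have "v * h \<notin> Q i" using prime_inD(6)[OF Q(1)[OF i] v(1) h(1)] v(2) Q(2)[OF i] by blast
    ultimately obtain z where z: "\<And>f. f \<in> Q i \<Longrightarrow> f z = 0" "(v * h) z \<noteq> 0"
      using nullstellensatz[OF finite_coords Q(1)[OF i], of "v * h" thesis] by blast
    have *: "f (\<kappa> (point z)) = f z" if "f \<in> pf I" for f
      using that by (rule pf_cong) (simp add: point)
    have Qz: "f (\<kappa> (point z)) = 0" if f: "f \<in> Q i" for f
    proof -
      have "f \<in> pf I" using f prime_inD(1)[OF Q(1)[OF i]] by blast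
      then show ?thesis using z(1)[OF f] by (simp only: *)
    qed
    have "point z \<in> Y"
      using Qz Q(3)[OF i] z(2) *[OF h(1)] by (intro hY) (auto simp: point)
    then have "point z \<in> Z i" using Qz by (simp add: Z_def)
    with z(2) *[OF v(1)] show ?thesis by (intro bexI[of _ "point z"]) auto
  qed
  have closed: "closedin ?T (Z i)" if "i \<le> card J" for i
    unfolding closedin_subtopology
  proof (intro exI conjI)
    have "{\<lambda>x. f (\<kappa> x) |f. f \<in> Q i} \<subseteq> polyfun s E"
      using pf_polyfun prime_inD(1)[OF Q(1)[OF that]] by blast
    then show "closedin (zariski s E) {x \<in> E. \<forall>f\<in>{\<lambda>x. f (\<kappa> x) |f. f \<in> Q i}. f x = 0}"
      unfolding closedin_zariski by blast
    show "Z i = {x \<in> E. \<forall>f\<in>{\<lambda>x. f (\<kappa> x) |f. f \<in> Q i}. f x = 0} \<inter> Y"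
      using cone_subset by (auto simp: Z_def)
  qed
  have irr: "irreducible_in ?T (Z i)" if i: "i \<le> card J" for i
    unfolding irreducible_in_def
  proof (intro conjI allI impI)
    show "Z i \<subseteq> topspace ?T" using cone_subset by (auto simp: Z_def topspace_zariski)
    show "Z i \<noteq> {}"
      using key[OF i pf_closed(2)] prime_inD(5)[OF Q(1)[OF i]] by blast
    fix A B assume AB: "closedin ?T A \<and> closedin ?T B \<and> Z i \<subseteq> A \<union> B"
    have sep: "\<exists>g\<in>pf I. g \<notin> Q i \<and> (\<forall>x\<in>A. g (\<kappa> x) = 0)"
      if A: "closedin ?T A" "\<not> Z i \<subseteq> A" for A
    proof -
      from A(1) obtain F where F: "F \<subseteq> polyfun s E" "A = {x \<in> E. \<forall>f\<in>F. f x = 0} \<inter> Y"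
        unfolding closedin_subtopology closedin_zariski by blast
      from A(2) obtain y where y: "y \<in> Z i" "y \<notin> A" by blast
      then have yY: "y \<in> Y" "y \<in> E" using cone_subset by (auto simp: Z_def)
      with y(2) F(2) obtain f where f: "f \<in> F" "f y \<noteq> 0" by blast
      with F(1) have "f \<in> polyfun s E" by blast
      from polyfun_pf[OF this] obtain g where g: "g \<in> pf I" "\<forall>x\<in>E. f x = g (\<kappa> x)" by blast
      have "g \<notin> Q i" using y(1) g(2) f(2) yY by (auto simp: Z_def)
      moreover have "\<forall>x\<in>A. g (\<kappa> x) = 0" using F(2) f(1) g(2) by auto
      ultimately show ?thesis using g(1) by blast
    qed
    show "Z i \<subseteq> A \<or> Z i \<subseteq> B"
    proof (rule ccontr)
      assume "\<not> ?thesis"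
      with AB sep obtain f g where f: "f \<in> pf I" "f \<notin> Q i" "\<forall>x\<in>A. f (\<kappa> x) = 0"
        and g: "g \<in> pf I" "g \<notin> Q i" "\<forall>x\<in>B. g (\<kappa> x) = 0" by metis
      have "f * g \<notin> Q i" using prime_inD(6)[OF Q(1)[OF i] f(1) g(1)] f(2) g(2) by blast
      with key[OF i pf_closed(4)[OF f(1) g(1)]] obtain y where "y \<in> Z i" "(f * g) (\<kappa> y) \<noteq> 0" by blast
      with AB f(3) g(3) show False by auto
    qed
  qed
  have strict: "Z i \<subset> Z (Suc i)" if i: "i < card J" for i
  proof -
    have "Z i \<subseteq> Z (Suc i)" using chain[OF i] by (auto simp: Z_def)
    moreover from chain[OF i] obtain v where v: "v \<in> Q i" "v \<notin> Q (Suc i)" by blast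
    then have "v \<in> pf I" using prime_inD(1)[OF Q(1)[of i]] i by auto
    with v i key[of "Suc i" v] have "\<exists>y\<in>Z (Suc i). v (\<kappa> y) \<noteq> 0" by simp
    then have "Z (Suc i) \<noteq> Z i" using v(1) by (auto simp: Z_def)
    ultimately show ?thesis by blast
  qed
  show ?thesis
    unfolding krull_dim_def
    by (rule Sup_upper) (use closed irr strict in \<open>blast\<close>)
qed

text \<open>A nonzero vector spans a line inside the cone, on which some coordinate takes all
  values. Through the dimension hypothesis this makes \<open>U\<close> nonzero.\<close>

lemma cone_dim_pos: "1 \<le> cone_dim"
proof -
  obtain y where y: "y \<in> Y" "y \<noteq> 0" by (rule cone_nonzero)
  then have yE: "y \<in> E" using cone_subset by blast
  obtain t where t: "t \<in> I" "\<kappa> y t \<noteq> 0"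
    using coord_inj[OF yE carrier_closed(1)] y(2) coord_0 by auto
  have "f = 0" if f: "f \<in> vanishing I (\<kappa> ` Y)" "f \<in> pf {t}" for f
  proof
    fix z
    let ?y = "s (z t / \<kappa> y t) y"
    have "f z = f (\<kappa> ?y)" using f(2) t(2) by (intro pf_cong[of f "{t}"]) (auto simp: coord_scale[OF yE])
    also have "\<dots> = 0" using f(1) cone_scale[OF y(1)] by (auto simp: vanishing_def)
    finally show "f z = 0 z" by simp
  qed
  then have "enat (card {t}) \<le> cone_dim"
    using t(1) by (intro card_independent_le_cone_dim) auto
  then show ?thesis by (simp add: one_enat_def)
qed

lemma growth_le_cone_dim:
  assumes "cone_dim = enat c"
  shows "growth_le I (\<kappa> ` Y) c"
proof -
  obtain J where J: "J \<subseteq> I" "vanishing I (\<kappa> ` Y) \<inter> pf J \<subseteq> {0}" "growth_le I (\<kappa> ` Y) (card J)"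
    by (rule growth_transcendence_degree[OF finite_coords prime_vanishing])
  from card_independent_le_cone_dim[OF J(1,2)] assms have "card J \<le> c" by simp
  with J(3) show ?thesis by (rule growth_le_mono)
qed

end

text \<open>The bilinear form of the statement serves twice: with \<open>T (ev b x)\<close> as
  \<open>\<mu> b x\<close>, and with \<open>b i v\<close> as \<open>\<mu> b v\<close>.\<close>

lemma bilinear_kernel_not_dense:
  fixes sE :: "'k::alg_closed_field \<Rightarrow> 'e::ab_group_add \<Rightarrow> 'e"
    and \<mu> :: "'b::ab_group_add \<Rightarrow> 'e \<Rightarrow> 'u::ab_group_add"
  assumes E: "chart sE E \<kappa>E IE" and B: "chart sB B \<kappa>B IB" and U: "chart sU U \<kappa>U IU"
    and \<mu>B: "\<And>x. x \<in> E \<Longrightarrow> linear_on sB sU B (\<lambda>b. \<mu> b x)"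
    and \<mu>E: "\<And>b. b \<in> B \<Longrightarrow> linear_on sE sU E (\<mu> b)"
    and \<mu>U: "\<And>b x. b \<in> B \<Longrightarrow> x \<in> E \<Longrightarrow> \<mu> b x \<in> U"
    and cone: "\<And>c z. z \<in> C \<Longrightarrow> (\<lambda>i. c * z i) \<in> C" and growth: "growth_le IE C (card IU)"
    and IU: "IU \<noteq> {}"
  shows "\<exists>F\<in>pf IB. F \<noteq> 0 \<and> (\<forall>x\<in>E. \<kappa>E x \<in> C \<longrightarrow> (\<lambda>b. \<mu> b x) ` B = U \<longrightarrow>
    (\<forall>b\<in>B. \<mu> b x = 0 \<longrightarrow> F (\<kappa>B b) = 0))"
proof -
  interpret E: chart sE E \<kappa>E IE by fact
  interpret B: chart sB B \<kappa>B IB by fact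
  interpret U: chart sU U \<kappa>U IU by fact
  \<comment> \<open>Structure constants of \<open>\<mu>\<close>: \<open>M (\<kappa>E x)\<close> is
    the matrix of \<open>b \<mapsto> \<mu> b x\<close>, with entries linear in the coordinates of
    \<open>x\<close>.\<close>
  define M where "M = (\<lambda>z k j. \<Sum>i\<in>IE. \<kappa>U (\<mu> (B.unit j) (E.unit i)) k * z i)"
  have M: "(\<Sum>j\<in>IB. M (\<kappa>E x) k j * \<kappa>B b j) = \<kappa>U (\<mu> b x) k" if x: "x \<in> E" and b: "b \<in> B" for k x b
  proof -
    have "\<mu> b x = (\<Sum>j\<in>IB. sU (\<kappa>B b j) (\<mu> (B.unit j) x))"
      by (rule B.linear_on_expansion[OF U.vector_space_axioms \<mu>B[OF x] b])
    also have "\<kappa>U \<dots> k = (\<Sum>j\<in>IB. \<kappa>B b j * \<kappa>U (\<mu> (B.unit j) x) k)"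
      using x by (simp add: U.coord_sum U.coord_scale U.carrier_closed \<mu>U B.unit_in)
    also have "\<dots> = (\<Sum>j\<in>IB. M (\<kappa>E x) k j * \<kappa>B b j)"
    proof (rule sum.cong[OF refl])
      fix j
      have "\<mu> (B.unit j) x = (\<Sum>i\<in>IE. sU (\<kappa>E x i) (\<mu> (B.unit j) (E.unit i)))"
        by (rule E.linear_on_expansion[OF U.vector_space_axioms \<mu>E[OF B.unit_in] x])
      then have "\<kappa>U (\<mu> (B.unit j) x) k = M (\<kappa>E x) k j"
        by (simp add: U.coord_sum U.coord_scale U.carrier_closed \<mu>U B.unit_in E.unit_in M_def mult.commute)
      then show "\<kappa>B b j * \<kappa>U (\<mu> (B.unit j) x) k = M (\<kappa>E x) k j * \<kappa>B b j" by simp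
    qed
    finally show ?thesis ..
  qed
  have "\<forall>k\<in>IU. \<forall>j\<in>IB. pdeg IE 1 (\<lambda>z. M z k j)"
    unfolding M_def by (intro ballI pdeg_sum pdeg_cmult) (simp add: pdeg_coord)
  moreover have "\<forall>k\<in>IU. \<forall>j\<in>IB. \<forall>c x. M (\<lambda>i. c * x i) k j = c * M x k j"
    by (simp add: M_def sum_distrib_left algebra_simps)
  ultimately obtain F where F: "F \<in> pf IB" "F \<noteq> 0"
    and F0: "\<And>x b. x \<in> C \<Longrightarrow> forms_onto IU IB (M x) \<Longrightarrow> b \<in> forms_kernel IU IB (M x) \<Longrightarrow> F b = 0"
    using kernel_locus_not_dense[OF U.finite_coords IU B.finite_coords _ _ cone growth, of M] by blast
  have "F (\<kappa>B b) = 0"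
    if x: "x \<in> E" "\<kappa>E x \<in> C" "(\<lambda>b. \<mu> b x) ` B = U" and b: "b \<in> B" "\<mu> b x = 0" for x b
  proof -
    have "forms_onto IU IB (M (\<kappa>E x))"
      unfolding forms_onto_def
    proof
      fix c
      from x(3) U.point(1)[of c] obtain b' where b': "b' \<in> B" "\<mu> b' x = U.point c" by (metis imageE)
      then show "\<exists>b. \<forall>k\<in>IU. (\<Sum>j\<in>IB. M (\<kappa>E x) k j * b j) = c k"
        using M[OF x(1) b'(1)] U.point(2) by (intro exI[of _ "\<kappa>B b'"]) simp
    qed
    moreover have "\<kappa>B b \<in> forms_kernel IU IB (M (\<kappa>E x))"
      using M[OF x(1) b(1)] b(2) U.coord_0 by (simp add: forms_kernel_def)
    ultimately show ?thesis using F0 x(2) by blast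
  qed
  with F show ?thesis by blast
qed


section \<open>Tensors and endomorphisms\<close>

text \<open>The basis vectors themselves are the indices, so varying dimensions fit into one index
  type and tensors can be expanded along the index set.\<close>

lemma fd_space_chart:
  fixes s :: "'k::field \<Rightarrow> 'e::ab_group_add \<Rightarrow> 'e"
  assumes "fd_space s E"
  obtains \<kappa> and A :: "'e set" where "A \<subseteq> E" "card A = vector_space.dim s E" "chart s E \<kappa> A"
    "\<And>a. a \<in> A \<Longrightarrow> chart.unit E \<kappa> A a = a"
proof -
  interpret vector_space s using assms by (simp add: fd_space_def)
  obtain A where A: "finite A" "A \<subseteq> E" "independent A" "span A = E"
    using fd_space_basis[OF assms] .
  have inj: "x = y" if "x \<in> E" "y \<in> E" "\<And>i. i \<in> A \<Longrightarrow> representation A x i = representation A y i" for x y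
  proof -
    have *: "(\<Sum>a\<in>A. s (representation A v a) a) = v" if "v \<in> E" for v
      using sum_representation_eq[OF A(3), of v A] A that by simp
    have "x = (\<Sum>a\<in>A. s (representation A x a) a)" using *[OF that(1)] by (rule sym)
    also have "\<dots> = (\<Sum>a\<in>A. s (representation A y a) a)" using that(3) by (intro sum.cong) auto
    also have "\<dots> = y" by (rule *[OF that(2)])
    finally show ?thesis .
  qed
  have rep: "representation A a b = (if b = a then 1 else 0)" if "a \<in> A" for a b
    using representation_basis[OF A(3) that] by auto
  have ch: "chart s E (representation A) A"
  proof (unfold_locales)
    show "subspace E" using A(4) by (metis subspace_span)
    show "linear_on s (*) E (\<lambda>x. representation A x i)" for i
      using representation_add[OF A(3)] representation_scale[OF A(3)] A(4) by (auto simp: linear_on_def)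
    show "\<exists>x\<in>E. \<forall>i\<in>A. representation A x i = z i" for z
    proof (intro bexI ballI)
      show "(\<Sum>a\<in>A. s (z a) a) \<in> E"
        unfolding A(4)[symmetric] by (intro span_sum span_scale span_base)
      fix i assume i: "i \<in> A"
      have "representation A (\<Sum>a\<in>A. s (z a) a) i = (\<Sum>a\<in>A. representation A (s (z a) a) i)"
        using A by (subst representation_sum[OF A(3)]) (auto intro: span_scale span_base)
      also have "\<dots> = (\<Sum>a\<in>A. if i = a then z a else 0)"
        using A by (intro sum.cong) (auto simp: representation_scale[OF A(3)] span_base rep)
      finally show "representation A (\<Sum>a\<in>A. s (z a) a) i = z i" using i A(1) by simp
    qed
    show "representation A x i = 0" if "i \<notin> A" for x i
      using that representation_ne_zero by blast
  qed (use A(1) inj in auto)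
  interpret c: chart s E "representation A" A by (rule ch)
  have "c.unit a = a" if "a \<in> A" for a
    by (rule c.coord_inj) (use that A(2) in \<open>auto simp: c.unit_def c.point rep\<close>)
  moreover have "card A = dim E" using dim_eq_card[of A E] A by (metis span_eq span_span)
  ultimately show ?thesis using that A ch by blast
qed

lemma subspace_dsum:
  assumes "vector_space s" "\<And>i. i \<in> {1..l} \<Longrightarrow> module.subspace s (E i)"
  shows "module.subspace (fun_scale s) (indexed_dsum l E)"
proof -
  interpret vector_space s by fact
  interpret f: vector_space "fun_scale s" by (rule vector_space_fun_scale) fact
  show ?thesis
    unfolding f.subspace_def indexed_dsum_def fun_scale_def
    using assms(2) subspace_0 subspace_add subspace_scale by auto
qed

lemma chart_dsum:
  fixes s :: "'k::field \<Rightarrow> 'e::ab_group_add \<Rightarrow> 'e" and \<kappa> :: "nat \<Rightarrow> 'e \<Rightarrow> 'i \<Rightarrow> 'k"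
  assumes s: "vector_space s" and ch: "\<And>i. i \<in> {1..l} \<Longrightarrow> chart s (E i) (\<kappa> i) (I i)"
  shows "chart (fun_scale s) (indexed_dsum l E)
    (\<lambda>x (i, b). if i \<in> {1..l} then \<kappa> i (x i) b else 0) (Sigma {1..l} I)"
proof -
  interpret vector_space s by fact
  interpret f: vector_space "fun_scale s" by (rule vector_space_fun_scale) fact
  have xi: "x i \<in> E i" if "x \<in> indexed_dsum l E" "i \<in> {1..l}" for x i
    using that by (simp add: indexed_dsum_def)
  show ?thesis
  proof
    show "f.subspace (indexed_dsum l E)"
      using chart.subspace_carrier[OF ch] by (rule subspace_dsum[OF s])
    show "finite (Sigma {1..l} I)" using chart.finite_coords[OF ch] by auto
  next
    fix p assume "p \<in> Sigma {1..l} I"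
    then obtain i b where p: "p = (i, b)" "i \<in> {1..l}" "b \<in> I i" by auto
    interpret chart s "E i" "\<kappa> i" "I i" by (rule ch) fact
    show "linear_on (fun_scale s) (*) (indexed_dsum l E) (\<lambda>x. case p of (i, b) \<Rightarrow> if i \<in> {1..l} then \<kappa> i (x i) b else 0)"
      using p(2) xi[OF _ p(2)] by (auto simp: linear_on_def p(1) fun_scale_def coord_add coord_scale)
  next
    fix z :: "nat \<times> 'i \<Rightarrow> 'k"
    have "\<forall>i\<in>{1..l}. \<exists>y\<in>E i. \<forall>b\<in>I i. \<kappa> i y b = z (i, b)"
    proof
      fix i assume "i \<in> {1..l}"
      from chart.coord_surj[OF ch[OF this], of "\<lambda>b. z (i, b)"]
      show "\<exists>y\<in>E i. \<forall>b\<in>I i. \<kappa> i y b = z (i, b)" .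
    qed
    then obtain y where y: "\<And>i. i \<in> {1..l} \<Longrightarrow> y i \<in> E i \<and> (\<forall>b\<in>I i. \<kappa> i (y i) b = z (i, b))" by metis
    show "\<exists>x\<in>indexed_dsum l E. \<forall>p\<in>Sigma {1..l} I. (case p of (i, b) \<Rightarrow> if i \<in> {1..l} then \<kappa> i (x i) b else 0) = z p"
      by (intro bexI[of _ "\<lambda>i. if i \<in> {1..l} then y i else 0"]) (use y in \<open>auto simp: indexed_dsum_def\<close>)
  next
    fix x y assume x: "x \<in> indexed_dsum l E" and y: "y \<in> indexed_dsum l E"
      and eq: "\<And>p. p \<in> Sigma {1..l} I \<Longrightarrow> (case p of (i, b) \<Rightarrow> if i \<in> {1..l} then \<kappa> i (x i) b else 0) =
        (case p of (i, b) \<Rightarrow> if i \<in> {1..l} then \<kappa> i (y i) b else 0)"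
    show "x = y"
    proof
      fix i
      show "x i = y i"
      proof (cases "i \<in> {1..l}")
        case True
        show ?thesis
          by (rule chart.coord_inj[OF ch[OF True] xi[OF x True] xi[OF y True]]) (use eq[of "(i, _)"] True in auto)
      qed (use x y in \<open>auto simp: indexed_dsum_def\<close>)
    qed
  next
    fix x p assume x: "x \<in> indexed_dsum l E" and "p \<notin> Sigma {1..l} I"
    then show "(case p of (i, b) \<Rightarrow> if i \<in> {1..l} then \<kappa> i (x i) b else 0) = 0"
      using chart.coord_support[OF ch] xi[OF x] by (cases p) auto
  qed
qed

section \<open>Endomorphisms in coordinates\<close>

context chart
begin

lemma endo_expansion:
  assumes "\<phi> \<in> endos s E" "x \<in> E"
  shows "\<phi> x = (\<Sum>i\<in>I. s (\<kappa> x i) (\<phi> (unit i)))"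
  using assms(1) by (intro linear_on_expansion[OF vector_space_axioms _ assms(2)]) (simp add: endos_def)

lemma endo_exists:
  assumes "\<forall>i\<in>I. y i \<in> E"
  shows "\<exists>\<phi>\<in>endos s E. \<forall>i\<in>I. \<phi> (unit i) = y i"
proof (intro bexI ballI)
  define \<phi> where "\<phi> = (\<lambda>x. if x \<in> E then \<Sum>i\<in>I. s (\<kappa> x i) (y i) else 0)"
  show "\<phi> \<in> endos s E"
    unfolding endos_def linear_on_def
    using assms carrier_closed(2,3)
    by (auto simp: \<phi>_def coord_add coord_scale scale_left_distrib sum.distrib scale_sum_right
        intro!: subspace_sum[OF subspace_carrier])
  fix i assume i: "i \<in> I"
  have "\<phi> (unit i) = (\<Sum>j\<in>I. if j = i then y j else 0)"
    unfolding \<phi>_def if_P[OF unit_in] by (intro sum.cong) (auto simp: unit_def point)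
  then show "\<phi> (unit i) = y i" using i finite_coords by simp
qed

lemma chart_endos:
  "chart (fun_scale s) (endos s E)
    (\<lambda>\<phi> (i, j). if i \<in> I \<and> j \<in> I then \<kappa> (\<phi> (unit i)) j else 0) (I \<times> I)"
proof -
  interpret f: vector_space "fun_scale s" by (rule vector_space_fun_scale) (rule vector_space_axioms)
  have phi: "\<phi> x \<in> E" if "\<phi> \<in> endos s E" "x \<in> E" for \<phi> x using that by (auto simp: endos_def)
  show ?thesis
  proof
    show "f.subspace (endos s E)"
      unfolding f.subspace_def endos_def linear_on_def
      using carrier_closed by (auto simp: fun_scale_def scale_right_distrib algebra_simps image_subset_iff)
    show "finite (I \<times> I)" using finite_coords by simp
  next
    fix p assume "p \<in> I \<times> I"
    then show "linear_on (fun_scale s) (*) (endos s E)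
      (\<lambda>\<phi>. case p of (i, j) \<Rightarrow> if i \<in> I \<and> j \<in> I then \<kappa> (\<phi> (unit i)) j else 0)"
      using phi[OF _ unit_in] by (auto simp: linear_on_def fun_scale_def coord_add coord_scale)
  next
    fix z :: "'i \<times> 'i \<Rightarrow> 'k"
    obtain \<phi> where \<phi>: "\<phi> \<in> endos s E" "\<forall>i\<in>I. \<phi> (unit i) = point (\<lambda>j. z (i, j))"
      using endo_exists[of "\<lambda>i. point (\<lambda>j. z (i, j))"] point(1) by blast
    then show "\<exists>\<phi>\<in>endos s E. \<forall>p\<in>I \<times> I. (case p of (i, j) \<Rightarrow> if i \<in> I \<and> j \<in> I then \<kappa> (\<phi> (unit i)) j else 0) = z p"
      by (intro bexI[of _ \<phi>]) (auto simp: point)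
  next
    fix \<phi> \<psi> assume \<phi>: "\<phi> \<in> endos s E" and \<psi>: "\<psi> \<in> endos s E"
      and eq: "\<And>p. p \<in> I \<times> I \<Longrightarrow> (case p of (i, j) \<Rightarrow> if i \<in> I \<and> j \<in> I then \<kappa> (\<phi> (unit i)) j else 0) =
        (case p of (i, j) \<Rightarrow> if i \<in> I \<and> j \<in> I then \<kappa> (\<psi> (unit i)) j else 0)"
    have "\<phi> (unit i) = \<psi> (unit i)" if "i \<in> I" for i
      by (rule coord_inj[OF phi[OF \<phi> unit_in] phi[OF \<psi> unit_in]]) (use eq[of "(i, _)"] that in auto)
    then have "\<phi> x = \<psi> x" if "x \<in> E" for x
      using endo_expansion[OF \<phi> that] endo_expansion[OF \<psi> that] by simp
    moreover have "\<phi> x = \<psi> x" if "x \<notin> E" for x using that \<phi> \<psi> by (simp add: endos_def)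
    ultimately show "\<phi> = \<psi>" by blast
  next
    fix \<phi> p assume "\<phi> \<in> endos s E" "p \<notin> I \<times> I"
    then show "(case p of (i, j) \<Rightarrow> if i \<in> I \<and> j \<in> I then \<kappa> (\<phi> (unit i)) j else 0) = 0"
      by (cases p) auto
  qed
qed

text \<open>It suffices to move one basis vector that occurs in \<open>v\<close> and to send the
  others to 0.\<close>

lemma endo_transitive:
  assumes "v \<in> E" "v \<noteq> 0" "y \<in> E"
  obtains \<phi> where "\<phi> \<in> endos s E" "\<phi> v = y"
proof -
  obtain i where i: "i \<in> I" "\<kappa> v i \<noteq> 0"
    using coord_inj[OF assms(1) carrier_closed(1)] assms(2) coord_0 by auto
  have "\<forall>j\<in>I. (if j = i then s (inverse (\<kappa> v i)) y else 0) \<in> E"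
    using assms(3) carrier_closed by simp
  from endo_exists[OF this] obtain \<phi> where
    \<phi>: "\<phi> \<in> endos s E" "\<forall>j\<in>I. \<phi> (unit j) = (if j = i then s (inverse (\<kappa> v i)) y else 0)" by blast
  have "\<phi> v = (\<Sum>j\<in>I. if j = i then y else 0)"
    unfolding endo_expansion[OF \<phi>(1) assms(1)] using i by (intro sum.cong) (auto simp: \<phi>(2))
  then have "\<phi> v = y" using i finite_coords by simp
  with \<phi>(1) that show ?thesis by blast
qed

end

text \<open>Tensors are realised as forms on pairs of functionals, so this is how nonzero vectors
  are detected in them.\<close>

lemma separating_functional:
  assumes "vector_space s" "x \<noteq> 0"
  obtains f where "Vector_Spaces.linear s (*) f" "f x = (1 :: 'k::field)"
proof -
  interpret vector_space s by fact
  have ind: "independent {x}" using assms(2) by simp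
  define B where "B = extend_basis {x}"
  have B: "independent B" "span B = UNIV" "x \<in> B"
    using independent_extend_basis[OF ind] span_extend_basis[OF ind] extend_basis_superset[OF ind]
    by (auto simp: B_def)
  have "Vector_Spaces.linear s (*) (\<lambda>v. representation B v x)"
    by (simp add: Vector_Spaces.linear_def vector_space_axioms vector_space_mult
        module_hom_def module_hom_axioms_def module_iff_vector_space
        representation_add representation_scale B)
  moreover have "representation B x x = 1" using representation_basis[OF B(1,3)] by simp
  ultimately show ?thesis using that by blast
qed

locale tensor_chart = V: chart sV V \<kappa> A
  for sV :: "'k::field \<Rightarrow> 'v::ab_group_add \<Rightarrow> 'v" and V :: "'v set" and \<kappa> :: "'v \<Rightarrow> 'v \<Rightarrow> 'k"
    and A :: "'v set" +
  fixes sW :: "'k \<Rightarrow> 'w::ab_group_add \<Rightarrow> 'w" and W :: "'w set"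
  assumes V: "fd_space sV V" and W: "fd_space sW W"
    and A: "A \<subseteq> V" and unit: "a \<in> A \<Longrightarrow> V.unit a = a"
begin

sublocale W: vector_space sW using W by (simp add: fd_space_def)

lemma tensor_subspace: "fun_vs.subspace (tensor_space sV sW V' W')"
  unfolding tensor_space_def by (rule fun_vs.subspace_span)

lemma pure_tensor_in: "v \<in> V' \<Longrightarrow> w \<in> W' \<Longrightarrow> pure_tensor sV sW v w \<in> tensor_space sV sW V' W'"
  unfolding tensor_space_def by (intro fun_vs.span_base) blast

lemma pure_tensor_linear:
  "pure_tensor sV sW (v + v') w = pure_tensor sV sW v w + pure_tensor sV sW v' w"
  "pure_tensor sV sW (sV c v) w = tscale c (pure_tensor sV sW v w)"
  "pure_tensor sV sW v (w + w') = pure_tensor sV sW v w + pure_tensor sV sW v w'"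
  "pure_tensor sV sW v (sW c w) = tscale c (pure_tensor sV sW v w)"
  using pure_tensor_bilinear(1)[of sV sW w] pure_tensor_bilinear(2)[of sW sV v]
  by (auto simp: linear_on_def)

lemma pure_tensor_0: "pure_tensor sV sW 0 w = 0" "pure_tensor sV sW v 0 = 0"
  using pure_tensor_linear(2)[of 0 0 w] pure_tensor_linear(4)[of v 0 0] by auto

lemma pure_tensor_sum_left: "pure_tensor sV sW (\<Sum>i\<in>L. x i) w = (\<Sum>i\<in>L. pure_tensor sV sW (x i) w)"
  by (induction L rule: infinite_finite_induct) (auto simp: pure_tensor_0 pure_tensor_linear)

lemma tensor_expansion:
  assumes "t \<in> tensor_space sV sW V W"
  obtains \<omega> where "\<forall>a\<in>A. \<omega> a \<in> W" "t = (\<Sum>a\<in>A. pure_tensor sV sW a (\<omega> a))"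
proof -
  have WS: "W.subspace W" using W by (simp add: fd_space_def)
  have "\<exists>\<omega>. (\<forall>a\<in>A. \<omega> a \<in> W) \<and> t = (\<Sum>a\<in>A. pure_tensor sV sW a (\<omega> a))"
    using assms unfolding tensor_space_def
  proof (induction rule: fun_vs.span_induct_alt)
    case base
    then show ?case using W.subspace_0[OF WS] by (intro exI[of _ "\<lambda>_. 0"]) (simp add: pure_tensor_0)
  next
    case (step c x y)
    then obtain v w \<omega> where x: "x = pure_tensor sV sW v w" "v \<in> V" "w \<in> W"
      and \<omega>: "\<forall>a\<in>A. \<omega> a \<in> W" "y = (\<Sum>a\<in>A. pure_tensor sV sW a (\<omega> a))" by blast
    have "x = pure_tensor sV sW (\<Sum>a\<in>A. sV (\<kappa> v a) a) w"
      using V.expansion[OF x(2)] x(1) unit by simp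
    then have "tscale c x + y = (\<Sum>a\<in>A. pure_tensor sV sW a (sW (c * \<kappa> v a) w + \<omega> a))"
      by (simp add: \<omega>(2) pure_tensor_sum_left pure_tensor_linear fun_vs.scale_sum_right sum.distrib)
    with \<omega>(1) x(3) show ?case
      by (intro exI[of _ "\<lambda>a. sW (c * \<kappa> v a) w + \<omega> a"])
        (auto intro: W.subspace_add[OF WS] W.subspace_scale[OF WS])
  qed
  with that show ?thesis by blast
qed

lemma fd_tensor_space: "fd_space tscale (tensor_space sV sW V W)"
proof -
  obtain C where C: "finite C" "C \<subseteq> W" "W.span C = W" using fd_space_basis[OF W] by metis
  let ?G = "(\<lambda>(a, c). pure_tensor sV sW a c) ` (A \<times> C)"
  have pure: "pure_tensor sV sW a w \<in> fun_vs.span ?G" if a: "a \<in> A" and w: "w \<in> W" for a w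
  proof -
    have "w \<in> W.span C" using w C(3) by simp
    then show ?thesis
    proof (induction rule: W.span_induct_alt)
      case base
      then show ?case by (simp only: pure_tensor_0 fun_vs.span_zero)
    next
      case (step c x y)
      have "pure_tensor sV sW a x \<in> fun_vs.span ?G"
        using a step(1) by (intro fun_vs.span_base) auto
      with step show ?case
        unfolding pure_tensor_linear by (intro fun_vs.span_add fun_vs.span_scale)
    qed
  qed
  have "fun_vs.span ?G = tensor_space sV sW V W"
  proof
    show "fun_vs.span ?G \<subseteq> tensor_space sV sW V W"
      using A C(2) by (intro fun_vs.span_minimal tensor_subspace) (auto intro: pure_tensor_in)
    show "tensor_space sV sW V W \<subseteq> fun_vs.span ?G"
    proof
      fix t assume "t \<in> tensor_space sV sW V W"
      then obtain \<omega> where \<omega>: "\<forall>a\<in>A. \<omega> a \<in> W" "t = (\<Sum>a\<in>A. pure_tensor sV sW a (\<omega> a))"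
        by (rule tensor_expansion)
      show "t \<in> fun_vs.span ?G" unfolding \<omega>(2) using pure \<omega>(1) by (intro fun_vs.span_sum) blast
    qed
  qed
  moreover have "finite ?G" using V.finite_coords C(1) by simp
  ultimately show ?thesis
    unfolding fd_space_def using tensor_subspace vector_space_tscale by blast
qed

lemma tensor_act_expansion:
  assumes \<phi>: "\<phi> \<in> endos sV V" and \<omega>: "\<forall>a\<in>A. \<omega> a \<in> W"
  shows "tensor_act sV sW V W \<phi> (\<Sum>a\<in>A. pure_tensor sV sW a (\<omega> a)) =
    (\<Sum>a\<in>A. pure_tensor sV sW (\<phi> a) (\<omega> a))"
proof -
  have "tensor_act sV sW V W \<phi> (\<Sum>a\<in>A. pure_tensor sV sW a (\<omega> a)) =
    (\<Sum>a\<in>A. tensor_act sV sW V W \<phi> (pure_tensor sV sW a (\<omega> a)))"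
    using A \<omega> by (intro linear_on_sum[OF tensor_act(1)[OF V W \<phi>] vector_space_tscale vector_space_tscale
      tensor_subspace] pure_tensor_in) auto
  also have "\<dots> = (\<Sum>a\<in>A. pure_tensor sV sW (\<phi> a) (\<omega> a))"
    using A \<omega> tensor_act(3)[OF V W \<phi>] by (intro sum.cong) auto
  finally show ?thesis .
qed

lemma tensor_act_in:
  assumes \<phi>: "\<phi> \<in> endos sV V" and t: "t \<in> tensor_space sV sW V W"
  shows "tensor_act sV sW V W \<phi> t \<in> tensor_space sV sW V W"
proof -
  obtain \<omega> where \<omega>: "\<forall>a\<in>A. \<omega> a \<in> W" "t = (\<Sum>a\<in>A. pure_tensor sV sW a (\<omega> a))"
    using t by (rule tensor_expansion)
  have "\<phi> a \<in> V" if "a \<in> A" for a using \<phi> A that by (auto simp: endos_def)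
  with \<omega>(1) show ?thesis
    unfolding tensor_act_expansion[OF \<phi> \<omega>(1), folded \<omega>(2)]
    by (intro fun_vs.subspace_sum[OF tensor_subspace] pure_tensor_in) auto
qed

lemma tensor_act_linear_endo:
  assumes t: "t \<in> tensor_space sV sW V W"
  shows "linear_on (fun_scale sV) tscale (endos sV V) (\<lambda>\<phi>. tensor_act sV sW V W \<phi> t)"
proof -
  obtain \<omega> where \<omega>: "\<forall>a\<in>A. \<omega> a \<in> W" "t = (\<Sum>a\<in>A. pure_tensor sV sW a (\<omega> a))"
    using t by (rule tensor_expansion)
  note S = chart.subspace_carrier[OF V.chart_endos]
  note F = vector_space_fun_scale[OF V.vector_space_axioms]
  interpret F: vector_space "fun_scale sV :: 'k \<Rightarrow> ('v \<Rightarrow> 'v) \<Rightarrow> 'v \<Rightarrow> 'v" by (rule F)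
  show ?thesis
    unfolding linear_on_def
  proof (intro conjI ballI allI)
    fix \<phi> \<psi> assume "\<phi> \<in> endos sV V" "\<psi> \<in> endos sV V"
    moreover from this have "\<phi> + \<psi> \<in> endos sV V" by (rule F.subspace_add[OF S])
    ultimately show "tensor_act sV sW V W (\<phi> + \<psi>) t = tensor_act sV sW V W \<phi> t + tensor_act sV sW V W \<psi> t"
      using \<omega>(1) unfolding \<omega>(2) by (simp add: tensor_act_expansion pure_tensor_linear sum.distrib)
  next
    fix c \<phi> assume "\<phi> \<in> endos sV V"
    moreover from this have "fun_scale sV c \<phi> \<in> endos sV V" by (rule F.subspace_scale[OF S])
    ultimately show "tensor_act sV sW V W (fun_scale sV c \<phi>) t = tscale c (tensor_act sV sW V W \<phi> t)"
      using \<omega>(1) unfolding \<omega>(2)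
      by (simp add: tensor_act_expansion pure_tensor_linear fun_vs.scale_sum_right fun_scale_def[of sV])
  qed
qed

text \<open>
  \<open>W'\<close> is the span of the second components in the expansion of \<open>t\<close> along a basis of \<open>V\<close>.
\<close>

lemma tensor_orbit:
  assumes t: "t \<in> tensor_space sV sW V W"
  obtains W' where "W.subspace W'" "W' \<subseteq> W"
    "(\<lambda>\<phi>. tensor_act sV sW V W \<phi> t) ` endos sV V = tensor_space sV sW V W'"
proof -
  obtain \<omega> where \<omega>: "\<forall>a\<in>A. \<omega> a \<in> W" "t = (\<Sum>a\<in>A. pure_tensor sV sW a (\<omega> a))"
    using t by (rule tensor_expansion)
  let ?W' = "W.span (\<omega> ` A)" and ?R = "(\<lambda>\<phi>. tensor_act sV sW V W \<phi> t) ` endos sV V"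
  have act: "tensor_act sV sW V W \<phi> t = (\<Sum>a\<in>A. pure_tensor sV sW (\<phi> a) (\<omega> a))" if "\<phi> \<in> endos sV V" for \<phi>
    unfolding \<omega>(2) by (rule tensor_act_expansion[OF that \<omega>(1)])
  note S = chart.subspace_carrier[OF V.chart_endos] and L = tensor_act_linear_endo[OF t]
  interpret F: vector_space "fun_scale sV :: 'k \<Rightarrow> ('v \<Rightarrow> 'v) \<Rightarrow> 'v \<Rightarrow> 'v"
    by (rule vector_space_fun_scale[OF V.vector_space_axioms])
  have R: "fun_vs.subspace ?R"
    unfolding fun_vs.subspace_def
  proof (intro conjI ballI allI)
    show "0 \<in> ?R"
      using linear_on_0[OF L F.vector_space_axioms vector_space_tscale S] F.subspace_0[OF S] by force
    fix x assume "x \<in> ?R"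
    then obtain \<phi> where \<phi>: "\<phi> \<in> endos sV V" "x = tensor_act sV sW V W \<phi> t" by blast
    {
      fix y assume "y \<in> ?R"
      then obtain \<psi> where \<psi>: "\<psi> \<in> endos sV V" "y = tensor_act sV sW V W \<psi> t" by blast
      show "x + y \<in> ?R"
        using L \<phi> \<psi> F.subspace_add[OF S \<phi>(1) \<psi>(1)] by (intro image_eqI[of _ _ "\<phi> + \<psi>"]) (auto simp: linear_on_def)
    }
    show "tscale c x \<in> ?R" for c
      using L \<phi> F.subspace_scale[OF S \<phi>(1)]
      by (intro image_eqI[of _ _ "fun_scale sV c \<phi>"]) (auto simp: linear_on_def)
  qed
  have pure: "pure_tensor sV sW v w \<in> ?R" if v: "v \<in> V" and w: "w \<in> ?W'" for v w
    using w
  proof (induction rule: W.span_induct_alt)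
    case base
    then show ?case using fun_vs.subspace_0[OF R] by (simp only: pure_tensor_0)
  next
    case (step c x y)
    then obtain a where a: "a \<in> A" "x = \<omega> a" by blast
    \<comment> \<open>The endomorphism that sends \<open>a\<close> to \<open>v\<close> and kills the
      other basis vectors isolates the component \<open>\<omega> a\<close>.\<close>
    have "\<forall>i\<in>A. (if i = a then v else 0) \<in> V" using v V.carrier_closed(1) by simp
    from V.endo_exists[OF this] obtain \<phi> where
      \<phi>: "\<phi> \<in> endos sV V" "\<forall>i\<in>A. \<phi> (V.unit i) = (if i = a then v else 0)" by blast
    have "tensor_act sV sW V W \<phi> t = (\<Sum>i\<in>A. if i = a then pure_tensor sV sW v (\<omega> i) else 0)"
      unfolding act[OF \<phi>(1)] using \<phi>(2) unit by (intro sum.cong) (auto simp: pure_tensor_0)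
    then have "tensor_act sV sW V W \<phi> t = pure_tensor sV sW v x" using a V.finite_coords by simp
    then have "pure_tensor sV sW v x \<in> ?R" using \<phi>(1) by force
    with step.IH show ?case
      unfolding pure_tensor_linear by (intro fun_vs.subspace_add[OF R] fun_vs.subspace_scale[OF R])
  qed
  show ?thesis
  proof
    show "W.subspace ?W'" by (rule W.subspace_span)
    show "?W' \<subseteq> W" using W \<omega>(1) by (intro W.span_minimal) (auto simp: fd_space_def)
    show "?R = tensor_space sV sW V ?W'"
    proof
      show "?R \<subseteq> tensor_space sV sW V ?W'"
      proof
        fix x assume "x \<in> ?R"
        then obtain \<phi> where \<phi>: "\<phi> \<in> endos sV V" "x = tensor_act sV sW V W \<phi> t" by blast
        have "\<phi> a \<in> V" if "a \<in> A" for a using \<phi>(1) A that by (auto simp: endos_def)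
        then show "x \<in> tensor_space sV sW V ?W'"
          unfolding \<phi>(2) act[OF \<phi>(1)]
          by (intro fun_vs.subspace_sum[OF tensor_subspace] pure_tensor_in) (auto intro: W.span_base)
      qed
      show "tensor_space sV sW V ?W' \<subseteq> ?R"
        unfolding tensor_space_def[of sV sW V ?W'] using pure by (intro fun_vs.span_minimal R) auto
    qed
  qed
qed

text \<open>Contracting the second factor with a functional \<open>g\<close> sends \<open>t\<close>
  to \<open>v\<close> and commutes with the action, so \<open>\<phi> v\<close> is the contraction of
  0. Choosing \<open>g\<close> nonzero on some component of \<open>t\<close> makes \<open>v\<close>
  nonzero.\<close>

lemma tensor_act_kernel:
  assumes \<phi>: "\<phi> \<in> endos sV V" and t: "t \<in> tensor_space sV sW V W" "t \<noteq> 0"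
    and 0: "tensor_act sV sW V W \<phi> t = 0"
  shows "\<exists>v\<in>V. v \<noteq> 0 \<and> \<phi> v = 0"
proof -
  obtain \<omega> where \<omega>: "\<forall>a\<in>A. \<omega> a \<in> W" "t = (\<Sum>a\<in>A. pure_tensor sV sW a (\<omega> a))"
    using t(1) by (rule tensor_expansion)
  from t(2) obtain a where a: "a \<in> A" "\<omega> a \<noteq> 0"
    unfolding \<omega>(2) by (metis (no_types, lifting) pure_tensor_0(2) sum.neutral)
  obtain g where g: "Vector_Spaces.linear sW (*) g" "g (\<omega> a) = 1"
    using separating_functional[OF W.vector_space_axioms a(2)] .
  define v where "v = (\<Sum>i\<in>A. sV (g (\<omega> i)) (V.unit i))"
  have v: "v \<in> V" unfolding v_def by (intro V.subspace_sum[OF V.subspace_carrier] V.carrier_closed V.unit_in)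
  have "V.unit i \<in> V" for i by (rule V.unit_in)
  then have "\<kappa> v a = (\<Sum>i\<in>A. if i = a then g (\<omega> i) else 0)"
    unfolding v_def using a(1)
    by (subst V.coord_sum) (auto simp: V.carrier_closed V.coord_scale V.unit_def V.point intro!: sum.cong)
  then have "\<kappa> v a = 1" using a(1) V.finite_coords g(2) by simp
  then have "v \<noteq> 0" using V.coord_0 by auto
  have "\<phi> v = 0"
  proof (rule ccontr)
    assume "\<phi> v \<noteq> 0"
    then obtain f where f: "Vector_Spaces.linear sV (*) f" "f (\<phi> v) = 1"
      using separating_functional[OF V.vector_space_axioms] by blast
    have lin: "linear_on sV sV V \<phi>" using \<phi> by (simp add: endos_def)
    have "\<phi> v = (\<Sum>i\<in>A. \<phi> (sV (g (\<omega> i)) (V.unit i)))"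
      unfolding v_def
      by (intro linear_on_sum[OF lin V.vector_space_axioms V.vector_space_axioms V.subspace_carrier]
          V.carrier_closed V.unit_in)
    also have "\<dots> = (\<Sum>i\<in>A. sV (g (\<omega> i)) (\<phi> i))"
      using lin A unit by (intro sum.cong) (auto simp: linear_on_def)
    finally have "f (\<phi> v) = (\<Sum>i\<in>A. g (\<omega> i) * f (\<phi> i))"
    proof -
      interpret f: Vector_Spaces.linear sV "(*)" f by (rule f(1))
      assume "\<phi> v = (\<Sum>i\<in>A. sV (g (\<omega> i)) (\<phi> i))"
      then show ?thesis by (simp add: f.sum f.scale)
    qed
    also have "\<dots> = (\<Sum>i\<in>A. pure_tensor sV sW (\<phi> i) (\<omega> i) (f, g))"
      using f(1) g(1) by (simp add: pure_tensor_def mult.commute)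
    also have "\<dots> = (\<Sum>i\<in>A. pure_tensor sV sW (\<phi> i) (\<omega> i)) (f, g)"
    proof -
      have "(\<Sum>i\<in>L. h i) x = (\<Sum>i\<in>L. h i x)" for L :: "'v set" and h :: "'v \<Rightarrow> ('k, 'v, 'w) tensor" and x
        by (induction L rule: infinite_finite_induct) auto
      then show ?thesis by simp
    qed
    also have "(\<Sum>i\<in>A. pure_tensor sV sW (\<phi> i) (\<omega> i)) = 0"
      using 0 tensor_act_expansion[OF \<phi> \<omega>(1), folded \<omega>(2)] by (simp only:)
    finally show False using f(2) by simp
  qed
  with v \<open>v \<noteq> 0\<close> show ?thesis by blast
qed

end

theorem theorem2p1:
  fixes sV :: "'k::alg_closed_field \<Rightarrow> 'v::ab_group_add \<Rightarrow> 'v"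
    and sW :: "'k \<Rightarrow> 'w::ab_group_add \<Rightarrow> 'w"
    and sU :: "'k \<Rightarrow> 'u::ab_group_add \<Rightarrow> 'u"
    and l :: nat
    and V :: "nat \<Rightarrow> 'v set" and W :: "nat \<Rightarrow> 'w set" and U :: "'u set"
    and T :: "(nat \<Rightarrow> ('k, 'v, 'w) tensor) \<Rightarrow> 'u"
    and X :: "nat \<Rightarrow> ('k, 'v, 'w) tensor set set"
  assumes "\<And>i. i \<in> {1..l} \<Longrightarrow> fd_space sV (V i)"
    and "\<And>i. i \<in> {1..l} \<Longrightarrow> fd_space sW (W i)"
    and "fd_space sU U"
    and "linear_on dscale sU (indexed_dsum l (\<lambda>i. tensor_space sV sW (V i) (W i))) T"
    and "T ` indexed_dsum l (\<lambda>i. tensor_space sV sW (V i) (W i)) \<subseteq> U"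
    and "right_omnipresent_max_rank sV sW l V W U T"
    and "\<And>i. i \<in> {1..l} \<Longrightarrow>
           locally_closedin (proj_zariski tscale (tensor_space sV sW (V i) (W i))) (X i)"
    and "\<And>i. i \<in> {1..l} \<Longrightarrow>
           irreducible_in (proj_zariski tscale (tensor_space sV sW (V i) (W i))) (X i)"
    and "(\<Sum>i=1..l. krull_dim (subtopology (zariski tscale (tensor_space sV sW (V i) (W i))) (affine_cone (X i))))
           \<le> enat (vector_space.dim sU U)"
  shows "\<exists>Z. closedin (zariski (bscale sV) (end_prod sV l V)) Z \<and> Z \<noteq> end_prod sV l V \<and>
           fst ` (snd -` proj_join l X \<inter> incidence sV sW l V W T) \<subseteq> Z"
proof (cases "l = 0")
  case True
  \<comment> \<open>Without summands there is no nonzero tuple, and the empty set is proper because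
    \<open>B\<close> contains 0.\<close>
  then have "proj_join l X = {}" by (auto simp: proj_join_def indexed_dsum_def fun_eq_iff)
  moreover have "0 \<in> end_prod sV l V" using True by (simp add: end_prod_def indexed_dsum_def)
  ultimately show ?thesis by (intro exI[of _ "{}"]) auto
next
  case False
  note V = assms(1) and W = assms(2)

  \<comment> \<open>Spaces and their coordinates\<close>
  define Q where "Q = (\<lambda>i. tensor_space sV sW (V i) (W i))"
  define D where "D = indexed_dsum l Q"
  define B where "B = end_prod sV l V"
  define ev where "ev = eval_map sV sW l V W"
  have TD: "linear_on dscale sU D T" "T ` D \<subseteq> U" using assms(4,5) by (simp_all add: D_def Q_def)
  have one: "1 \<in> {1..l}" using False by simp
  have sV: "vector_space sV" using V[OF one] by (simp add: fd_space_def)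
  have sU: "vector_space sU" using assms(3) by (simp add: fd_space_def)
  have "\<forall>i\<in>{1..l}. \<exists>\<kappa> A. tensor_chart sV (V i) \<kappa> A sW (W i)"
  proof
    fix i assume i: "i \<in> {1..l}"
    obtain \<kappa> A where "A \<subseteq> V i" "card A = vector_space.dim sV (V i)" "chart sV (V i) \<kappa> A"
      "\<And>a. a \<in> A \<Longrightarrow> chart.unit (V i) \<kappa> A a = a"
      by (rule fd_space_chart[OF V[OF i]]) (rule that)
    then have "tensor_chart sV (V i) \<kappa> A sW (W i)"
      by (intro tensor_chart.intro tensor_chart_axioms.intro V[OF i] W[OF i])
    then show "\<exists>\<kappa> A. tensor_chart sV (V i) \<kappa> A sW (W i)" by blast
  qed
  then obtain \<kappa>V A where tc: "\<And>i. i \<in> {1..l} \<Longrightarrow> tensor_chart sV (V i) (\<kappa>V i) (A i) sW (W i)" by metis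
  note chV = tensor_chart.axioms(1)[OF tc]
  have "\<forall>i\<in>{1..l}. \<exists>\<kappa> I. chart tscale (Q i) \<kappa> (I :: ('k, 'v, 'w) tensor set)"
    unfolding Q_def using fd_space_chart[OF tensor_chart.fd_tensor_space[OF tc]] by metis
  then obtain \<kappa>Q IQ where chQ: "\<And>i. i \<in> {1..l} \<Longrightarrow> chart tscale (Q i) (\<kappa>Q i) (IQ i :: ('k, 'v, 'w) tensor set)"
    by metis
  obtain \<kappa>U and IU :: "'u set" where IU: "card IU = vector_space.dim sU U" "chart sU U \<kappa>U IU"
    using fd_space_chart[OF assms(3)] by metis
  define \<kappa>D where "\<kappa>D = (\<lambda>x (i, b). if i \<in> {1..l} then \<kappa>Q i (x i) b else 0)"
  have chD: "chart dscale D \<kappa>D (Sigma {1..l} IQ)"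
    unfolding D_def \<kappa>D_def by (rule chart_dsum[OF vector_space_tscale chQ])
  define \<kappa>E where "\<kappa>E = (\<lambda>i \<phi> (a, a'). if a \<in> A i \<and> a' \<in> A i
    then \<kappa>V i (\<phi> (chart.unit (V i) (\<kappa>V i) (A i) a)) a' else 0)"
  have chE: "chart (fun_scale sV) (endos sV (V i)) (\<kappa>E i) (A i \<times> A i)" if "i \<in> {1..l}" for i
    unfolding \<kappa>E_def by (rule chart.chart_endos[OF chV[OF that]])
  define IB where "IB = Sigma {1..l} (\<lambda>i. A i \<times> A i)"
  define \<kappa>B where "\<kappa>B = (\<lambda>b (i, p). if i \<in> {1..l} then \<kappa>E i (b i) p else 0)"
  have chB: "chart (bscale sV) B \<kappa>B IB"
    unfolding B_def end_prod_def \<kappa>B_def IB_def by (rule chart_dsum[OF vector_space_fun_scale[OF sV] chE])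
  interpret U: chart sU U \<kappa>U IU by (rule IU(2))
  interpret D: chart dscale D \<kappa>D "Sigma {1..l} IQ" by (rule chD)
  interpret B: chart "bscale sV" B \<kappa>B IB by (rule chB)

  \<comment> \<open>Bilinearity of the evaluation map\<close>
  have Bi: "b i \<in> endos sV (V i)" if "b \<in> B" "i \<in> {1..l}" for b i
    using that by (simp add: B_def end_prod_def indexed_dsum_def)
  have Di: "x i \<in> Q i" if "x \<in> D" "i \<in> {1..l}" for x i
    using that by (simp add: D_def indexed_dsum_def)
  have ev: "ev b x i = tensor_act sV sW (V i) (W i) (b i) (x i)" if "i \<in> {1..l}" for b x i
    using that by (simp add: ev_def eval_map_def)
  have ev0: "ev b x i = 0" if "i \<notin> {1..l}" for b x i
    unfolding ev_def eval_map_def using that by (rule if_not_P)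
  have act_in: "ev b x i \<in> Q i" if "b \<in> B" "x \<in> D" "i \<in> {1..l}" for b x i
    unfolding ev[OF that(3)] Q_def
    using tensor_chart.tensor_act_in[OF tc] Bi Di that by (simp add: Q_def)
  have ev_in: "ev b x \<in> D" if "b \<in> B" "x \<in> D" for b x
    unfolding D_def indexed_dsum_def using act_in[OF that] ev0 by blast
  have evD: "linear_on dscale dscale D (ev b)" if b: "b \<in> B" for b
  proof -
    have L: "linear_on tscale tscale (Q i) (tensor_act sV sW (V i) (W i) (b i))" if "i \<in> {1..l}" for i
      unfolding Q_def by (rule tensor_act(1)[OF V[OF that] W[OF that] Bi[OF b that]])
    have "ev b (x + y) i = (ev b x + ev b y) i" if "x \<in> D" "y \<in> D" for x y i
      using L[of i] Di[OF that(1), of i] Di[OF that(2), of i]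
      by (cases "i \<in> {1..l}") (simp_all add: ev ev0 linear_on_def)
    moreover have "ev b (dscale c x) i = dscale c (ev b x) i" if "x \<in> D" for c x i
      using L[of i] Di[OF that, of i]
      by (cases "i \<in> {1..l}") (simp_all add: ev ev0 linear_on_def fun_scale_def[of tscale])
    ultimately show ?thesis by (auto simp: linear_on_def fun_eq_iff[where 'a = nat])
  qed
  have evB: "linear_on (bscale sV) dscale B (\<lambda>b. ev b x)" if x: "x \<in> D" for x
  proof -
    have L: "linear_on (fun_scale sV) tscale (endos sV (V i)) (\<lambda>\<phi>. tensor_act sV sW (V i) (W i) \<phi> (x i))"
      if "i \<in> {1..l}" for i
      using tensor_chart.tensor_act_linear_endo[OF tc] Di x that by (simp add: Q_def)
    have "ev (b + b') x i = (ev b x + ev b' x) i" if "b \<in> B" "b' \<in> B" for b b' i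
      using L[of i] Bi[OF that(1), of i] Bi[OF that(2), of i]
      by (cases "i \<in> {1..l}") (simp_all add: ev ev0 linear_on_def)
    moreover have "ev (bscale sV c b) x i = dscale c (ev b x) i" if "b \<in> B" for c b i
      using L[of i] Bi[OF that, of i]
      by (cases "i \<in> {1..l}") (simp_all add: ev ev0 linear_on_def fun_scale_def[of tscale] fun_scale_def[of "fun_scale sV"])
    ultimately show ?thesis by (auto simp: linear_on_def fun_eq_iff[where 'a = nat])
  qed
  have \<mu>B: "linear_on (bscale sV) sU B (\<lambda>b. T (ev b x))" if "x \<in> D" for x
    using evB[OF that] TD(1) ev_in[OF _ that] by (simp add: linear_on_def)
  have \<mu>D: "linear_on dscale sU D (\<lambda>x. T (ev b x))" if "b \<in> B" for b
    using evD[OF that] TD(1) ev_in[OF that] by (simp add: linear_on_def)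

  \<comment> \<open>Growth of the product of the cones\<close>
  have pc: "projective_chart tscale (Q i) (\<kappa>Q i) (IQ i) (X i)" if "i \<in> {1..l}" for i
    using assms(7,8)[OF that]
    by (intro projective_chart.intro chQ[OF that] projective_chart_axioms.intro) (simp_all add: Q_def)
  define kd where "kd = (\<lambda>i. krull_dim (subtopology (zariski tscale (Q i)) (affine_cone (X i))))"
  have kd: "(\<Sum>i=1..l. kd i) \<le> enat (card IU)" using assms(9) by (simp add: kd_def Q_def IU(1))
  have kd_le: "kd i \<le> enat (card IU)" if "i \<in> {1..l}" for i
    using member_le_sum[of i "{1..l}" kd] that kd by (auto intro: order_trans)
  then have "\<exists>c. kd i = enat c" if "i \<in> {1..l}" for i using that by (metis enat_ile)
  then obtain c where c: "\<And>i. i \<in> {1..l} \<Longrightarrow> kd i = enat (c i)" by metis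
  have sum_enat: "(\<Sum>i\<in>S. enat (c i)) = enat (\<Sum>i\<in>S. c i)" for S
    by (induction S rule: infinite_finite_induct) (auto simp: zero_enat_def)
  have c_sum: "(\<Sum>i\<in>{1..l}. c i) \<le> card IU"
    using kd c sum_enat[of "{1..l}"] by (simp cong: sum.cong_simp)
  have "1 \<le> kd 1" using projective_chart.cone_dim_pos[OF pc[OF one]] by (simp add: kd_def)
  with kd_le[OF one] have "1 \<le> card IU" by (metis enat_ord_simps(1) one_enat_def order_trans)
  then have IU0: "IU \<noteq> {}" by auto
  define C where "C = {z. \<forall>i\<in>{1..l}. (\<lambda>b. z (i, b)) \<in> \<kappa>Q i ` affine_cone (X i)}"
  have C_cone: "(\<lambda>p. r * z p) \<in> C" if "z \<in> C" for r z
    unfolding C_def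
  proof (intro CollectI ballI)
    fix i assume i: "i \<in> {1..l}"
    interpret projective_chart tscale "Q i" "\<kappa>Q i" "IQ i" "X i" by (rule pc[OF i])
    from that i have "(\<lambda>b. z (i, b)) \<in> \<kappa>Q i ` affine_cone (X i)" unfolding C_def by blast
    then obtain y where y: "y \<in> affine_cone (X i)" "(\<lambda>b. z (i, b)) = \<kappa>Q i y" by blast
    then have "(\<lambda>b. r * z (i, b)) = \<kappa>Q i (tscale r y)"
      using cone_subset coord_scale[of y r] by (auto simp: fun_eq_iff)
    with cone_scale[OF y(1)] show "(\<lambda>b. r * z (i, b)) \<in> \<kappa>Q i ` affine_cone (X i)" by blast
  qed
  have C_growth: "growth_le (Sigma {1..l} IQ) C (card IU)"
  proof (rule growth_le_mono[OF _ c_sum])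
    show "growth_le (Sigma {1..l} IQ) C (\<Sum>i\<in>{1..l}. c i)"
      unfolding C_def
      using c projective_chart.growth_le_cone_dim[OF pc] by (intro growth_le_Sigma) (auto simp: kd_def)
  qed

  \<comment> \<open>Polynomials for the two cases of maximal rank\<close>
  have F0: "\<exists>F\<in>pf IB. F \<noteq> 0 \<and> (\<forall>x\<in>D. \<kappa>D x \<in> C \<longrightarrow> (\<lambda>b. T (ev b x)) ` B = U \<longrightarrow>
      (\<forall>b\<in>B. T (ev b x) = 0 \<longrightarrow> F (\<kappa>B b) = 0))"
    using TD(2) ev_in
    by (intro bilinear_kernel_not_dense[OF chD chB IU(2) \<mu>B \<mu>D _ C_cone C_growth IU0]) auto
  have F1: "\<exists>F\<in>pf IB. F \<noteq> 0 \<and> (\<forall>v\<in>V i. v \<noteq> 0 \<longrightarrow> (\<forall>b\<in>B. b i v = 0 \<longrightarrow> F (\<kappa>B b) = 0))"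
    if i: "i \<in> {1..l}" for i
  proof -
    interpret Vi: chart sV "V i" "\<kappa>V i" "A i" by (rule chV[OF i])
    have bV: "b i v \<in> V i" if "b \<in> B" "v \<in> V i" for b v
      using Bi[OF that(1) i] that(2) by (auto simp: endos_def)
    show ?thesis
    proof (cases "A i = {}")
      case True
      then have "v = 0" if "v \<in> V i" for v
        using Vi.coord_inj[OF that Vi.carrier_closed(1)] by simp
      then show ?thesis by (intro bexI[of _ 1] conjI ballI impI one_neq_zero pf_closed(2)) blast
    next
      case False
      \<comment> \<open>The balance is exact here as well: \<open>b i v = 0\<close> amounts to dim
        \<open>V i\<close> equations, and the growth exponent of the full space of all
        \<open>v\<close> is the same number.\<close>
      have F: "\<exists>F\<in>pf IB. F \<noteq> 0 \<and> (\<forall>v\<in>V i. \<kappa>V i v \<in> UNIV \<longrightarrow> (\<lambda>b. b i v) ` B = V i \<longrightarrow>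
          (\<forall>b\<in>B. b i v = 0 \<longrightarrow> F (\<kappa>B b) = 0))"
        using Bi[OF _ i] bV
        by (intro bilinear_kernel_not_dense[OF chV[OF i] chB chV[OF i] _ _ _ _ growth_le_UNIV[OF Vi.finite_coords] False])
          (auto simp: linear_on_def endos_def fun_scale_def[of "fun_scale sV"] fun_scale_def[of sV])
      have orbit: "(\<lambda>b. b i v) ` B = V i" if v: "v \<in> V i" "v \<noteq> 0" for v
      proof
        show "(\<lambda>b. b i v) ` B \<subseteq> V i" using bV v(1) by blast
        show "V i \<subseteq> (\<lambda>b. b i v) ` B"
        proof
          fix y assume "y \<in> V i"
          then obtain \<phi> where \<phi>: "\<phi> \<in> endos sV (V i)" "\<phi> v = y" by (rule Vi.endo_transitive[OF v])
          have "0 \<in> endos sV (V j)" if "j \<in> {1..l}" for j by (rule chart.carrier_closed(1)[OF chE[OF that]])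
          with \<phi>(1) i have "(\<lambda>j. if j = i then \<phi> else 0) \<in> B"
            by (simp add: B_def end_prod_def indexed_dsum_def)
          then show "y \<in> (\<lambda>b. b i v) ` B"
            using \<phi>(2) by (intro image_eqI[of _ _ "\<lambda>j. if j = i then \<phi> else 0"]) simp_all
        qed
      qed
      from F obtain G where "G \<in> pf IB" "G \<noteq> 0" and G: "\<forall>v\<in>V i. \<kappa>V i v \<in> UNIV \<longrightarrow> (\<lambda>b. b i v) ` B = V i \<longrightarrow>
          (\<forall>b\<in>B. b i v = 0 \<longrightarrow> G (\<kappa>B b) = 0)" by (elim bexE conjE)
      then show ?thesis
        using G[rule_format, OF _ UNIV_I orbit] by (intro bexI[of _ G] conjI ballI impI) simp_all
    qed
  qed
  \<comment> \<open>Index 0 is free for the surjective case, the summands being numbered from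
    1.\<close>
  define Zs where "Zs = (\<lambda>i. if i = 0
    then {\<kappa>B b |b. b \<in> B \<and> (\<exists>x\<in>D. \<kappa>D x \<in> C \<and> (\<lambda>b. T (ev b x)) ` B = U \<and> T (ev b x) = 0)}
    else {\<kappa>B b |b. b \<in> B \<and> (\<exists>v\<in>V i. v \<noteq> 0 \<and> b i v = 0)})"
  have "\<exists>F\<in>pf IB. F \<noteq> 0 \<and> (\<forall>i\<in>{0..l}. \<forall>z\<in>Zs i. F z = 0)"
  proof (rule pf_vanishing_union)
    fix i assume i: "i \<in> {0..l}"
    show "\<exists>F\<in>pf IB. F \<noteq> 0 \<and> (\<forall>z\<in>Zs i. F z = 0)"
    proof (cases "i = 0")
      case True
      from F0 obtain F where "F \<in> pf IB" "F \<noteq> 0" "\<forall>x\<in>D. \<kappa>D x \<in> C \<longrightarrow> (\<lambda>b. T (ev b x)) ` B = U \<longrightarrow>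
        (\<forall>b\<in>B. T (ev b x) = 0 \<longrightarrow> F (\<kappa>B b) = 0)" by blast
      then show ?thesis by (intro bexI[of _ F]) (auto simp add: Zs_def True)
    next
      case False
      with i have "i \<in> {1..l}" by simp
      from F1[OF this] obtain F where "F \<in> pf IB" "F \<noteq> 0"
        "\<forall>v\<in>V i. v \<noteq> 0 \<longrightarrow> (\<forall>b\<in>B. b i v = 0 \<longrightarrow> F (\<kappa>B b) = 0)" by blast
      then show ?thesis using False by (intro bexI[of _ F]) (auto simp add: Zs_def)
    qed
  qed simp
  then obtain F where F: "F \<in> pf IB" "F \<noteq> 0" and FZ: "\<And>i z. i \<le> l \<Longrightarrow> z \<in> Zs i \<Longrightarrow> F z = 0" by auto

  \<comment> \<open>The proper closed subset\<close>
  show ?thesis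
  proof (intro exI conjI)
    show "closedin (zariski (bscale sV) (end_prod sV l V)) {b \<in> B. \<forall>f\<in>{\<lambda>b. F (\<kappa>B b)}. f b = 0}"
      unfolding closedin_zariski B_def[symmetric] using B.pf_polyfun[OF F(1)]
      by (intro exI[of _ "{\<lambda>b. F (\<kappa>B b)}"]) simp
    \<comment> \<open>A point where \<open>F\<close> is nonzero is the coordinate vector of an
      element of \<open>B\<close>, so the closed set is proper.\<close>
    from F(2) obtain z where z: "F z \<noteq> 0" by (auto simp: fun_eq_iff)
    have "F (\<kappa>B (B.point z)) = F z" using F(1) by (rule pf_cong) (simp add: B.point)
    with z have "B.point z \<notin> {b \<in> B. \<forall>f\<in>{\<lambda>b. F (\<kappa>B b)}. f b = 0}" by simp
    with B.point(1)[of z] show "{b \<in> B. \<forall>f\<in>{\<lambda>b. F (\<kappa>B b)}. f b = 0} \<noteq> end_prod sV l V"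
      unfolding B_def[symmetric] by metis
    show "fst ` (snd -` proj_join l X \<inter> incidence sV sW l V W T) \<subseteq> {b \<in> B. \<forall>f\<in>{\<lambda>b. F (\<kappa>B b)}. f b = 0}"
    proof
      fix b assume "b \<in> fst ` (snd -` proj_join l X \<inter> incidence sV sW l V W T)"
      then obtain L where "(b, L) \<in> incidence sV sW l V W T" "L \<in> proj_join l X" by auto
      then have b: "b \<in> B" and inc: "\<And>x. x \<in> L \<Longrightarrow> x \<noteq> 0 \<Longrightarrow> T (ev b x) = 0"
        and "L \<in> proj_join l X" by (auto simp: incidence_def B_def ev_def)
      then obtain x where x: "L = D.span {x}" "x \<in> indexed_dsum l (\<lambda>i. affine_cone (X i))" "x \<noteq> 0"
        by (auto simp: proj_join_def)
      have Tx: "T (ev b x) = 0" using x inc by (auto intro: D.span_base)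
      have xi: "x i \<in> affine_cone (X i)" if "i \<in> {1..l}" for i
        using x(2) that by (simp add: indexed_dsum_def)
      have x0: "x i = 0" if "i \<notin> {1..l}" for i
        using x(2) that unfolding indexed_dsum_def by blast
      have xD: "x \<in> D"
        unfolding D_def indexed_dsum_def using xi x0 projective_chart.cone_subset[OF pc] by blast
      have xC: "\<kappa>D x \<in> C" using xi by (auto simp: C_def \<kappa>D_def)
      have "\<forall>i\<in>{1..l}. \<exists>W'. module.subspace sW W' \<and> W' \<subseteq> W i \<and>
          (\<lambda>\<phi>. tensor_act sV sW (V i) (W i) \<phi> (x i)) ` endos sV (V i) = tensor_space sV sW (V i) W'"
      proof
        fix i assume i: "i \<in> {1..l}"
        from Di[OF xD i] have "x i \<in> tensor_space sV sW (V i) (W i)" by (simp add: Q_def)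
        from tensor_chart.tensor_orbit[OF tc[OF i] this]
        show "\<exists>W'. module.subspace sW W' \<and> W' \<subseteq> W i \<and>
          (\<lambda>\<phi>. tensor_act sV sW (V i) (W i) \<phi> (x i)) ` endos sV (V i) = tensor_space sV sW (V i) W'" by metis
      qed
      then obtain W' where W': "\<And>i. i \<in> {1..l} \<Longrightarrow> module.subspace sW (W' i) \<and> W' i \<subseteq> W i"
        "\<And>i. i \<in> {1..l} \<Longrightarrow> (\<lambda>\<phi>. tensor_act sV sW (V i) (W i) \<phi> (x i)) ` endos sV (V i) =
          tensor_space sV sW (V i) (W' i)" by metis
      define D' where "D' = indexed_dsum l (\<lambda>i. tensor_space sV sW (V i) (W' i))"
      have orbit: "(\<lambda>b. ev b x) ` B = D'"
      proof
        show "(\<lambda>b. ev b x) ` B \<subseteq> D'"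
        proof
          fix y assume "y \<in> (\<lambda>b. ev b x) ` B"
          then obtain b where "b \<in> B" "y = ev b x" by blast
          then show "y \<in> D'"
            unfolding D'_def indexed_dsum_def using W'(2) Bi ev ev0 by fastforce
        qed
        show "D' \<subseteq> (\<lambda>b. ev b x) ` B"
        proof
          fix y assume y: "y \<in> D'"
          have "\<forall>i\<in>{1..l}. \<exists>\<phi>\<in>endos sV (V i). y i = tensor_act sV sW (V i) (W i) \<phi> (x i)"
          proof
            fix i assume i: "i \<in> {1..l}"
            then have "y i \<in> tensor_space sV sW (V i) (W' i)" using y by (simp add: D'_def indexed_dsum_def)
            with W'(2)[OF i] show "\<exists>\<phi>\<in>endos sV (V i). y i = tensor_act sV sW (V i) (W i) \<phi> (x i)" by blast
          qed
          then obtain \<phi> where \<phi>: "\<And>i. i \<in> {1..l} \<Longrightarrow> \<phi> i \<in> endos sV (V i)"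
            "\<And>i. i \<in> {1..l} \<Longrightarrow> y i = tensor_act sV sW (V i) (W i) (\<phi> i) (x i)" by metis
          define b' where "b' = (\<lambda>i. if i \<in> {1..l} then \<phi> i else 0)"
          have "b' \<in> B" using \<phi>(1) by (simp add: B_def end_prod_def indexed_dsum_def b'_def)
          moreover have "ev b' x = y"
          proof
            fix i
            show "ev b' x i = y i"
            proof (cases "i \<in> {1..l}")
              case True
              then show ?thesis using \<phi>(2)[OF True] by (simp add: ev b'_def)
            next
              case False
              then have "y i = 0" using y unfolding D'_def indexed_dsum_def by blast
              with ev0[OF False] show ?thesis by simp
            qed
          qed
          ultimately show "y \<in> (\<lambda>b. ev b x) ` B" by blast
        qed
      qed
      have "max_rank T D' U"
        using assms(6) W'(1) unfolding right_omnipresent_max_rank_def D'_def by blast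
      then have "F (\<kappa>B b) = 0"
        unfolding max_rank_def
      proof
        assume "T ` D' = U"
        then have "(\<lambda>b. T (ev b x)) ` B = U" unfolding orbit[symmetric] image_image .
        then have "\<kappa>B b \<in> Zs 0" using b xD xC Tx by (auto simp: Zs_def)
        then show ?thesis using FZ by blast
      next
        \<comment> \<open>Both \<open>ev b x\<close> and 0 lie in \<open>D'\<close>, so
          \<open>T (ev b x) = 0\<close> forces \<open>ev b x = 0\<close>. A nonzero component
          \<open>x i\<close> is then killed by \<open>b i\<close>, which puts \<open>b\<close> into
          the singular locus \<open>Zs i\<close>.\<close>
        assume inj: "inj_on T D'"
        have "ev 0 x = 0" by (rule linear_on_0[OF evB[OF xD] B.vector_space_axioms D.vector_space_axioms B.subspace_carrier])
        then have "0 \<in> D'" unfolding orbit[symmetric] using B.carrier_closed(1) by force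
        moreover have "ev b x \<in> D'" unfolding orbit[symmetric] using b by blast
        moreover have "T 0 = 0" by (rule linear_on_0[OF TD(1) D.vector_space_axioms sU D.subspace_carrier])
        ultimately have ev0x: "ev b x = 0" using inj Tx by (metis inj_onD)
        from x(3) obtain i where i0: "x i \<noteq> 0" by (auto simp: fun_eq_iff[where 'a = nat])
        then have i: "i \<in> {1..l}" using x0 by blast
        have "tensor_act sV sW (V i) (W i) (b i) (x i) = 0"
          using ev[OF i, of b x] ev0x by (metis zero_fun_apply)
        with tensor_chart.tensor_act_kernel[OF tc[OF i] Bi[OF b i] _ i0]
          Di[OF xD i] obtain v where "v \<in> V i" "v \<noteq> 0" "b i v = 0" by (auto simp: Q_def)
        then have "\<kappa>B b \<in> Zs i" using b i by (auto simp: Zs_def)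
        with i show ?thesis using FZ by auto
      qed
      with b show "b \<in> {b \<in> B. \<forall>f\<in>{\<lambda>b. F (\<kappa>B b)}. f b = 0}" by simp
    qed
  qed
qed

end
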